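(* Let $H$ be a bialgebra over a field $k$ and let $D$ be a vector space, equipped with linear maps (candidate left and right $H$-actions, left and right $H$-coactions, multiplication, unit, comultiplication and counit) $h\otimes d\mapsto h\cdot d$, $d\otimes h\mapsto d\cdot h$, $\lambda(d)=d^{(-1)}\otimes d^{(0)}\in H\otimes D$, $\rho(d)=d^{<0>}\otimes d^{<1>}\in D\otimes H$, $c\otimes d\mapsto cd$, $1_D\in D$, $\Delta_D(d)=d_1\otimes d_2\in D\otimes D$, $\varepsilon_D:D\to k$. Then $(H,D)$ is an L-R-admissible pair if and only if $D$ (with these structures) is a bialgebra in the prebraided category $\mathcal{LR}(H)$ satisfying $$c^{<0>}\cdot d^{(-1)}\otimes c^{<1>}\cdot d^{(0)}=c\otimes d\qquad\text{for all } c,d\in D.$$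
   Context: Everything is over a field $k$, $\otimes=\otimes_k$. For a bialgebra $H$ write $\Delta(h)=h_1\otimes h_2$ and $\varepsilon_H=\varepsilon$ for its counit. **L-R-admissible pairs.** Consider the following conditions on $D$. (i) $D$ is an $H$-bimodule, with actions $h\otimes d\mapsto h\cdot d$ and $d\otimes h\mapsto d\cdot h$. (ii) $D$ is an (associative unital) algebra with unit $1_D$ and multiplication $c\otimes d\mapsto cd$. (iii) $D$ is an $H$-bimodule algebra: $h\cdot 1_D=\varepsilon(h)1_D$, $1_D\cdot h=\varepsilon(h)1_D$, $h\cdot(cd)=(h_1\cdot c)(h_2\cdot d)$, $(cd)\cdot h=(c\cdot h_1)(d\cdot h_2)$ for all $h\in H$, $c,d\in D$. (iv) $D$ is an $H$-bicomodule, with right coaction $\rho(d)=d^{<0>}\otimes d^{<1>}$ and left coaction $\lambda(d)=d^{(-1)}\otimes d^{(0)}$. (v) $D$ is a (coassociative counital) coalgebra with comultiplication $\Delta_D(d)=d_1\otimes d_2$ and counit $\varepsilon_D$. (vi) $D$ is an $H$-bicomodule coalgebra: for all $d\in D$, $d_1^{(-1)}d_2^{(-1)}\otimes d_1^{(0)}\otimes d_2^{(0)}=d^{(-1)}\otimes(d^{(0)})_1\otimes(d^{(0)})_2$, $d^{(-1)}\varepsilon_D(d^{(0)})=\varepsilon_D(d)1_H$, $d_1^{<0>}\otimes d_2^{<0>}\otimes d_1^{<1>}d_2^{<1>}=(d^{<0>})_1\otimes(d^{<0>})_2\otimes d^{<1>}$, $\varepsilon_D(d^{<0>})d^{<1>}=\varepsilon_D(d)1_H$.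 $(H,D)$ is called an L-R-admissible pair if (i)–(vi) hold and moreover, for all $h\in H$ and $c,d\in D$: - $\varepsilon_D(1_D)=1$, $\varepsilon_D(cd)=\varepsilon_D(c)\varepsilon_D(d)$; - $\varepsilon_D(h\cdot d)=\varepsilon_D(d\cdot h)=\varepsilon_D(d)\varepsilon_H(h)$; - $\rho(1_D)=1_D\otimes 1_H$, $\lambda(1_D)=1_H\otimes 1_D$; - $\Delta_D(1_D)=1_D\otimes 1_D$; - $\rho(cd)=c^{<0>}d^{<0>}\otimes c^{<1>}d^{<1>}$; - $\lambda(cd)=c^{(-1)}d^{(-1)}\otimes c^{(0)}d^{(0)}$; - $\Delta_D(h\cdot d)=h_1\cdot d_1\otimes h_2\cdot d_2$; - $\Delta_D(d\cdot h)=d_1\cdot h_1\otimes d_2\cdot h_2$; - $\Delta_D(cd)=c_1(c_2^{(-1)}\cdot d_1^{<0>})\otimes(c_2^{(0)}\cdot d_1^{<1>})d_2$; - $(h_1\cdot d)^{(-1)}h_2\otimes(h_1\cdot d)^{(0)}=h_1d^{(-1)}\otimes h_2\cdot d^{(0)}$; - $(h\cdot d)^{<0>}\otimes(h\cdot d)^{<1>}=h\cdot d^{<0>}\otimes d^{<1>}$; - $(d\cdot h_2)^{<0>}\otimes h_1(d\cdot h_2)^{<1>}=d^{<0>}\cdot h_1\otimes d^{<1>}h_2$; - $(d\cdot h)^{(-1)}\otimes(d\cdot h)^{(0)}=d^{(-1)}\otimes d^{(0)}\cdot h$; - $c^{<0>}\cdot d^{(-1)}\otimes c^{<1>}\cdot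 d^{(0)}=c\otimes d$. **The category $\mathcal{LR}(H)$.** Objects are vector spaces $M$ endowed with $H$-bimodule and $H$-bicomodule structures, denoted $h\otimes m\mapsto h\cdot m$, $m\otimes h\mapsto m\cdot h$, $m\mapsto m^{(-1)}\otimes m^{(0)}\in H\otimes M$, $m\mapsto m^{<0>}\otimes m^{<1>}\in M\otimes H$, such that for all $h\in H$, $m\in M$: - $(h_1\cdot m)^{(-1)}h_2\otimes(h_1\cdot m)^{(0)}=h_1m^{(-1)}\otimes h_2\cdot m^{(0)}$, - $(h\cdot m)^{<0>}\otimes(h\cdot m)^{<1>}=h\cdot m^{<0>}\otimes m^{<1>}$, - $(m\cdot h_2)^{<0>}\otimes h_1(m\cdot h_2)^{<1>}=m^{<0>}\cdot h_1\otimes m^{<1>}h_2$, - $(m\cdot h)^{(-1)}\otimes(m\cdot h)^{(0)}=m^{(-1)}\otimes m^{(0)}\cdot h$. Morphisms are the $H$-bilinear $H$-bicolinear maps. $\mathcal{LR}(H)$ is a (strict) monoidal category with unit $k$ (with the usual structures given by $\varepsilon$ and $1_H$) and tensor product $M\otimes N$ with structures - $h\cdot(m\otimes n)=h_1\cdot m\otimes h_2\cdot n$, $\ (m\otimes n)\cdot h=m\cdot h_1\otimes n\cdot h_2$, - $(m\otimes n)^{(-1)}\otimes(m\otimes n)^{(0)}=m^{(-1)}n^{(-1)}\otimes(m^{(0)}\otimes n^{(0)})$, - $(m\otimes n)^{<0>}\otimes(m\otimes n)^{<1>}=(m^{<0>}\otimes n^{<0>})\otimes m^{<1>}n^{<1>}$.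 It is prebraided (the braiding need not be invertible) via $c_{M,N}:M\otimes N\to N\otimes M$, $c_{M,N}(m\otimes n)=m^{(-1)}\cdot n^{<0>}\otimes m^{(0)}\cdot n^{<1>}$. A bialgebra in a prebraided category is an object $D$ that is an algebra and a coalgebra in the category (structure maps are morphisms of the category) such that the comultiplication and counit are algebra maps, where $D\otimes D$ carries the multiplication $(\mu\otimes\mu)\circ(\mathrm{id}\otimes c_{D,D}\otimes\mathrm{id})$, with $\mu$ the multiplication of $D$. *)

theory Defs
  imports "HOL-Algebra.AbelCoset" "Jordan_Normal_Form.Missing_VectorSpace"
begin

section \<open>Tensor products of vector spaces\<close>

text \<open>
  \<open>V \<otimes> W\<close> is the free vector space on \<open>carrier V \<times> carrier W\<close> modulo the subspace spanned by the
  bilinearity relations; its elements are cosets of finitely supported functions.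
\<close>

type_synonym ('k, 'v, 'w) tens = "('v \<times> 'w \<Rightarrow> 'k) set"

definition free_vs :: "('k, 'r) ring_scheme \<Rightarrow> 'x set \<Rightarrow> ('k, 'x \<Rightarrow> 'k) module" where
  "free_vs K S =
    \<lparr>carrier = {f. range f \<subseteq> carrier K \<and> {x. f x \<noteq> \<zero>\<^bsub>K\<^esub>} \<subseteq> S \<and> finite {x. f x \<noteq> \<zero>\<^bsub>K\<^esub>}},
     mult = undefined, one = undefined,
     zero = (\<lambda>x. \<zero>\<^bsub>K\<^esub>),
     add = (\<lambda>f g x. f x \<oplus>\<^bsub>K\<^esub> g x),
     smult = (\<lambda>a f x. a \<otimes>\<^bsub>K\<^esub> f x)\<rparr>"

definition single :: "('k, 'r) ring_scheme \<Rightarrow> 'x \<Rightarrow> 'x \<Rightarrow> 'k" where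
  "single K x = (\<lambda>y. if y = x then \<one>\<^bsub>K\<^esub> else \<zero>\<^bsub>K\<^esub>)"

definition quot_vs :: "('k, 'v, 'm) module_scheme \<Rightarrow> 'v set \<Rightarrow> ('k, 'v set) module" where
  "quot_vs V U =
    \<lparr>carrier = a_rcosets\<^bsub>V\<^esub> U,
     mult = undefined, one = undefined,
     zero = U,
     add = (\<lambda>X Y. X <+>\<^bsub>V\<^esub> Y),
     smult = (\<lambda>a X. \<Union>x\<in>X. U +>\<^bsub>V\<^esub> (a \<odot>\<^bsub>V\<^esub> x))\<rparr>"

definition bilinear_rels ::
  "('k, 'r) ring_scheme \<Rightarrow> ('k, 'v, 'm) module_scheme \<Rightarrow> ('k, 'w, 'n) module_scheme
    \<Rightarrow> ('v \<times> 'w \<Rightarrow> 'k) set" where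
  "bilinear_rels K V W =
    (let F = free_vs K (carrier V \<times> carrier W); e = (\<lambda>v w. single K (v, w)) in
      {e (v \<oplus>\<^bsub>V\<^esub> v') w \<ominus>\<^bsub>F\<^esub> (e v w \<oplus>\<^bsub>F\<^esub> e v' w) | v v' w.
          v \<in> carrier V \<and> v' \<in> carrier V \<and> w \<in> carrier W}
    \<union> {e v (w \<oplus>\<^bsub>W\<^esub> w') \<ominus>\<^bsub>F\<^esub> (e v w \<oplus>\<^bsub>F\<^esub> e v w') | v w w'.
          v \<in> carrier V \<and> w \<in> carrier W \<and> w' \<in> carrier W}
    \<union> {e (a \<odot>\<^bsub>V\<^esub> v) w \<ominus>\<^bsub>F\<^esub> a \<odot>\<^bsub>F\<^esub> e v w | a v w.
          a \<in> carrier K \<and> v \<in> carrier V \<and> w \<in> carrier W}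
    \<union> {e v (a \<odot>\<^bsub>W\<^esub> w) \<ominus>\<^bsub>F\<^esub> a \<odot>\<^bsub>F\<^esub> e v w | a v w.
          a \<in> carrier K \<and> v \<in> carrier V \<and> w \<in> carrier W})"

definition tensor_rels ::
  "('k, 'r) ring_scheme \<Rightarrow> ('k, 'v, 'm) module_scheme \<Rightarrow> ('k, 'w, 'n) module_scheme
    \<Rightarrow> ('v \<times> 'w \<Rightarrow> 'k) set" where
  "tensor_rels K V W = module.span K (free_vs K (carrier V \<times> carrier W)) (bilinear_rels K V W)"

definition tensor ::
  "('k, 'r) ring_scheme \<Rightarrow> ('k, 'v, 'm) module_scheme \<Rightarrow> ('k, 'w, 'n) module_scheme
    \<Rightarrow> ('k, ('k, 'v, 'w) tens) module" where
  "tensor K V W = quot_vs (free_vs K (carrier V \<times> carrier W)) (tensor_rels K V W)"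

text \<open>\<open>tens K V W v w\<close> is the pure tensor \<open>v \<otimes> w\<close> in \<open>V \<otimes> W\<close>.\<close>

definition tens ::
  "('k, 'r) ring_scheme \<Rightarrow> ('k, 'v, 'm) module_scheme \<Rightarrow> ('k, 'w, 'n) module_scheme
    \<Rightarrow> 'v \<Rightarrow> 'w \<Rightarrow> ('k, 'v, 'w) tens" where
  "tens K V W v w =
    tensor_rels K V W +>\<^bsub>free_vs K (carrier V \<times> carrier W)\<^esub> single K (v, w)"

text \<open>
  \<open>sweedler K U t (\<lambda>v w. B v w)\<close> is the image of \<open>t \<in> V \<otimes> W\<close> under the linear map \<open>V \<otimes> W \<rightarrow> U\<close> induced
  by a bilinear \<open>B\<close>, i.e. \<open>\<Sum>\<^sub>i B v\<^sub>i w\<^sub>i\<close> for any representation \<open>t = \<Sum>\<^sub>i v\<^sub>i \<otimes> w\<^sub>i\<close>. It is only used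
  with bilinear \<open>B\<close>, for which the choice of the representative \<open>f\<close> does not matter. An expression in
  Sweedler notation, such as \<open>h\<^sub>1 \<cdot> c \<otimes> h\<^sub>2 \<cdot> d\<close>, is rendered as \<open>sweedler\<close> applied to \<open>\<Delta>(h)\<close>.
\<close>

definition sweedler ::
  "('k, 'r) ring_scheme \<Rightarrow> ('k, 'u, 'm) module_scheme
    \<Rightarrow> ('k, 'v, 'w) tens \<Rightarrow> ('v \<Rightarrow> 'w \<Rightarrow> 'u) \<Rightarrow> 'u" where
  "sweedler K U t B =
    (let f = (SOME f. f \<in> t) in
      finsum U (\<lambda>(v, w). f (v, w) \<odot>\<^bsub>U\<^esub> B v w) {p. f p \<noteq> \<zero>\<^bsub>K\<^esub>})"

definition tensor_map ::
  "('k, 'r) ring_scheme \<Rightarrow> ('k, 'x, 'm) module_scheme \<Rightarrow> ('k, 'y, 'n) module_scheme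
    \<Rightarrow> ('v \<Rightarrow> 'x) \<Rightarrow> ('w \<Rightarrow> 'y) \<Rightarrow> ('k, 'v, 'w) tens \<Rightarrow> ('k, 'x, 'y) tens" where
  "tensor_map K X Y f g t = sweedler K (tensor K X Y) t (\<lambda>v w. tens K X Y (f v) (g w))"

definition tensor_assoc ::
  "('k, 'r) ring_scheme \<Rightarrow> ('k, 'u, 'l) module_scheme \<Rightarrow> ('k, 'v, 'm) module_scheme
    \<Rightarrow> ('k, 'w, 'n) module_scheme \<Rightarrow> ('k, ('k, 'u, 'v) tens, 'w) tens
    \<Rightarrow> ('k, 'u, ('k, 'v, 'w) tens) tens" where
  "tensor_assoc K U V W t =
    sweedler K (tensor K U (tensor K V W)) t (\<lambda>s w.
    sweedler K (tensor K U (tensor K V W)) s (\<lambda>u v.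
      tens K U (tensor K V W) u (tens K V W v w)))"

definition tensor_assoc_inv ::
  "('k, 'r) ring_scheme \<Rightarrow> ('k, 'u, 'l) module_scheme \<Rightarrow> ('k, 'v, 'm) module_scheme
    \<Rightarrow> ('k, 'w, 'n) module_scheme \<Rightarrow> ('k, 'u, ('k, 'v, 'w) tens) tens
    \<Rightarrow> ('k, ('k, 'u, 'v) tens, 'w) tens" where
  "tensor_assoc_inv K U V W t =
    sweedler K (tensor K (tensor K U V) W) t (\<lambda>u s.
    sweedler K (tensor K (tensor K U V) W) s (\<lambda>v w.
      tens K (tensor K U V) W (tens K U V u v) w))"

definition base_vs :: "('k, 'r) ring_scheme \<Rightarrow> ('k, 'k) module" where
  "base_vs K =
    \<lparr>carrier = carrier K, mult = mult K, one = one K, zero = zero K, add = add K, smult = mult K\<rparr>"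

text \<open>The unit constraints \<open>k \<otimes> V \<rightarrow> V\<close> and \<open>V \<otimes> k \<rightarrow> V\<close>.\<close>

definition tensor_lunit ::
  "('k, 'r) ring_scheme \<Rightarrow> ('k, 'v, 'm) module_scheme \<Rightarrow> ('k, 'k, 'v) tens \<Rightarrow> 'v" where
  "tensor_lunit K V t = sweedler K V t (\<lambda>a v. a \<odot>\<^bsub>V\<^esub> v)"

definition tensor_runit ::
  "('k, 'r) ring_scheme \<Rightarrow> ('k, 'v, 'm) module_scheme \<Rightarrow> ('k, 'v, 'k) tens \<Rightarrow> 'v" where
  "tensor_runit K V t = sweedler K V t (\<lambda>v a. a \<odot>\<^bsub>V\<^esub> v)"

definition bilinear_map ::
  "('k, 'r) ring_scheme \<Rightarrow> ('k, 'v, 'm) module_scheme \<Rightarrow> ('k, 'w, 'n) module_scheme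
    \<Rightarrow> ('k, 'u, 'l) module_scheme \<Rightarrow> ('v \<Rightarrow> 'w \<Rightarrow> 'u) \<Rightarrow> bool" where
  "bilinear_map K V W U B \<longleftrightarrow>
    (\<forall>v\<in>carrier V. (\<lambda>w. B v w) \<in> module_hom K W U) \<and>
    (\<forall>w\<in>carrier W. (\<lambda>v. B v w) \<in> module_hom K V U)"


section \<open>Algebras, coalgebras and bialgebras\<close>

text \<open>The locale \<open>algebra\<close> of HOL-Algebra only covers commutative algebras.\<close>

definition k_algebra :: "('k, 'r) ring_scheme \<Rightarrow> ('k, 'a, 'm) module_scheme \<Rightarrow> bool" where
  "k_algebra K A \<longleftrightarrow>
    vectorspace K A \<and> ring A \<and>
    (\<forall>a\<in>carrier K. \<forall>x\<in>carrier A. \<forall>y\<in>carrier A.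
      (a \<odot>\<^bsub>A\<^esub> x) \<otimes>\<^bsub>A\<^esub> y = a \<odot>\<^bsub>A\<^esub> (x \<otimes>\<^bsub>A\<^esub> y) \<and>
      x \<otimes>\<^bsub>A\<^esub> (a \<odot>\<^bsub>A\<^esub> y) = a \<odot>\<^bsub>A\<^esub> (x \<otimes>\<^bsub>A\<^esub> y))"

definition k_coalgebra ::
  "('k, 'r) ring_scheme \<Rightarrow> ('k, 'c, 'm) module_scheme
    \<Rightarrow> ('c \<Rightarrow> ('k, 'c, 'c) tens) \<Rightarrow> ('c \<Rightarrow> 'k) \<Rightarrow> bool" where
  "k_coalgebra K C \<Delta> \<epsilon> \<longleftrightarrow>
    vectorspace K C \<and>
    \<Delta> \<in> module_hom K C (tensor K C C) \<and>
    \<epsilon> \<in> module_hom K C (base_vs K) \<and>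
    (\<forall>c\<in>carrier C.
      sweedler K (tensor K C (tensor K C C)) (\<Delta> c) (\<lambda>c1 c2.
      sweedler K (tensor K C (tensor K C C)) (\<Delta> c1) (\<lambda>c11 c12.
        tens K C (tensor K C C) c11 (tens K C C c12 c2)))
      = sweedler K (tensor K C (tensor K C C)) (\<Delta> c) (\<lambda>c1 c2.
          tens K C (tensor K C C) c1 (\<Delta> c2))) \<and>
    (\<forall>c\<in>carrier C. sweedler K C (\<Delta> c) (\<lambda>c1 c2. \<epsilon> c1 \<odot>\<^bsub>C\<^esub> c2) = c) \<and>
    (\<forall>c\<in>carrier C. sweedler K C (\<Delta> c) (\<lambda>c1 c2. \<epsilon> c2 \<odot>\<^bsub>C\<^esub> c1) = c)"

record ('k, 'h) bialg = "('k, 'h) module" +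
  comult :: "'h \<Rightarrow> ('k, 'h, 'h) tens"
  counit :: "'h \<Rightarrow> 'k"

definition bialgebra :: "('k, 'r) ring_scheme \<Rightarrow> ('k, 'h, 's) bialg_scheme \<Rightarrow> bool" where
  "bialgebra K H \<longleftrightarrow>
    k_algebra K H \<and> k_coalgebra K H (comult H) (counit H) \<and>
    (\<forall>g\<in>carrier H. \<forall>h\<in>carrier H.
      comult H (g \<otimes>\<^bsub>H\<^esub> h) =
        sweedler K (tensor K H H) (comult H g) (\<lambda>g1 g2.
        sweedler K (tensor K H H) (comult H h) (\<lambda>h1 h2.
          tens K H H (g1 \<otimes>\<^bsub>H\<^esub> h1) (g2 \<otimes>\<^bsub>H\<^esub> h2)))) \<and>
    comult H \<one>\<^bsub>H\<^esub> = tens K H H \<one>\<^bsub>H\<^esub> \<one>\<^bsub>H\<^esub> \<and>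
    (\<forall>g\<in>carrier H. \<forall>h\<in>carrier H. counit H (g \<otimes>\<^bsub>H\<^esub> h) = counit H g \<otimes>\<^bsub>K\<^esub> counit H h) \<and>
    counit H \<one>\<^bsub>H\<^esub> = \<one>\<^bsub>K\<^esub>"


section \<open>Bimodules and bicomodules\<close>

text \<open>\<open>lcoact M m\<close> is \<open>m\<^sup>(\<^sup>-\<^sup>1\<^sup>) \<otimes> m\<^sup>(\<^sup>0\<^sup>)\<close> and \<open>rcoact M m\<close> is \<open>m\<^sup><\<^sup>0\<^sup>> \<otimes> m\<^sup><\<^sup>1\<^sup>>\<close>.\<close>

record ('k, 'h, 'm) lr_space = "('k, 'm) module" +
  lact :: "'h \<Rightarrow> 'm \<Rightarrow> 'm" (infixr \<open>\<rightharpoonup>\<index>\<close> 75)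
  ract :: "'m \<Rightarrow> 'h \<Rightarrow> 'm" (infixl \<open>\<leftharpoonup>\<index>\<close> 75)
  lcoact :: "'m \<Rightarrow> ('k, 'h, 'm) tens"
  rcoact :: "'m \<Rightarrow> ('k, 'm, 'h) tens"

definition bimodule ::
  "('k, 'r) ring_scheme \<Rightarrow> ('k, 'h, 's) bialg_scheme \<Rightarrow> ('k, 'h, 'm, 'x) lr_space_scheme \<Rightarrow> bool"
  where
  "bimodule K H M \<longleftrightarrow>
    vectorspace K M \<and>
    bilinear_map K H M M (lact M) \<and>
    bilinear_map K M H M (ract M) \<and>
    (\<forall>m\<in>carrier M. \<one>\<^bsub>H\<^esub> \<rightharpoonup>\<^bsub>M\<^esub> m = m \<and> m \<leftharpoonup>\<^bsub>M\<^esub> \<one>\<^bsub>H\<^esub> = m) \<and>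
    (\<forall>g\<in>carrier H. \<forall>h\<in>carrier H. \<forall>m\<in>carrier M.
      (g \<otimes>\<^bsub>H\<^esub> h) \<rightharpoonup>\<^bsub>M\<^esub> m = g \<rightharpoonup>\<^bsub>M\<^esub> (h \<rightharpoonup>\<^bsub>M\<^esub> m) \<and>
      m \<leftharpoonup>\<^bsub>M\<^esub> (g \<otimes>\<^bsub>H\<^esub> h) = (m \<leftharpoonup>\<^bsub>M\<^esub> g) \<leftharpoonup>\<^bsub>M\<^esub> h \<and>
      (g \<rightharpoonup>\<^bsub>M\<^esub> m) \<leftharpoonup>\<^bsub>M\<^esub> h = g \<rightharpoonup>\<^bsub>M\<^esub> (m \<leftharpoonup>\<^bsub>M\<^esub> h))"

definition bicomodule ::
  "('k, 'r) ring_scheme \<Rightarrow> ('k, 'h, 's) bialg_scheme \<Rightarrow> ('k, 'h, 'm, 'x) lr_space_scheme \<Rightarrow> bool"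
  where
  "bicomodule K H M \<longleftrightarrow>
    vectorspace K M \<and>
    lcoact M \<in> module_hom K M (tensor K H M) \<and>
    rcoact M \<in> module_hom K M (tensor K M H) \<and>
    (\<forall>m\<in>carrier M.
      sweedler K (tensor K H (tensor K H M)) (lcoact M m) (\<lambda>h x.
      sweedler K (tensor K H (tensor K H M)) (comult H h) (\<lambda>h1 h2.
        tens K H (tensor K H M) h1 (tens K H M h2 x)))
      = sweedler K (tensor K H (tensor K H M)) (lcoact M m) (\<lambda>h x.
          tens K H (tensor K H M) h (lcoact M x))) \<and>
    (\<forall>m\<in>carrier M. sweedler K M (lcoact M m) (\<lambda>h x. counit H h \<odot>\<^bsub>M\<^esub> x) = m) \<and>
    (\<forall>m\<in>carrier M.
      sweedler K (tensor K M (tensor K H H)) (rcoact M m) (\<lambda>x h.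
      sweedler K (tensor K M (tensor K H H)) (rcoact M x) (\<lambda>y g.
        tens K M (tensor K H H) y (tens K H H g h)))
      = sweedler K (tensor K M (tensor K H H)) (rcoact M m) (\<lambda>x h.
          tens K M (tensor K H H) x (comult H h))) \<and>
    (\<forall>m\<in>carrier M. sweedler K M (rcoact M m) (\<lambda>x h. counit H h \<odot>\<^bsub>M\<^esub> x) = m) \<and>
    (\<forall>m\<in>carrier M.
      sweedler K (tensor K H (tensor K M H)) (rcoact M m) (\<lambda>x h.
      sweedler K (tensor K H (tensor K M H)) (lcoact M x) (\<lambda>g y.
        tens K H (tensor K M H) g (tens K M H y h)))
      = sweedler K (tensor K H (tensor K M H)) (lcoact M m) (\<lambda>g y.
          tens K H (tensor K M H) g (rcoact M y)))"

text \<open>The four compatibility conditions occurring both in the definition of the category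
  \<open>\<L>\<R>(H)\<close> and in that of an L-R-admissible pair, in the same order as there:
    \<open>(h\<^sub>1\<cdot>m)\<^sup>(\<^sup>-\<^sup>1\<^sup>)h\<^sub>2 \<otimes> (h\<^sub>1\<cdot>m)\<^sup>(\<^sup>0\<^sup>) = h\<^sub>1m\<^sup>(\<^sup>-\<^sup>1\<^sup>) \<otimes> h\<^sub>2\<cdot>m\<^sup>(\<^sup>0\<^sup>)\<close>,
    \<open>(h\<cdot>m)\<^sup><\<^sup>0\<^sup>> \<otimes> (h\<cdot>m)\<^sup><\<^sup>1\<^sup>> = h\<cdot>m\<^sup><\<^sup>0\<^sup>> \<otimes> m\<^sup><\<^sup>1\<^sup>>\<close>,
    \<open>(m\<cdot>h\<^sub>2)\<^sup><\<^sup>0\<^sup>> \<otimes> h\<^sub>1(m\<cdot>h\<^sub>2)\<^sup><\<^sup>1\<^sup>> = m\<^sup><\<^sup>0\<^sup>>\<cdot>h\<^sub>1 \<otimes> m\<^sup><\<^sup>1\<^sup>>h\<^sub>2\<close>,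
    \<open>(m\<cdot>h)\<^sup>(\<^sup>-\<^sup>1\<^sup>) \<otimes> (m\<cdot>h)\<^sup>(\<^sup>0\<^sup>) = m\<^sup>(\<^sup>-\<^sup>1\<^sup>) \<otimes> m\<^sup>(\<^sup>0\<^sup>)\<cdot>h\<close>.\<close>

definition lr_compatible ::
  "('k, 'r) ring_scheme \<Rightarrow> ('k, 'h, 's) bialg_scheme \<Rightarrow> ('k, 'h, 'm, 'x) lr_space_scheme \<Rightarrow> bool"
  where
  "lr_compatible K H M \<longleftrightarrow>
    (\<forall>h\<in>carrier H. \<forall>m\<in>carrier M.
      sweedler K (tensor K H M) (comult H h) (\<lambda>h1 h2.
      sweedler K (tensor K H M) (lcoact M (h1 \<rightharpoonup>\<^bsub>M\<^esub> m)) (\<lambda>g x.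
        tens K H M (g \<otimes>\<^bsub>H\<^esub> h2) x))
      = sweedler K (tensor K H M) (comult H h) (\<lambda>h1 h2.
        sweedler K (tensor K H M) (lcoact M m) (\<lambda>g x.
          tens K H M (h1 \<otimes>\<^bsub>H\<^esub> g) (h2 \<rightharpoonup>\<^bsub>M\<^esub> x)))) \<and>
    (\<forall>h\<in>carrier H. \<forall>m\<in>carrier M.
      rcoact M (h \<rightharpoonup>\<^bsub>M\<^esub> m) =
        sweedler K (tensor K M H) (rcoact M m) (\<lambda>x g. tens K M H (h \<rightharpoonup>\<^bsub>M\<^esub> x) g)) \<and>
    (\<forall>h\<in>carrier H. \<forall>m\<in>carrier M.
      sweedler K (tensor K M H) (comult H h) (\<lambda>h1 h2.
      sweedler K (tensor K M H) (rcoact M (m \<leftharpoonup>\<^bsub>M\<^esub> h2)) (\<lambda>x g.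
        tens K M H x (h1 \<otimes>\<^bsub>H\<^esub> g)))
      = sweedler K (tensor K M H) (comult H h) (\<lambda>h1 h2.
        sweedler K (tensor K M H) (rcoact M m) (\<lambda>x g.
          tens K M H (x \<leftharpoonup>\<^bsub>M\<^esub> h1) (g \<otimes>\<^bsub>H\<^esub> h2)))) \<and>
    (\<forall>h\<in>carrier H. \<forall>m\<in>carrier M.
      lcoact M (m \<leftharpoonup>\<^bsub>M\<^esub> h) =
        sweedler K (tensor K H M) (lcoact M m) (\<lambda>g x. tens K H M g (x \<leftharpoonup>\<^bsub>M\<^esub> h)))"


section \<open>L-R-admissible pairs\<close>

definition bimodule_algebra ::
  "('k, 'r) ring_scheme \<Rightarrow> ('k, 'h, 's) bialg_scheme \<Rightarrow> ('k, 'h, 'd, 'x) lr_space_scheme \<Rightarrow> bool"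
  where
  "bimodule_algebra K H D \<longleftrightarrow>
    bimodule K H D \<and> k_algebra K D \<and>
    (\<forall>h\<in>carrier H.
      h \<rightharpoonup>\<^bsub>D\<^esub> \<one>\<^bsub>D\<^esub> = counit H h \<odot>\<^bsub>D\<^esub> \<one>\<^bsub>D\<^esub> \<and>
      \<one>\<^bsub>D\<^esub> \<leftharpoonup>\<^bsub>D\<^esub> h = counit H h \<odot>\<^bsub>D\<^esub> \<one>\<^bsub>D\<^esub>) \<and>
    (\<forall>h\<in>carrier H. \<forall>c\<in>carrier D. \<forall>d\<in>carrier D.
      h \<rightharpoonup>\<^bsub>D\<^esub> (c \<otimes>\<^bsub>D\<^esub> d) =
        sweedler K D (comult H h) (\<lambda>h1 h2. (h1 \<rightharpoonup>\<^bsub>D\<^esub> c) \<otimes>\<^bsub>D\<^esub> (h2 \<rightharpoonup>\<^bsub>D\<^esub> d)) \<and>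
      (c \<otimes>\<^bsub>D\<^esub> d) \<leftharpoonup>\<^bsub>D\<^esub> h =
        sweedler K D (comult H h) (\<lambda>h1 h2. (c \<leftharpoonup>\<^bsub>D\<^esub> h1) \<otimes>\<^bsub>D\<^esub> (d \<leftharpoonup>\<^bsub>D\<^esub> h2)))"

definition bicomodule_coalgebra ::
  "('k, 'r) ring_scheme \<Rightarrow> ('k, 'h, 's) bialg_scheme \<Rightarrow> ('k, 'h, 'd, 'x) lr_space_scheme
    \<Rightarrow> ('d \<Rightarrow> ('k, 'd, 'd) tens) \<Rightarrow> ('d \<Rightarrow> 'k) \<Rightarrow> bool"
  where
  "bicomodule_coalgebra K H D \<Delta> \<epsilon> \<longleftrightarrow>
    bicomodule K H D \<and> k_coalgebra K D \<Delta> \<epsilon> \<and>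
    (\<forall>d\<in>carrier D.
      sweedler K (tensor K H (tensor K D D)) (\<Delta> d) (\<lambda>d1 d2.
      sweedler K (tensor K H (tensor K D D)) (lcoact D d1) (\<lambda>g x.
      sweedler K (tensor K H (tensor K D D)) (lcoact D d2) (\<lambda>h y.
        tens K H (tensor K D D) (g \<otimes>\<^bsub>H\<^esub> h) (tens K D D x y))))
      = sweedler K (tensor K H (tensor K D D)) (lcoact D d) (\<lambda>h x.
          tens K H (tensor K D D) h (\<Delta> x))) \<and>
    (\<forall>d\<in>carrier D.
      sweedler K H (lcoact D d) (\<lambda>h x. \<epsilon> x \<odot>\<^bsub>H\<^esub> h) = \<epsilon> d \<odot>\<^bsub>H\<^esub> \<one>\<^bsub>H\<^esub>) \<and>
    (\<forall>d\<in>carrier D.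
      sweedler K (tensor K (tensor K D D) H) (\<Delta> d) (\<lambda>d1 d2.
      sweedler K (tensor K (tensor K D D) H) (rcoact D d1) (\<lambda>x g.
      sweedler K (tensor K (tensor K D D) H) (rcoact D d2) (\<lambda>y h.
        tens K (tensor K D D) H (tens K D D x y) (g \<otimes>\<^bsub>H\<^esub> h))))
      = sweedler K (tensor K (tensor K D D) H) (rcoact D d) (\<lambda>x h.
          tens K (tensor K D D) H (\<Delta> x) h)) \<and>
    (\<forall>d\<in>carrier D.
      sweedler K H (rcoact D d) (\<lambda>x h. \<epsilon> x \<odot>\<^bsub>H\<^esub> h) = \<epsilon> d \<odot>\<^bsub>H\<^esub> \<one>\<^bsub>H\<^esub>)"

text \<open>The condition \<open>c\<^sup><\<^sup>0\<^sup>>\<cdot>d\<^sup>(\<^sup>-\<^sup>1\<^sup>) \<otimes> c\<^sup><\<^sup>1\<^sup>>\<cdot>d\<^sup>(\<^sup>0\<^sup>) = c \<otimes> d\<close>.\<close>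

definition lr_twist_trivial ::
  "('k, 'r) ring_scheme \<Rightarrow> ('k, 'h, 's) bialg_scheme \<Rightarrow> ('k, 'h, 'd, 'x) lr_space_scheme \<Rightarrow> bool"
  where
  "lr_twist_trivial K H D \<longleftrightarrow>
    (\<forall>c\<in>carrier D. \<forall>d\<in>carrier D.
      sweedler K (tensor K D D) (rcoact D c) (\<lambda>x g.
      sweedler K (tensor K D D) (lcoact D d) (\<lambda>h y.
        tens K D D (x \<leftharpoonup>\<^bsub>D\<^esub> h) (g \<rightharpoonup>\<^bsub>D\<^esub> y)))
      = tens K D D c d)"

definition lr_admissible ::
  "('k, 'r) ring_scheme \<Rightarrow> ('k, 'h, 's) bialg_scheme \<Rightarrow> ('k, 'h, 'd, 'x) lr_space_scheme
    \<Rightarrow> ('d \<Rightarrow> ('k, 'd, 'd) tens) \<Rightarrow> ('d \<Rightarrow> 'k) \<Rightarrow> bool"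
  where
  "lr_admissible K H D \<Delta> \<epsilon> \<longleftrightarrow>
    bimodule_algebra K H D \<and>
    bicomodule_coalgebra K H D \<Delta> \<epsilon> \<and>
    \<epsilon> \<one>\<^bsub>D\<^esub> = \<one>\<^bsub>K\<^esub> \<and>
    (\<forall>c\<in>carrier D. \<forall>d\<in>carrier D. \<epsilon> (c \<otimes>\<^bsub>D\<^esub> d) = \<epsilon> c \<otimes>\<^bsub>K\<^esub> \<epsilon> d) \<and>
    (\<forall>h\<in>carrier H. \<forall>d\<in>carrier D.
      \<epsilon> (h \<rightharpoonup>\<^bsub>D\<^esub> d) = \<epsilon> d \<otimes>\<^bsub>K\<^esub> counit H h \<and>
      \<epsilon> (d \<leftharpoonup>\<^bsub>D\<^esub> h) = \<epsilon> d \<otimes>\<^bsub>K\<^esub> counit H h) \<and>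
    rcoact D \<one>\<^bsub>D\<^esub> = tens K D H \<one>\<^bsub>D\<^esub> \<one>\<^bsub>H\<^esub> \<and>
    lcoact D \<one>\<^bsub>D\<^esub> = tens K H D \<one>\<^bsub>H\<^esub> \<one>\<^bsub>D\<^esub> \<and>
    \<Delta> \<one>\<^bsub>D\<^esub> = tens K D D \<one>\<^bsub>D\<^esub> \<one>\<^bsub>D\<^esub> \<and>
    (\<forall>c\<in>carrier D. \<forall>d\<in>carrier D.
      rcoact D (c \<otimes>\<^bsub>D\<^esub> d) =
        sweedler K (tensor K D H) (rcoact D c) (\<lambda>x g.
        sweedler K (tensor K D H) (rcoact D d) (\<lambda>y h.
          tens K D H (x \<otimes>\<^bsub>D\<^esub> y) (g \<otimes>\<^bsub>H\<^esub> h)))) \<and>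
    (\<forall>c\<in>carrier D. \<forall>d\<in>carrier D.
      lcoact D (c \<otimes>\<^bsub>D\<^esub> d) =
        sweedler K (tensor K H D) (lcoact D c) (\<lambda>g x.
        sweedler K (tensor K H D) (lcoact D d) (\<lambda>h y.
          tens K H D (g \<otimes>\<^bsub>H\<^esub> h) (x \<otimes>\<^bsub>D\<^esub> y)))) \<and>
    (\<forall>h\<in>carrier H. \<forall>d\<in>carrier D.
      \<Delta> (h \<rightharpoonup>\<^bsub>D\<^esub> d) =
        sweedler K (tensor K D D) (comult H h) (\<lambda>h1 h2.
        sweedler K (tensor K D D) (\<Delta> d) (\<lambda>d1 d2.
          tens K D D (h1 \<rightharpoonup>\<^bsub>D\<^esub> d1) (h2 \<rightharpoonup>\<^bsub>D\<^esub> d2)))) \<and>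
    (\<forall>h\<in>carrier H. \<forall>d\<in>carrier D.
      \<Delta> (d \<leftharpoonup>\<^bsub>D\<^esub> h) =
        sweedler K (tensor K D D) (comult H h) (\<lambda>h1 h2.
        sweedler K (tensor K D D) (\<Delta> d) (\<lambda>d1 d2.
          tens K D D (d1 \<leftharpoonup>\<^bsub>D\<^esub> h1) (d2 \<leftharpoonup>\<^bsub>D\<^esub> h2)))) \<and>
    (\<forall>c\<in>carrier D. \<forall>d\<in>carrier D.
      \<Delta> (c \<otimes>\<^bsub>D\<^esub> d) =
        sweedler K (tensor K D D) (\<Delta> c) (\<lambda>c1 c2.
        sweedler K (tensor K D D) (\<Delta> d) (\<lambda>d1 d2.
        sweedler K (tensor K D D) (lcoact D c2) (\<lambda>g x.
        sweedler K (tensor K D D) (rcoact D d1) (\<lambda>y h.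
          tens K D D (c1 \<otimes>\<^bsub>D\<^esub> (g \<rightharpoonup>\<^bsub>D\<^esub> y)) ((x \<leftharpoonup>\<^bsub>D\<^esub> h) \<otimes>\<^bsub>D\<^esub> d2)))))) \<and>
    lr_compatible K H D \<and>
    lr_twist_trivial K H D"


section \<open>The prebraided category \<open>\<L>\<R>(H)\<close>\<close>

text \<open>
  The monoidal category is not strict here, so the associativity and unit constraints of vector
  spaces are inserted explicitly. The vector space underlying \<open>lr_tensor K H M N\<close> is \<open>tensor K M N\<close>.
\<close>

definition lr_object ::
  "('k, 'r) ring_scheme \<Rightarrow> ('k, 'h, 's) bialg_scheme \<Rightarrow> ('k, 'h, 'm, 'x) lr_space_scheme \<Rightarrow> bool"
  where
  "lr_object K H M \<longleftrightarrow> bimodule K H M \<and> bicomodule K H M \<and> lr_compatible K H M"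

definition lr_hom ::
  "('k, 'r) ring_scheme \<Rightarrow> ('k, 'h, 's) bialg_scheme \<Rightarrow> ('k, 'h, 'm, 'x) lr_space_scheme
    \<Rightarrow> ('k, 'h, 'n, 'y) lr_space_scheme \<Rightarrow> ('m \<Rightarrow> 'n) set"
  where
  "lr_hom K H M N =
    {f \<in> module_hom K M N.
      (\<forall>h\<in>carrier H. \<forall>m\<in>carrier M. f (h \<rightharpoonup>\<^bsub>M\<^esub> m) = h \<rightharpoonup>\<^bsub>N\<^esub> f m) \<and>
      (\<forall>h\<in>carrier H. \<forall>m\<in>carrier M. f (m \<leftharpoonup>\<^bsub>M\<^esub> h) = f m \<leftharpoonup>\<^bsub>N\<^esub> h) \<and>
      (\<forall>m\<in>carrier M. lcoact N (f m) = tensor_map K H N id f (lcoact M m)) \<and>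
      (\<forall>m\<in>carrier M. rcoact N (f m) = tensor_map K N H f id (rcoact M m))}"

definition lr_unit ::
  "('k, 'r) ring_scheme \<Rightarrow> ('k, 'h, 's) bialg_scheme \<Rightarrow> ('k, 'h, 'k) lr_space" where
  "lr_unit K H =
    \<lparr>carrier = carrier K, mult = mult K, one = one K, zero = zero K, add = add K, smult = mult K,
     lact = (\<lambda>h a. counit H h \<otimes>\<^bsub>K\<^esub> a),
     ract = (\<lambda>a h. a \<otimes>\<^bsub>K\<^esub> counit H h),
     lcoact = (\<lambda>a. tens K H (base_vs K) \<one>\<^bsub>H\<^esub> a),
     rcoact = (\<lambda>a. tens K (base_vs K) H a \<one>\<^bsub>H\<^esub>)\<rparr>"

definition lr_tensor ::
  "('k, 'r) ring_scheme \<Rightarrow> ('k, 'h, 's) bialg_scheme \<Rightarrow> ('k, 'h, 'm, 'x) lr_space_scheme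
    \<Rightarrow> ('k, 'h, 'n, 'y) lr_space_scheme \<Rightarrow> ('k, 'h, ('k, 'm, 'n) tens) lr_space"
  where
  "lr_tensor K H M N =
    \<lparr>carrier = carrier (tensor K M N),
     mult = mult (tensor K M N), one = one (tensor K M N),
     zero = zero (tensor K M N), add = add (tensor K M N), smult = smult (tensor K M N),
     lact = (\<lambda>h t.
       sweedler K (tensor K M N) (comult H h) (\<lambda>h1 h2.
       sweedler K (tensor K M N) t (\<lambda>m n. tens K M N (h1 \<rightharpoonup>\<^bsub>M\<^esub> m) (h2 \<rightharpoonup>\<^bsub>N\<^esub> n)))),
     ract = (\<lambda>t h.
       sweedler K (tensor K M N) (comult H h) (\<lambda>h1 h2.
       sweedler K (tensor K M N) t (\<lambda>m n. tens K M N (m \<leftharpoonup>\<^bsub>M\<^esub> h1) (n \<leftharpoonup>\<^bsub>N\<^esub> h2)))),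
     lcoact = (\<lambda>t.
       sweedler K (tensor K H (tensor K M N)) t (\<lambda>m n.
       sweedler K (tensor K H (tensor K M N)) (lcoact M m) (\<lambda>g x.
       sweedler K (tensor K H (tensor K M N)) (lcoact N n) (\<lambda>h y.
         tens K H (tensor K M N) (g \<otimes>\<^bsub>H\<^esub> h) (tens K M N x y))))),
     rcoact = (\<lambda>t.
       sweedler K (tensor K (tensor K M N) H) t (\<lambda>m n.
       sweedler K (tensor K (tensor K M N) H) (rcoact M m) (\<lambda>x g.
       sweedler K (tensor K (tensor K M N) H) (rcoact N n) (\<lambda>y h.
         tens K (tensor K M N) H (tens K M N x y) (g \<otimes>\<^bsub>H\<^esub> h)))))\<rparr>"

text \<open>\<open>c\<^sub>M\<^sub>,\<^sub>N (m \<otimes> n) = m\<^sup>(\<^sup>-\<^sup>1\<^sup>)\<cdot>n\<^sup><\<^sup>0\<^sup>> \<otimes> m\<^sup>(\<^sup>0\<^sup>)\<cdot>n\<^sup><\<^sup>1\<^sup>>\<close>\<close>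

definition lr_braiding ::
  "('k, 'r) ring_scheme \<Rightarrow> ('k, 'h, 's) bialg_scheme \<Rightarrow> ('k, 'h, 'm, 'x) lr_space_scheme
    \<Rightarrow> ('k, 'h, 'n, 'y) lr_space_scheme \<Rightarrow> ('k, 'm, 'n) tens \<Rightarrow> ('k, 'n, 'm) tens"
  where
  "lr_braiding K H M N t =
    sweedler K (tensor K N M) t (\<lambda>m n.
    sweedler K (tensor K N M) (lcoact M m) (\<lambda>g x.
    sweedler K (tensor K N M) (rcoact N n) (\<lambda>y h.
      tens K N M (g \<rightharpoonup>\<^bsub>N\<^esub> y) (x \<leftharpoonup>\<^bsub>M\<^esub> h))))"

definition lr_algebra ::
  "('k, 'r) ring_scheme \<Rightarrow> ('k, 'h, 's) bialg_scheme \<Rightarrow> ('k, 'h, 'd, 'x) lr_space_scheme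
    \<Rightarrow> (('k, 'd, 'd) tens \<Rightarrow> 'd) \<Rightarrow> ('k \<Rightarrow> 'd) \<Rightarrow> bool"
  where
  "lr_algebra K H D \<mu> \<eta> \<longleftrightarrow>
    lr_object K H D \<and>
    \<mu> \<in> lr_hom K H (lr_tensor K H D D) D \<and>
    \<eta> \<in> lr_hom K H (lr_unit K H) D \<and>
    (\<forall>t\<in>carrier (tensor K (tensor K D D) D).
      \<mu> (tensor_map K D D \<mu> id t) = \<mu> (tensor_map K D D id \<mu> (tensor_assoc K D D D t))) \<and>
    (\<forall>t\<in>carrier (tensor K (base_vs K) D). \<mu> (tensor_map K D D \<eta> id t) = tensor_lunit K D t) \<and>
    (\<forall>t\<in>carrier (tensor K D (base_vs K)). \<mu> (tensor_map K D D id \<eta> t) = tensor_runit K D t)"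

definition lr_coalgebra ::
  "('k, 'r) ring_scheme \<Rightarrow> ('k, 'h, 's) bialg_scheme \<Rightarrow> ('k, 'h, 'd, 'x) lr_space_scheme
    \<Rightarrow> ('d \<Rightarrow> ('k, 'd, 'd) tens) \<Rightarrow> ('d \<Rightarrow> 'k) \<Rightarrow> bool"
  where
  "lr_coalgebra K H D \<Delta> \<epsilon> \<longleftrightarrow>
    lr_object K H D \<and>
    \<Delta> \<in> lr_hom K H D (lr_tensor K H D D) \<and>
    \<epsilon> \<in> lr_hom K H D (lr_unit K H) \<and>
    (\<forall>d\<in>carrier D.
      tensor_assoc K D D D (tensor_map K (tensor K D D) D \<Delta> id (\<Delta> d))
      = tensor_map K D (tensor K D D) id \<Delta> (\<Delta> d)) \<and>
    (\<forall>d\<in>carrier D. tensor_lunit K D (tensor_map K (base_vs K) D \<epsilon> id (\<Delta> d)) = d) \<and>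
    (\<forall>d\<in>carrier D. tensor_runit K D (tensor_map K D (base_vs K) id \<epsilon> (\<Delta> d)) = d)"

text \<open>
  \<open>lr_middle_braiding\<close> is \<open>id \<otimes> c\<^sub>D\<^sub>,\<^sub>D \<otimes> id\<close> on \<open>(D \<otimes> D) \<otimes> (D \<otimes> D)\<close>, computed as
  \<open>(D\<otimes>D)\<otimes>(D\<otimes>D) \<rightarrow> D\<otimes>(D\<otimes>(D\<otimes>D)) \<rightarrow> D\<otimes>((D\<otimes>D)\<otimes>D) \<rightarrow> D\<otimes>((D\<otimes>D)\<otimes>D) \<rightarrow> D\<otimes>(D\<otimes>(D\<otimes>D)) \<rightarrow> (D\<otimes>D)\<otimes>(D\<otimes>D)\<close>.
\<close>

definition lr_middle_braiding ::
  "('k, 'r) ring_scheme \<Rightarrow> ('k, 'h, 's) bialg_scheme \<Rightarrow> ('k, 'h, 'd, 'x) lr_space_scheme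
    \<Rightarrow> ('k, ('k, 'd, 'd) tens, ('k, 'd, 'd) tens) tens
    \<Rightarrow> ('k, ('k, 'd, 'd) tens, ('k, 'd, 'd) tens) tens"
  where
  "lr_middle_braiding K H D =
    tensor_assoc_inv K D D (tensor K D D) \<circ>
    tensor_map K D (tensor K D (tensor K D D)) id
      (tensor_assoc K D D D \<circ>
       tensor_map K (tensor K D D) D (lr_braiding K H D D) id \<circ>
       tensor_assoc_inv K D D D) \<circ>
    tensor_assoc K D D (tensor K D D)"

definition lr_mult_tensor ::
  "('k, 'r) ring_scheme \<Rightarrow> ('k, 'h, 's) bialg_scheme \<Rightarrow> ('k, 'h, 'd, 'x) lr_space_scheme
    \<Rightarrow> (('k, 'd, 'd) tens \<Rightarrow> 'd)
    \<Rightarrow> ('k, ('k, 'd, 'd) tens, ('k, 'd, 'd) tens) tens \<Rightarrow> ('k, 'd, 'd) tens"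
  where
  "lr_mult_tensor K H D \<mu> = tensor_map K D D \<mu> \<mu> \<circ> lr_middle_braiding K H D"

text \<open>The unit \<open>k \<cong> k \<otimes> k \<rightarrow> D \<otimes> D\<close> of the algebra \<open>D \<otimes> D\<close>.\<close>

definition lr_unit_tensor ::
  "('k, 'r) ring_scheme \<Rightarrow> ('k, 'h, 'd, 'x) lr_space_scheme
    \<Rightarrow> ('k \<Rightarrow> 'd) \<Rightarrow> 'k \<Rightarrow> ('k, 'd, 'd) tens"
  where
  "lr_unit_tensor K D \<eta> a =
    tensor_map K D D \<eta> \<eta> (tens K (base_vs K) (base_vs K) \<one>\<^bsub>K\<^esub> a)"

text \<open>\<open>f\<close> commutes with the multiplications \<open>\<mu>, \<mu>'\<close> and units \<open>\<eta>, \<eta>'\<close> of \<open>A\<close> and \<open>B\<close>.\<close>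

definition algebra_map ::
  "('k, 'r) ring_scheme \<Rightarrow> ('k, 'a, 'm) module_scheme \<Rightarrow> (('k, 'a, 'a) tens \<Rightarrow> 'a) \<Rightarrow> ('k \<Rightarrow> 'a)
    \<Rightarrow> ('k, 'b, 'n) module_scheme \<Rightarrow> (('k, 'b, 'b) tens \<Rightarrow> 'b) \<Rightarrow> ('k \<Rightarrow> 'b)
    \<Rightarrow> ('a \<Rightarrow> 'b) \<Rightarrow> bool"
  where
  "algebra_map K A \<mu> \<eta> B \<mu>' \<eta>' f \<longleftrightarrow>
    (\<forall>t\<in>carrier (tensor K A A). f (\<mu> t) = \<mu>' (tensor_map K B B f f t)) \<and>
    (\<forall>a\<in>carrier K. f (\<eta> a) = \<eta>' a)"

definition lr_bialgebra ::
  "('k, 'r) ring_scheme \<Rightarrow> ('k, 'h, 's) bialg_scheme \<Rightarrow> ('k, 'h, 'd, 'x) lr_space_scheme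
    \<Rightarrow> (('k, 'd, 'd) tens \<Rightarrow> 'd) \<Rightarrow> ('k \<Rightarrow> 'd)
    \<Rightarrow> ('d \<Rightarrow> ('k, 'd, 'd) tens) \<Rightarrow> ('d \<Rightarrow> 'k) \<Rightarrow> bool"
  where
  "lr_bialgebra K H D \<mu> \<eta> \<Delta> \<epsilon> \<longleftrightarrow>
    lr_algebra K H D \<mu> \<eta> \<and>
    lr_coalgebra K H D \<Delta> \<epsilon> \<and>
    algebra_map K D \<mu> \<eta> (tensor K D D) (lr_mult_tensor K H D \<mu>) (lr_unit_tensor K D \<eta>) \<Delta> \<and>
    algebra_map K D \<mu> \<eta> (base_vs K) (tensor_lunit K (base_vs K)) id \<epsilon>"

text \<open>The multiplication and unit of \<open>D\<close> as linear maps \<open>D \<otimes> D \<rightarrow> D\<close> and \<open>k \<rightarrow> D\<close>.\<close>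

definition mult_map ::
  "('k, 'r) ring_scheme \<Rightarrow> ('k, 'd, 'm) module_scheme \<Rightarrow> ('k, 'd, 'd) tens \<Rightarrow> 'd" where
  "mult_map K D t = sweedler K D t (\<lambda>c d. c \<otimes>\<^bsub>D\<^esub> d)"

definition unit_map ::
  "('k, 'r) ring_scheme \<Rightarrow> ('k, 'd, 'm) module_scheme \<Rightarrow> 'k \<Rightarrow> 'd" where
  "unit_map K D a = a \<odot>\<^bsub>D\<^esub> \<one>\<^bsub>D\<^esub>"

end

theory Submission
  imports Defs
begin

text \<open>
  By the universal property of the tensor product, two linear maps out of \<open>V \<otimes> W\<close> that agree on pure
  tensors are equal. So each axiom of a bialgebra in \<open>\<L>\<R>(H)\<close>, an equation between linear maps on a
  tensor power of \<open>D\<close>, is equivalent to its values on pure tensors, and these are precisely the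
  conditions of an L-R-admissible pair: \<open>D\<close> is an \<open>H\<close>-bimodule algebra and an \<open>H\<close>-bicomodule algebra
  if and only if multiplication and unit are morphisms, dually for the coalgebra structure, and the
  formula for \<open>\<Delta>(cd)\<close> is multiplicativity of \<open>\<Delta>\<close> for the product of \<open>D \<otimes> D\<close> twisted by the braiding.
\<close>


section \<open>The universal property of the tensor product\<close>

text \<open>The obstacle is \<open>sweedler\<close>: it sums over an arbitrarily chosen
  representative, so it has its intended value only when the integrand is bilinear, and rewriting
  under nested sums calls for bilinearity at every layer. Hence linearity is established by rules
  that a loop can apply to any expression, and sums are compared as values of linear maps. A second
  obstacle is that the associativity and unit constraints are explicit. On pure tensors they merely
  rebracket, but \<Delta>(d) and the values of the braiding are not pure, so some evaluations must
  be known on general tensors. The counit conditions live in H \<otimes> k and k \<otimes> H, and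
  comparing them with conditions in H requires the unit constraints to be injective. Each axiom is
  translated using only the linearity of the structure maps of D and H, never another axiom about D.
  This is why the translations can finally be combined by pure logic.\<close>

lemma carrier_free_vs:
  "f \<in> carrier (free_vs K S) \<longleftrightarrow>
    (\<forall>x. f x \<in> carrier K) \<and> (\<forall>x. f x \<noteq> \<zero>\<^bsub>K\<^esub> \<longrightarrow> x \<in> S) \<and> finite {x. f x \<noteq> \<zero>\<^bsub>K\<^esub>}"
  by (auto simp: free_vs_def)

lemma free_vs_simps [simp]:
  "\<zero>\<^bsub>free_vs K S\<^esub> = (\<lambda>x. \<zero>\<^bsub>K\<^esub>)"
  "f \<oplus>\<^bsub>free_vs K S\<^esub> g = (\<lambda>x. f x \<oplus>\<^bsub>K\<^esub> g x)"
  "a \<odot>\<^bsub>free_vs K S\<^esub> f = (\<lambda>x. a \<otimes>\<^bsub>K\<^esub> f x)"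
  by (simp_all add: free_vs_def)

lemma module_free_vs:
  assumes "cring K"
  shows "module K (free_vs K S)"
proof -
  interpret cring K by fact
  show ?thesis
  proof (intro moduleI abelian_groupI)
    fix f g assume f: "f \<in> carrier (free_vs K S)" and g: "g \<in> carrier (free_vs K S)"
    have "finite ({x. f x \<noteq> \<zero>\<^bsub>K\<^esub>} \<union> {x. g x \<noteq> \<zero>\<^bsub>K\<^esub>})"
      using f g by (simp add: carrier_free_vs)
    then have "finite {x. f x \<oplus>\<^bsub>K\<^esub> g x \<noteq> \<zero>\<^bsub>K\<^esub>}"
      by (rule rev_finite_subset) auto
    moreover have "x \<in> S" if "f x \<oplus>\<^bsub>K\<^esub> g x \<noteq> \<zero>\<^bsub>K\<^esub>" for x
      using that f g unfolding carrier_free_vs by (metis r_zero zero_closed)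
    ultimately show "f \<oplus>\<^bsub>free_vs K S\<^esub> g \<in> carrier (free_vs K S)"
      using f g by (simp add: carrier_free_vs)
  next
    fix a f assume a: "a \<in> carrier K" and f: "f \<in> carrier (free_vs K S)"
    have nz: "f x \<noteq> \<zero>\<^bsub>K\<^esub>" if "a \<otimes>\<^bsub>K\<^esub> f x \<noteq> \<zero>\<^bsub>K\<^esub>" for x
      using that a by auto
    have "finite {x. a \<otimes>\<^bsub>K\<^esub> f x \<noteq> \<zero>\<^bsub>K\<^esub>}"
    proof -
      have "finite {x. f x \<noteq> \<zero>\<^bsub>K\<^esub>}" using f by (simp add: carrier_free_vs)
      then show ?thesis by (rule rev_finite_subset) (use nz in blast)
    qed
    then show "a \<odot>\<^bsub>free_vs K S\<^esub> f \<in> carrier (free_vs K S)"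
      using f a nz by (simp add: carrier_free_vs)
  next
    fix f assume f: "f \<in> carrier (free_vs K S)"
    have "(\<lambda>x. \<ominus>\<^bsub>K\<^esub> f x) \<in> carrier (free_vs K S)"
    proof -
      have "\<ominus>\<^bsub>K\<^esub> f x \<noteq> \<zero>\<^bsub>K\<^esub> \<longleftrightarrow> f x \<noteq> \<zero>\<^bsub>K\<^esub>" for x
        using f unfolding carrier_free_vs by (metis minus_minus minus_zero)
      then show ?thesis using f by (simp add: carrier_free_vs)
    qed
    moreover have "(\<lambda>x. \<ominus>\<^bsub>K\<^esub> f x) \<oplus>\<^bsub>free_vs K S\<^esub> f = \<zero>\<^bsub>free_vs K S\<^esub>"
      using f by (auto simp: carrier_free_vs l_neg)
    ultimately show "\<exists>g\<in>carrier (free_vs K S). g \<oplus>\<^bsub>free_vs K S\<^esub> f = \<zero>\<^bsub>free_vs K S\<^esub>"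
      by blast
  qed (simp_all add: carrier_free_vs a_assoc a_comm a_lcomm m_assoc l_distr r_distr assms fun_eq_iff)
qed

lemma vectorspace_free_vs:
  assumes "field K"
  shows "vectorspace K (free_vs K S)"
  using assms module_free_vs[of K S] unfolding vectorspace_def
  by (simp add: fieldE(1))

lemma single_closed:
  assumes "cring K" "x \<in> S"
  shows "single K x \<in> carrier (free_vs K S)"
proof -
  interpret cring K by fact
  show ?thesis using \<open>x \<in> S\<close> by (auto simp: carrier_free_vs single_def)
qed

text \<open>One point x is split off at a time: f is \<open>f x\<close> times the basis vector at x
  plus f with its value at x erased. The induction runs over a finite set containing the support
  rather than the support itself, so a point where f vanishes can simply be dropped.\<close>

lemma free_vs_induct [consumes 2, case_names zero step]:
  assumes K: "cring K"
    and f: "f \<in> carrier (free_vs K S)"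
    and zero: "P \<zero>\<^bsub>free_vs K S\<^esub>"
    and step: "\<And>a x g. \<lbrakk>a \<in> carrier K; x \<in> S; g \<in> carrier (free_vs K S); P g\<rbrakk>
      \<Longrightarrow> P (a \<odot>\<^bsub>free_vs K S\<^esub> single K x \<oplus>\<^bsub>free_vs K S\<^esub> g)"
  shows "P f"
proof -
  interpret cring K by fact
  define A where "A = {x. f x \<noteq> \<zero>\<^bsub>K\<^esub>}"
  have "finite A" using f by (simp add: A_def carrier_free_vs)
  moreover have "{x. f x \<noteq> \<zero>\<^bsub>K\<^esub>} \<subseteq> A" by (simp add: A_def)
  ultimately show ?thesis using f
  proof (induction A arbitrary: f)
    case empty
    then have "f = \<zero>\<^bsub>free_vs K S\<^esub>" by (auto simp: fun_eq_iff)
    then show ?case using zero by simp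
  next
    case (insert x A f)
    show ?case
    proof (cases "f x = \<zero>\<^bsub>K\<^esub>")
      case True
      then show ?thesis using insert.prems by (intro insert.IH) auto
    next
      case False
      define g where "g = f(x := \<zero>\<^bsub>K\<^esub>)"
      have "finite {y. g y \<noteq> \<zero>\<^bsub>K\<^esub>}"
        by (rule rev_finite_subset[of "{y. f y \<noteq> \<zero>\<^bsub>K\<^esub>}"])
          (use insert.prems(2) in \<open>auto simp: g_def carrier_free_vs\<close>)
      then have g: "g \<in> carrier (free_vs K S)" and sub: "{y. g y \<noteq> \<zero>\<^bsub>K\<^esub>} \<subseteq> A"
        using insert.prems by (auto simp: g_def carrier_free_vs split: if_splits)
      have "f = f x \<odot>\<^bsub>free_vs K S\<^esub> single K x \<oplus>\<^bsub>free_vs K S\<^esub> g"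
        using insert.prems(2) by (auto simp: fun_eq_iff g_def single_def carrier_free_vs)
      moreover have "P (f x \<odot>\<^bsub>free_vs K S\<^esub> single K x \<oplus>\<^bsub>free_vs K S\<^esub> g)"
        using insert.prems(2) False g insert.IH[OF sub g]
        by (intro step) (auto simp: carrier_free_vs)
      ultimately show ?thesis by simp
    qed
  qed
qed

section \<open>Quotient vector spaces\<close>

lemma abelian_subgroup_submodule:
  assumes "submodule K U V"
  shows "abelian_subgroup U V"
proof -
  interpret U: submodule K U V by fact
  interpret module K V by (rule U.module)
  show ?thesis
  proof (rule abelian_subgroupI3)
    show "additive_subgroup U V"
    proof (rule additive_subgroup.intro, rule group.subgroupI)
      show "group (add_monoid V)" by (rule M.a_group)
      show "U \<noteq> {}" using U.zero_closed by blast
      \<comment> \<open>A submodule is given as closed under sums and scalar multiples; negatives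
        come from multiplication by -1.\<close>
      fix x assume x: "x \<in> U"
      have "inv\<^bsub>add_monoid V\<^esub> x = \<ominus>\<^bsub>V\<^esub> x" by (simp add: a_inv_def)
      also have "\<dots> = (\<ominus>\<^bsub>K\<^esub> \<one>\<^bsub>K\<^esub>) \<odot>\<^bsub>V\<^esub> x"
        using x U.subset by (metis R.one_closed smult_l_minus smult_one subsetD)
      finally show "inv\<^bsub>add_monoid V\<^esub> x \<in> U" using x U.smult_closed by simp
    qed (use U.subset in auto)
  qed (rule M.abelian_group_axioms)
qed


lemma quot_vs_simps [simp]:
  "carrier (quot_vs V U) = a_rcosets\<^bsub>V\<^esub> U"
  "\<zero>\<^bsub>quot_vs V U\<^esub> = U"
  "X \<oplus>\<^bsub>quot_vs V U\<^esub> Y = X <+>\<^bsub>V\<^esub> Y"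
  "a \<odot>\<^bsub>quot_vs V U\<^esub> X = (\<Union>x\<in>X. U +>\<^bsub>V\<^esub> (a \<odot>\<^bsub>V\<^esub> x))"
  by (simp_all add: quot_vs_def)

text \<open>The scalar multiple of a coset is defined as a union over all its representatives.
  Replacing x by u + x with u in U changes \<open>a x\<close> by \<open>a u\<close>, again in U, so
  all members of this nonempty union are the same coset.\<close>

lemma quot_vs_smult_coset:
  assumes "submodule K U V" "a \<in> carrier K" "x \<in> carrier V"
  shows "a \<odot>\<^bsub>quot_vs V U\<^esub> (U +>\<^bsub>V\<^esub> x) = U +>\<^bsub>V\<^esub> (a \<odot>\<^bsub>V\<^esub> x)"
proof -
  interpret U: submodule K U V by fact
  interpret module K V by (rule U.module)
  interpret A: abelian_subgroup U V by (rule abelian_subgroup_submodule[OF assms(1)])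
  have eq: "U +>\<^bsub>V\<^esub> (a \<odot>\<^bsub>V\<^esub> y) = U +>\<^bsub>V\<^esub> (a \<odot>\<^bsub>V\<^esub> x)" if y: "y \<in> U +>\<^bsub>V\<^esub> x" for y
  proof -
    from y obtain u where u: "u \<in> U" "y = u \<oplus>\<^bsub>V\<^esub> x"
      by (auto simp: a_r_coset_def')
    then have "a \<odot>\<^bsub>V\<^esub> y = a \<odot>\<^bsub>V\<^esub> u \<oplus>\<^bsub>V\<^esub> a \<odot>\<^bsub>V\<^esub> x"
      using assms U.subset by (simp add: smult_r_distr subset_iff)
    then have "a \<odot>\<^bsub>V\<^esub> y \<in> U +>\<^bsub>V\<^esub> (a \<odot>\<^bsub>V\<^esub> x)"
      using u assms by (auto simp: a_r_coset_def')
    then show ?thesis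
      using A.a_repr_independence' assms by simp
  qed
  show ?thesis
    unfolding quot_vs_simps using eq A.a_rcos_self[OF assms(3)] by (intro equalityI UN_least) blast+
qed

text \<open>Every element is the coset of some representative and all operations act on
  representatives, so each axiom is inherited from V. Rewriting with \<open>simp only\<close> keeps
  the operations folded; \<open>quot_vs_simps\<close> would turn them into operations on
  sets.\<close>

lemma vectorspace_quot_vs:
  assumes "vectorspace K V" "submodule K U V"
  shows "vectorspace K (quot_vs V U)"
proof -
  interpret vectorspace K V by fact
  interpret A: abelian_subgroup U V by (rule abelian_subgroup_submodule[OF assms(2)])
  have rep: "\<exists>x\<in>carrier V. X = U +>\<^bsub>V\<^esub> x" if "X \<in> carrier (quot_vs V U)" for X
    using that by (auto simp: A_RCOSETS_def')
  have cls: "U +>\<^bsub>V\<^esub> x \<in> carrier (quot_vs V U)" if "x \<in> carrier V" for x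
    using that by (auto simp: A_RCOSETS_def')
  have add: "(U +>\<^bsub>V\<^esub> x) \<oplus>\<^bsub>quot_vs V U\<^esub> (U +>\<^bsub>V\<^esub> y) = U +>\<^bsub>V\<^esub> (x \<oplus>\<^bsub>V\<^esub> y)"
    if "x \<in> carrier V" "y \<in> carrier V" for x y
    using A.a_rcos_sum that by simp
  have zero: "\<zero>\<^bsub>quot_vs V U\<^esub> = U +>\<^bsub>V\<^esub> \<zero>\<^bsub>V\<^esub>"
    using A.a_subset by simp
  note smult = quot_vs_smult_coset[OF assms(2)]
  have "module K (quot_vs V U)"
  proof (intro moduleI abelian_groupI)
    fix X Y assume "X \<in> carrier (quot_vs V U)" "Y \<in> carrier (quot_vs V U)"
    then obtain x y where "x \<in> carrier V" "y \<in> carrier V" "X = U +>\<^bsub>V\<^esub> x" "Y = U +>\<^bsub>V\<^esub> y"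
      using rep by meson
    then show "X \<oplus>\<^bsub>quot_vs V U\<^esub> Y \<in> carrier (quot_vs V U)"
      and "X \<oplus>\<^bsub>quot_vs V U\<^esub> Y = Y \<oplus>\<^bsub>quot_vs V U\<^esub> X"
      by (simp_all only: add cls M.add.m_comm M.add.m_closed)
  next
    fix X Y Z
    assume "X \<in> carrier (quot_vs V U)" "Y \<in> carrier (quot_vs V U)" "Z \<in> carrier (quot_vs V U)"
    then obtain x y z where "x \<in> carrier V" "y \<in> carrier V" "z \<in> carrier V"
        "X = U +>\<^bsub>V\<^esub> x" "Y = U +>\<^bsub>V\<^esub> y" "Z = U +>\<^bsub>V\<^esub> z"
      using rep by meson
    then show "X \<oplus>\<^bsub>quot_vs V U\<^esub> Y \<oplus>\<^bsub>quot_vs V U\<^esub> Z = X \<oplus>\<^bsub>quot_vs V U\<^esub> (Y \<oplus>\<^bsub>quot_vs V U\<^esub> Z)"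
      by (simp only: add M.add.m_assoc M.add.m_closed)
  next
    fix X assume "X \<in> carrier (quot_vs V U)"
    then obtain x where x: "x \<in> carrier V" "X = U +>\<^bsub>V\<^esub> x"
      using rep by meson
    then show "\<zero>\<^bsub>quot_vs V U\<^esub> \<oplus>\<^bsub>quot_vs V U\<^esub> X = X"
      by (simp only: zero add M.l_zero M.zero_closed)
    have "(U +>\<^bsub>V\<^esub> (\<ominus>\<^bsub>V\<^esub> x)) \<oplus>\<^bsub>quot_vs V U\<^esub> X = \<zero>\<^bsub>quot_vs V U\<^esub>"
      using x by (simp only: zero add M.l_neg M.a_inv_closed)
    then show "\<exists>Y\<in>carrier (quot_vs V U). Y \<oplus>\<^bsub>quot_vs V U\<^esub> X = \<zero>\<^bsub>quot_vs V U\<^esub>"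
      using cls[OF M.a_inv_closed[OF x(1)]] by blast
    show "\<one>\<^bsub>K\<^esub> \<odot>\<^bsub>quot_vs V U\<^esub> X = X"
      using x by (simp only: smult R.one_closed smult_one)
    fix a assume a: "a \<in> carrier K"
    then show "a \<odot>\<^bsub>quot_vs V U\<^esub> X \<in> carrier (quot_vs V U)"
      using x by (simp only: smult cls smult_closed)
    fix b assume b: "b \<in> carrier K"
    show "(a \<oplus>\<^bsub>K\<^esub> b) \<odot>\<^bsub>quot_vs V U\<^esub> X =
        a \<odot>\<^bsub>quot_vs V U\<^esub> X \<oplus>\<^bsub>quot_vs V U\<^esub> b \<odot>\<^bsub>quot_vs V U\<^esub> X"
      using x a b by (simp only: smult add smult_closed smult_l_distr R.a_closed)
    show "(a \<otimes>\<^bsub>K\<^esub> b) \<odot>\<^bsub>quot_vs V U\<^esub> X = a \<odot>\<^bsub>quot_vs V U\<^esub> (b \<odot>\<^bsub>quot_vs V U\<^esub> X)"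
      using x a b by (simp only: smult smult_closed smult_assoc1 R.m_closed)
  next
    fix a X Y
    assume a: "a \<in> carrier K" and "X \<in> carrier (quot_vs V U)" "Y \<in> carrier (quot_vs V U)"
    then obtain x y where "x \<in> carrier V" "y \<in> carrier V" "X = U +>\<^bsub>V\<^esub> x" "Y = U +>\<^bsub>V\<^esub> y"
      using rep by meson
    then show "a \<odot>\<^bsub>quot_vs V U\<^esub> (X \<oplus>\<^bsub>quot_vs V U\<^esub> Y) =
        a \<odot>\<^bsub>quot_vs V U\<^esub> X \<oplus>\<^bsub>quot_vs V U\<^esub> a \<odot>\<^bsub>quot_vs V U\<^esub> Y"
      using a by (simp only: smult add smult_closed smult_r_distr M.add.m_closed)
  qed (use zero cls M.zero_closed R.is_cring in \<open>simp_all only:\<close>)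
  then show ?thesis
    by (simp add: vectorspace_def field_axioms)
qed

lemma coset_hom:
  assumes "vectorspace K V" "submodule K U V"
  shows "(\<lambda>x. U +>\<^bsub>V\<^esub> x) \<in> module_hom K V (quot_vs V U)"
proof -
  interpret vectorspace K V by fact
  interpret A: abelian_subgroup U V by (rule abelian_subgroup_submodule[OF assms(2)])
  show ?thesis
    unfolding module_hom_def using A.a_rcos_sum quot_vs_smult_coset[OF assms(2)]
    by (auto simp: A_RCOSETS_def' simp del: quot_vs_simps(4))
qed

section \<open>Linear extension from a basis\<close>

lemma free_lift_hom:
  assumes "vectorspace K U" and b: "\<And>x. x \<in> S \<Longrightarrow> b x \<in> carrier U"
  shows "(\<lambda>f. \<Oplus>\<^bsub>U\<^esub>x\<in>{x. f x \<noteq> \<zero>\<^bsub>K\<^esub>}. f x \<odot>\<^bsub>U\<^esub> b x) \<in> module_hom K (free_vs K S) U"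
    (is "?L \<in> _")
proof -
  interpret vectorspace K U by fact
  have closed: "(\<lambda>x. f x \<odot>\<^bsub>U\<^esub> b x) \<in> A \<rightarrow> carrier U"
    if "f \<in> carrier (free_vs K S)" "A \<subseteq> S" for f A
    using that b by (auto simp: carrier_free_vs)
  have sub: "{x. f x \<noteq> \<zero>\<^bsub>K\<^esub>} \<subseteq> S" if "f \<in> carrier (free_vs K S)" for f
    using that by (auto simp: carrier_free_vs)
  \<comment> \<open>The range of summation depends on f. To compare the sums for f, g and f + g, or
    for f and a f, they are first extended by zero terms to one common finite set.\<close>
  have ext: "?L f = (\<Oplus>\<^bsub>U\<^esub>x\<in>A. f x \<odot>\<^bsub>U\<^esub> b x)"
    if f: "f \<in> carrier (free_vs K S)" and A: "finite A" "A \<subseteq> S" "{x. f x \<noteq> \<zero>\<^bsub>K\<^esub>} \<subseteq> A" for f A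
    using f A b by (intro M.add.finprod_mono_neutral_cong_left) (auto simp: carrier_free_vs)
  show ?thesis
    unfolding module_hom_def
  proof (intro CollectI conjI allI impI; (elim conjE)?)
    show "?L \<in> carrier (free_vs K S) \<rightarrow> carrier U"
      using closed sub by (intro funcsetI M.finsum_closed) blast
  next
    fix f g assume f: "f \<in> carrier (free_vs K S)" and g: "g \<in> carrier (free_vs K S)"
    define A where "A = {x. f x \<noteq> \<zero>\<^bsub>K\<^esub>} \<union> {x. g x \<noteq> \<zero>\<^bsub>K\<^esub>}"
    interpret F: module K "free_vs K S" by (rule module_free_vs[OF R.is_cring])
    have A: "finite A" "A \<subseteq> S" using f g by (auto simp: A_def carrier_free_vs)
    have fg: "f \<oplus>\<^bsub>free_vs K S\<^esub> g \<in> carrier (free_vs K S)" using f g by (rule F.M.add.m_closed)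
    have "{x. (f \<oplus>\<^bsub>free_vs K S\<^esub> g) x \<noteq> \<zero>\<^bsub>K\<^esub>} \<subseteq> A"
      by (auto simp: A_def)
    then have "?L (f \<oplus>\<^bsub>free_vs K S\<^esub> g) = (\<Oplus>\<^bsub>U\<^esub>x\<in>A. (f x \<oplus>\<^bsub>K\<^esub> g x) \<odot>\<^bsub>U\<^esub> b x)"
      using ext[OF fg A] by simp
    also have "\<dots> = (\<Oplus>\<^bsub>U\<^esub>x\<in>A. f x \<odot>\<^bsub>U\<^esub> b x \<oplus>\<^bsub>U\<^esub> g x \<odot>\<^bsub>U\<^esub> b x)"
      using f g A(2) b by (intro M.add.finprod_cong') (auto simp: carrier_free_vs smult_l_distr subset_iff)
    also have "\<dots> = (\<Oplus>\<^bsub>U\<^esub>x\<in>A. f x \<odot>\<^bsub>U\<^esub> b x) \<oplus>\<^bsub>U\<^esub> (\<Oplus>\<^bsub>U\<^esub>x\<in>A. g x \<odot>\<^bsub>U\<^esub> b x)"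
      using closed[OF f A(2)] closed[OF g A(2)] by (rule M.finsum_addf)
    also have "\<dots> = ?L f \<oplus>\<^bsub>U\<^esub> ?L g"
      using ext[OF f A] ext[OF g A] by (simp add: A_def)
    finally show "?L (f \<oplus>\<^bsub>free_vs K S\<^esub> g) = ?L f \<oplus>\<^bsub>U\<^esub> ?L g" .
  next
    fix a f assume a: "a \<in> carrier K" and f: "f \<in> carrier (free_vs K S)"
    define A where "A = {x. f x \<noteq> \<zero>\<^bsub>K\<^esub>}"
    interpret F: module K "free_vs K S" by (rule module_free_vs[OF R.is_cring])
    have A: "finite A" "A \<subseteq> S" using f by (auto simp: A_def carrier_free_vs)
    have af: "a \<odot>\<^bsub>free_vs K S\<^esub> f \<in> carrier (free_vs K S)" using a f by (rule F.smult_closed)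
    have "{x. (a \<odot>\<^bsub>free_vs K S\<^esub> f) x \<noteq> \<zero>\<^bsub>K\<^esub>} \<subseteq> A"
      using a by (auto simp: A_def)
    then have "?L (a \<odot>\<^bsub>free_vs K S\<^esub> f) = (\<Oplus>\<^bsub>U\<^esub>x\<in>A. (a \<otimes>\<^bsub>K\<^esub> f x) \<odot>\<^bsub>U\<^esub> b x)"
      using ext[OF af A] by simp
    also have "\<dots> = (\<Oplus>\<^bsub>U\<^esub>x\<in>A. a \<odot>\<^bsub>U\<^esub> (f x \<odot>\<^bsub>U\<^esub> b x))"
      using f a A(2) b by (intro M.add.finprod_cong') (auto simp: carrier_free_vs smult_assoc1 subset_iff)
    also have "\<dots> = a \<odot>\<^bsub>U\<^esub> ?L f"
      using finsum_smult_ldistr[OF A(1) a closed[OF f A(2)]] by (simp add: A_def)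
    finally show "?L (a \<odot>\<^bsub>free_vs K S\<^esub> f) = a \<odot>\<^bsub>U\<^esub> ?L f" .
  qed
qed

lemma free_lift_single:
  assumes "vectorspace K U" and "b x \<in> carrier U"
  shows "(\<Oplus>\<^bsub>U\<^esub>y\<in>{y. single K x y \<noteq> \<zero>\<^bsub>K\<^esub>}. single K x y \<odot>\<^bsub>U\<^esub> b y) = b x"
proof -
  interpret vectorspace K U by fact
  have "{y. single K x y \<noteq> \<zero>\<^bsub>K\<^esub>} = {x}"
    by (auto simp: single_def)
  then show ?thesis
    using assms(2) by (simp add: single_def)
qed

section \<open>Bilinear maps and the tensor product\<close>

lemma bilinear_mapI:
  assumes "\<And>v. v \<in> carrier V \<Longrightarrow> (\<lambda>w. B v w) \<in> module_hom K W U"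
    and "\<And>w. w \<in> carrier W \<Longrightarrow> (\<lambda>v. B v w) \<in> module_hom K V U"
  shows "bilinear_map K V W U B"
  using assms by (simp add: bilinear_map_def)

lemma bilinear_mapD:
  assumes "bilinear_map K V W U B"
  shows "v \<in> carrier V \<Longrightarrow> (\<lambda>w. B v w) \<in> module_hom K W U"
    and "w \<in> carrier W \<Longrightarrow> (\<lambda>v. B v w) \<in> module_hom K V U"
    and "\<lbrakk>v \<in> carrier V; w \<in> carrier W\<rbrakk> \<Longrightarrow> B v w \<in> carrier U"
  using assms by (auto simp: bilinear_map_def module_hom_def)

lemma module_hom_in:
  "\<lbrakk>f \<in> module_hom K V W; v \<in> carrier V\<rbrakk> \<Longrightarrow> f v \<in> carrier W"
  by (auto simp: module_hom_def)

lemma module_hom_ker: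
  assumes "vectorspace K V" "vectorspace K W" "f \<in> module_hom K V W" "S \<subseteq> carrier V"
    and "\<And>x. x \<in> S \<Longrightarrow> f x = \<zero>\<^bsub>W\<^esub>" and "x \<in> module.span K V S"
  shows "f x = \<zero>\<^bsub>W\<^esub>"
proof -
  interpret V: vectorspace K V by fact
  interpret W: vectorspace K W by fact
  interpret mod_hom K V W f by unfold_locales fact
  have "V.span S \<subseteq> ker"
    using ker_is_submodule assms(4,5) by (intro V.span_is_subset) (auto simp: ker_def)
  then show ?thesis using assms(6) by (auto simp: ker_def)
qed

lemma bilinear_rels_subset:
  assumes "vectorspace K V" "vectorspace K W"
  shows "bilinear_rels K V W \<subseteq> carrier (free_vs K (carrier V \<times> carrier W))"
proof -
  interpret V: vectorspace K V by fact
  interpret W: vectorspace K W by fact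
  interpret F: module K "free_vs K (carrier V \<times> carrier W)"
    by (rule module_free_vs[OF V.R.is_cring])
  note simps = F.M.minus_closed F.M.add.m_closed F.smult_closed
    single_closed[OF V.R.is_cring, of _ "carrier V \<times> carrier W"]
  show ?thesis
    unfolding bilinear_rels_def Let_def
    by (auto simp del: free_vs_simps intro!: simps)
qed

lemma tensor_rels_submodule:
  assumes "vectorspace K V" "vectorspace K W"
  shows "submodule K (tensor_rels K V W) (free_vs K (carrier V \<times> carrier W))"
proof -
  interpret V: vectorspace K V by fact
  interpret F: module K "free_vs K (carrier V \<times> carrier W)"
    by (rule module_free_vs[OF V.R.is_cring])
  show ?thesis
    unfolding tensor_rels_def
    by (rule F.span_is_submodule[OF bilinear_rels_subset[OF assms]])
qed

lemma vectorspace_tensor: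
  assumes "vectorspace K V" "vectorspace K W"
  shows "vectorspace K (tensor K V W)"
  unfolding tensor_def
  using assms by (intro vectorspace_quot_vs vectorspace_free_vs tensor_rels_submodule)
    (auto simp: vectorspace_def)

text \<open>This is the independence of the representative. Let L be the linear extension of B to
  the free space. Bilinearity of B makes L vanish on the generating relations, hence on their span,
  and any representative of the coset differs from f by an element of that span.\<close>

lemma sweedler_coset:
  assumes V: "vectorspace K V" and W: "vectorspace K W" and U: "vectorspace K U"
    and B: "bilinear_map K V W U B"
    and f: "f \<in> carrier (free_vs K (carrier V \<times> carrier W))"
  shows "sweedler K U (tensor_rels K V W +>\<^bsub>free_vs K (carrier V \<times> carrier W)\<^esub> f) B =
    (\<Oplus>\<^bsub>U\<^esub>p\<in>{p. f p \<noteq> \<zero>\<^bsub>K\<^esub>}. f p \<odot>\<^bsub>U\<^esub> case_prod B p)"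
proof -
  let ?F = "free_vs K (carrier V \<times> carrier W)"
  define L where "L f = (\<Oplus>\<^bsub>U\<^esub>p\<in>{p. f p \<noteq> \<zero>\<^bsub>K\<^esub>}. f p \<odot>\<^bsub>U\<^esub> case_prod B p)" for f
  interpret V: vectorspace K V by fact
  interpret W: vectorspace K W by fact
  interpret U: vectorspace K U by fact
  have F: "vectorspace K ?F" by (rule vectorspace_free_vs) (rule V.field_axioms)
  interpret F: vectorspace K ?F by fact
  interpret A: abelian_subgroup "tensor_rels K V W" ?F
    by (rule abelian_subgroup_submodule[OF tensor_rels_submodule[OF V W]])
  note [simp del] = free_vs_simps
  have L: "L \<in> module_hom K ?F U"
    unfolding L_def using B by (intro free_lift_hom[OF U]) (auto simp: bilinear_mapD)
  interpret L: mod_hom K ?F U L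
    by unfold_locales (rule L)
  have e [simp]: "single K (v, w) \<in> carrier ?F" if "v \<in> carrier V" "w \<in> carrier W" for v w
    using that by (simp add: single_closed[OF V.R.is_cring])
  have Le [simp]: "L (single K (v, w)) = B v w" if "v \<in> carrier V" "w \<in> carrier W" for v w
    using free_lift_single[OF U, of "case_prod B" "(v, w)"] bilinear_mapD(3)[OF B that]
    by (simp add: L_def)
  have Bc [simp]: "B v w \<in> carrier U" if "v \<in> carrier V" "w \<in> carrier W" for v w
    using bilinear_mapD(3)[OF B that] .
  have lin [simp]:
    "B (v \<oplus>\<^bsub>V\<^esub> v') w = B v w \<oplus>\<^bsub>U\<^esub> B v' w" "B (a \<odot>\<^bsub>V\<^esub> v) w = a \<odot>\<^bsub>U\<^esub> B v w"
    if "v \<in> carrier V" "v' \<in> carrier V" "w \<in> carrier W" "a \<in> carrier K" for v v' w a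
    using bilinear_mapD(2)[OF B that(3)] that by (simp_all add: module_hom_def)
  have lin' [simp]:
    "B v (w \<oplus>\<^bsub>W\<^esub> w') = B v w \<oplus>\<^bsub>U\<^esub> B v w'" "B v (a \<odot>\<^bsub>W\<^esub> w) = a \<odot>\<^bsub>U\<^esub> B v w"
    if "v \<in> carrier V" "w \<in> carrier W" "w' \<in> carrier W" "a \<in> carrier K" for v w w' a
    using bilinear_mapD(1)[OF B that(1)] that by (simp_all add: module_hom_def)
  \<comment> \<open>\<open>lin\<close> and \<open>lin'\<close> state an additive and a scalar law
    under common premises. The premises on variables absent from the law being used are discharged
    with the zero scalar or the zero vector.\<close>
  have "L x = \<zero>\<^bsub>U\<^esub>" if "x \<in> bilinear_rels K V W" for x
    using that unfolding bilinear_rels_def Let_def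
    by (auto simp: U.M.minus_eq U.M.r_neg lin[OF _ _ _ V.R.zero_closed] lin'[OF _ _ _ V.R.zero_closed]
      lin(2)[OF _ V.M.zero_closed] lin'(2)[OF _ _ W.M.zero_closed])
  then have ker: "L r = \<zero>\<^bsub>U\<^esub>" if "r \<in> tensor_rels K V W" for r
    using that module_hom_ker[OF F U L bilinear_rels_subset[OF V W]]
    unfolding tensor_rels_def by blast
  \<comment> \<open>The representative that \<open>sweedler\<close> itself chooses.\<close>
  define g where "g = (SOME g. g \<in> tensor_rels K V W +>\<^bsub>?F\<^esub> f)"
  have "g \<in> tensor_rels K V W +>\<^bsub>?F\<^esub> f"
    unfolding g_def by (rule someI[where x = f], rule A.a_rcos_self[OF f])
  then obtain r where r: "r \<in> tensor_rels K V W" and g: "g = r \<oplus>\<^bsub>?F\<^esub> f"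
    by (auto simp: a_r_coset_def')
  have "L g = L f"
    using g r f ker[OF r] A.a_subset by (simp add: subset_iff)
  then show ?thesis
    by (simp add: sweedler_def Let_def g_def[symmetric] L_def case_prod_unfold)
qed

lemma tens_in:
  assumes "vectorspace K V" "vectorspace K W" "v \<in> carrier V" "w \<in> carrier W"
  shows "tens K V W v w \<in> carrier (tensor K V W)"
proof -
  interpret V: vectorspace K V by fact
  show ?thesis
    using assms(3,4) unfolding tensor_def tens_def
    by (intro module_hom_in[OF coset_hom[where K = K]] vectorspace_free_vs tensor_rels_submodule[OF assms(1,2)]
        V.field_axioms single_closed V.R.is_cring) auto
qed

lemma tensor_carrierE:
  assumes "t \<in> carrier (tensor K V W)"
  obtains f where "f \<in> carrier (free_vs K (carrier V \<times> carrier W))"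
    "t = tensor_rels K V W +>\<^bsub>free_vs K (carrier V \<times> carrier W)\<^esub> f"
  using assms by (auto simp: tensor_def A_RCOSETS_def')

lemma sweedler_tens:
  assumes V: "vectorspace K V" and W: "vectorspace K W" and U: "vectorspace K U"
    and B: "bilinear_map K V W U B" and "v \<in> carrier V" "w \<in> carrier W"
  shows "sweedler K U (tens K V W v w) B = B v w"
proof -
  interpret V: vectorspace K V by fact
  have "single K (v, w) \<in> carrier (free_vs K (carrier V \<times> carrier W))"
    using assms by (simp add: single_closed V.R.is_cring)
  from sweedler_coset[OF V W U B this] show ?thesis
    using free_lift_single[OF U, of "case_prod B" "(v, w)"] bilinear_mapD(3)[OF B assms(5,6)]
    by (simp add: tens_def)
qed

text \<open>Together with \<open>sweedler_tens\<close> this is the existence half of the universal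
  property; \<open>tensor_hom_eqI\<close> is the uniqueness half. Linearity descends from the free
  space because sums and scalar multiples of cosets are computed on representatives.\<close>

lemma sweedler_hom:
  assumes V: "vectorspace K V" and W: "vectorspace K W" and U: "vectorspace K U"
    and B: "bilinear_map K V W U B"
  shows "(\<lambda>t. sweedler K U t B) \<in> module_hom K (tensor K V W) U"
proof -
  let ?F = "free_vs K (carrier V \<times> carrier W)"
  let ?R = "tensor_rels K V W"
  interpret V: vectorspace K V by fact
  have F: "vectorspace K ?F" by (rule vectorspace_free_vs) (rule V.field_axioms)
  interpret F: vectorspace K ?F by fact
  note R = tensor_rels_submodule[OF V W]
  have cls: "(\<lambda>f. ?R +>\<^bsub>?F\<^esub> f) \<in> module_hom K ?F (tensor K V W)"
    unfolding tensor_def by (rule coset_hom[OF F R])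
  note sw = sweedler_coset[OF V W U B]
  have L: "(\<lambda>f. sweedler K U (?R +>\<^bsub>?F\<^esub> f) B) \<in> module_hom K ?F U"
  proof -
    have "(\<lambda>f. \<Oplus>\<^bsub>U\<^esub>p\<in>{p. f p \<noteq> \<zero>\<^bsub>K\<^esub>}. f p \<odot>\<^bsub>U\<^esub> case_prod B p) \<in> module_hom K ?F U"
      using B by (intro free_lift_hom[OF U]) (auto simp: bilinear_mapD)
    then show ?thesis
      unfolding module_hom_def
      by (simp add: sw F.M.add.m_closed F.smult_closed Pi_def del: free_vs_simps cong: conj_cong)
  qed
  show ?thesis
    unfolding module_hom_def
  proof (intro CollectI conjI allI impI funcsetI; (elim conjE)?)
    fix t assume "t \<in> carrier (tensor K V W)"
    then obtain f where "f \<in> carrier ?F" "t = ?R +>\<^bsub>?F\<^esub> f" by (rule tensor_carrierE)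
    then show "sweedler K U t B \<in> carrier U" using module_hom_in[OF L] by simp
  next
    fix s t assume s: "s \<in> carrier (tensor K V W)" and t: "t \<in> carrier (tensor K V W)"
    obtain f where "f \<in> carrier ?F" "s = ?R +>\<^bsub>?F\<^esub> f" by (rule tensor_carrierE[OF s])
    moreover obtain g where "g \<in> carrier ?F" "t = ?R +>\<^bsub>?F\<^esub> g" by (rule tensor_carrierE[OF t])
    ultimately show "sweedler K U (s \<oplus>\<^bsub>tensor K V W\<^esub> t) B = sweedler K U s B \<oplus>\<^bsub>U\<^esub> sweedler K U t B"
      using module_hom_add[OF cls] module_hom_add[OF L] by metis
  next
    fix a t assume a: "a \<in> carrier K" and t: "t \<in> carrier (tensor K V W)"
    obtain f where "f \<in> carrier ?F" "t = ?R +>\<^bsub>?F\<^esub> f" by (rule tensor_carrierE[OF t])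
    then show "sweedler K U (a \<odot>\<^bsub>tensor K V W\<^esub> t) B = a \<odot>\<^bsub>U\<^esub> sweedler K U t B"
      using module_hom_smult[OF cls] module_hom_smult[OF L] a by metis
  qed
qed

lemma module_hom_zero:
  assumes "vectorspace K V" "vectorspace K W" "f \<in> module_hom K V W"
  shows "f \<zero>\<^bsub>V\<^esub> = \<zero>\<^bsub>W\<^esub>"
proof -
  interpret V: vectorspace K V by fact
  interpret W: vectorspace K W by fact
  interpret mod_hom K V W f by unfold_locales fact
  show ?thesis by simp
qed

text \<open>The pure tensors are the classes of the basis vectors of the free space, so they span
  the quotient. The induction is over a representative of t.\<close>

lemma tensor_hom_eqI:
  assumes V: "vectorspace K V" and W: "vectorspace K W" and U: "vectorspace K U"
    and F: "F \<in> module_hom K (tensor K V W) U" and G: "G \<in> module_hom K (tensor K V W) U"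
    and eq: "\<And>v w. \<lbrakk>v \<in> carrier V; w \<in> carrier W\<rbrakk> \<Longrightarrow> F (tens K V W v w) = G (tens K V W v w)"
    and t: "t \<in> carrier (tensor K V W)"
  shows "F t = G t"
proof -
  let ?F = "free_vs K (carrier V \<times> carrier W)"
  let ?q = "\<lambda>f. tensor_rels K V W +>\<^bsub>?F\<^esub> f"
  interpret V: vectorspace K V by fact
  have FF: "vectorspace K ?F" by (rule vectorspace_free_vs) (rule V.field_axioms)
  have T: "vectorspace K (tensor K V W)" by (rule vectorspace_tensor[OF V W])
  interpret FF: vectorspace K ?F by fact
  interpret T: vectorspace K "tensor K V W" by fact
  have q: "?q \<in> module_hom K ?F (tensor K V W)"
    unfolding tensor_def by (rule coset_hom[OF FF tensor_rels_submodule[OF V W]])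
  note s = single_closed[OF V.R.is_cring, of _ "carrier V \<times> carrier W"]
  note hom = module_hom_add[OF q] module_hom_smult[OF q] module_hom_add[OF F] module_hom_add[OF G]
    module_hom_smult[OF F] module_hom_smult[OF G] module_hom_zero[OF FF T q]
    module_hom_zero[OF T U F] module_hom_zero[OF T U G]
  from t obtain f where f: "f \<in> carrier ?F" "t = ?q f" by (rule tensor_carrierE)
  from V.R.is_cring f(1) have "F (?q f) = G (?q f)"
  proof (induction rule: free_vs_induct)
    case zero
    then show ?case by (simp only: hom)
  next
    case (step a x g)
    have x: "F (?q (single K x)) = G (?q (single K x))"
      using eq step.hyps(2) by (auto simp: tens_def)
    show ?case
      using step x s[OF step.hyps(2)] module_hom_in[OF q] FF.smult_closed T.smult_closed
      by (simp only: hom)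
  qed
  then show ?thesis using f by simp
qed


section \<open>Linearity of Sweedler expressions\<close>

lemma module_homI:
  assumes "\<And>x. x \<in> carrier V \<Longrightarrow> f x \<in> carrier W"
    and "\<And>x y. \<lbrakk>x \<in> carrier V; y \<in> carrier V\<rbrakk> \<Longrightarrow> f (x \<oplus>\<^bsub>V\<^esub> y) = f x \<oplus>\<^bsub>W\<^esub> f y"
    and "\<And>a x. \<lbrakk>a \<in> carrier K; x \<in> carrier V\<rbrakk> \<Longrightarrow> f (a \<odot>\<^bsub>V\<^esub> x) = a \<odot>\<^bsub>W\<^esub> f x"
  shows "f \<in> module_hom K V W"
  using assms by (auto simp: module_hom_def)

lemma module_hom_cong:
  assumes "vectorspace K V" and "\<And>x. x \<in> carrier V \<Longrightarrow> f x = g x"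
  shows "f \<in> module_hom K V W \<longleftrightarrow> g \<in> module_hom K V W"
proof -
  interpret vectorspace K V by fact
  show ?thesis
    using assms(2) by (auto simp: module_hom_def Pi_def)
qed

text \<open>The relations were chosen for this: for each of the four laws, the difference of the two
  sides lifts to one of the generators in \<open>bilinear_rels\<close>, so its class is
  zero.\<close>

lemma bilinear_map_tens:
  assumes V: "vectorspace K V" and W: "vectorspace K W"
  shows "bilinear_map K V W (tensor K V W) (tens K V W)"
proof -
  let ?F = "free_vs K (carrier V \<times> carrier W)"
  let ?R = "tensor_rels K V W"
  let ?q = "\<lambda>f. ?R +>\<^bsub>?F\<^esub> f"
  interpret V: vectorspace K V by fact
  interpret W: vectorspace K W by fact
  have F: "vectorspace K ?F" by (rule vectorspace_free_vs) (rule V.field_axioms)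
  have T: "vectorspace K (tensor K V W)" by (rule vectorspace_tensor[OF V W])
  interpret F: vectorspace K ?F by fact
  interpret T: vectorspace K "tensor K V W" by fact
  have q: "?q \<in> module_hom K ?F (tensor K V W)"
    unfolding tensor_def by (rule coset_hom[OF F tensor_rels_submodule[OF V W]])
  interpret q: mod_hom K ?F "tensor K V W" ?q by unfold_locales (rule q)
  interpret A: abelian_subgroup ?R ?F
    by (rule abelian_subgroup_submodule[OF tensor_rels_submodule[OF V W]])
  note [simp del] = free_vs_simps
  have e [simp]: "single K (v, w) \<in> carrier ?F" if "v \<in> carrier V" "w \<in> carrier W" for v w
    using that by (simp add: single_closed[OF V.R.is_cring])
  have eqI: "?q x = ?q y"
    if "x \<ominus>\<^bsub>?F\<^esub> y \<in> bilinear_rels K V W" "x \<in> carrier ?F" "y \<in> carrier ?F" for x y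
  proof -
    have "x \<ominus>\<^bsub>?F\<^esub> y \<in> ?R"
      using that(1) F.in_own_span[OF bilinear_rels_subset[OF V W]] by (auto simp: tensor_rels_def)
    then have "?q (x \<ominus>\<^bsub>?F\<^esub> y) = \<zero>\<^bsub>tensor K V W\<^esub>"
      using A.a_rcos_const by (simp add: tensor_def)
    then have "?q x \<ominus>\<^bsub>tensor K V W\<^esub> ?q y = \<zero>\<^bsub>tensor K V W\<^esub>"
      using that by simp
    then show ?thesis
      using that q.f_im
      by (metis T.M.minus_eq T.M.minus_equality T.M.minus_minus T.M.a_inv_closed)
  qed
  have rels:
    "\<lbrakk>v \<in> carrier V; v' \<in> carrier V; w \<in> carrier W\<rbrakk> \<Longrightarrow>
      single K (v \<oplus>\<^bsub>V\<^esub> v', w) \<ominus>\<^bsub>?F\<^esub> (single K (v, w) \<oplus>\<^bsub>?F\<^esub> single K (v', w)) \<in> bilinear_rels K V W"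
    "\<lbrakk>v \<in> carrier V; w \<in> carrier W; w' \<in> carrier W\<rbrakk> \<Longrightarrow>
      single K (v, w \<oplus>\<^bsub>W\<^esub> w') \<ominus>\<^bsub>?F\<^esub> (single K (v, w) \<oplus>\<^bsub>?F\<^esub> single K (v, w')) \<in> bilinear_rels K V W"
    "\<lbrakk>v \<in> carrier V; w \<in> carrier W; a \<in> carrier K\<rbrakk> \<Longrightarrow>
      single K (a \<odot>\<^bsub>V\<^esub> v, w) \<ominus>\<^bsub>?F\<^esub> a \<odot>\<^bsub>?F\<^esub> single K (v, w) \<in> bilinear_rels K V W"
    "\<lbrakk>v \<in> carrier V; w \<in> carrier W; a \<in> carrier K\<rbrakk> \<Longrightarrow>
      single K (v, a \<odot>\<^bsub>W\<^esub> w) \<ominus>\<^bsub>?F\<^esub> a \<odot>\<^bsub>?F\<^esub> single K (v, w) \<in> bilinear_rels K V W" for v v' w w' a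
    unfolding bilinear_rels_def Let_def by blast+
  show ?thesis
    unfolding tens_def
    by (intro bilinear_mapI module_homI; (subst eqI[OF rels(1)] eqI[OF rels(2)] eqI[OF rels(3)] eqI[OF rels(4)])?) simp_all
qed

lemma module_hom_ident: "(\<lambda>x. x) \<in> module_hom K V V"
  by (simp add: module_hom_def)

lemma module_hom_compose:
  "\<lbrakk>f \<in> module_hom K V W; g \<in> module_hom K U V\<rbrakk> \<Longrightarrow> (\<lambda>x. f (g x)) \<in> module_hom K U W"
  by (auto simp: module_hom_def Pi_def)

lemma module_hom_bilinear:
  assumes "bilinear_map K V W U B"
  shows "\<lbrakk>g \<in> module_hom K X V; w \<in> carrier W\<rbrakk> \<Longrightarrow> (\<lambda>x. B (g x) w) \<in> module_hom K X U"
    and "\<lbrakk>v \<in> carrier V; h \<in> module_hom K X W\<rbrakk> \<Longrightarrow> (\<lambda>x. B v (h x)) \<in> module_hom K X U"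
  using assms module_hom_compose[of "\<lambda>v. B v w" K V U g X] module_hom_compose[of "B v" K W U h X]
  by (auto simp: bilinear_map_def)

lemma module_hom_pointwise_add:
  assumes "vectorspace K W" "f \<in> module_hom K V W" "g \<in> module_hom K V W"
  shows "(\<lambda>x. f x \<oplus>\<^bsub>W\<^esub> g x) \<in> module_hom K V W"
proof -
  interpret W: vectorspace K W by fact
  show ?thesis
    using assms(2,3) by (auto simp: module_hom_def Pi_def W.smult_r_distr W.M.a_ac)
qed

lemma module_hom_pointwise_smult:
  assumes "vectorspace K W" "f \<in> module_hom K V W" "a \<in> carrier K"
  shows "(\<lambda>x. a \<odot>\<^bsub>W\<^esub> f x) \<in> module_hom K V W"
proof -
  interpret W: vectorspace K W by fact
  show ?thesis
    using assms(2,3) by (auto simp: module_hom_def Pi_def W.smult_r_distr W.R.m_comm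
        simp flip: W.smult_assoc1)
qed

lemma module_hom_sweedler_arg:
  assumes "g \<in> module_hom K X (tensor K V W)" "bilinear_map K V W U B"
    and "vectorspace K V" "vectorspace K W" "vectorspace K U"
  shows "(\<lambda>x. sweedler K U (g x) B) \<in> module_hom K X U"
  using module_hom_compose[OF sweedler_hom] assms by metis

text \<open>Here the variable sits in the integrand while the tensor is fixed. For given x and y,
  additivity is an equation between two linear maps of t, so it need only be checked on pure
  tensors, where \<open>sweedler\<close> disappears and \<open>lin\<close> applies. Scalars are
  treated in the same way.\<close>

lemma module_hom_sweedler_param:
  assumes t: "t \<in> carrier (tensor K V W)"
    and bil: "\<And>x. x \<in> carrier X \<Longrightarrow> bilinear_map K V W U (B x)"
    and lin: "\<And>v w. \<lbrakk>v \<in> carrier V; w \<in> carrier W\<rbrakk> \<Longrightarrow> (\<lambda>x. B x v w) \<in> module_hom K X U"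
    and V: "vectorspace K V" and W: "vectorspace K W" and U: "vectorspace K U"
    and X: "vectorspace K X"
  shows "(\<lambda>x. sweedler K U t (B x)) \<in> module_hom K X U"
proof -
  interpret X: vectorspace K X by fact
  note hom = sweedler_hom[OF V W U] and val = sweedler_tens[OF V W U]
  show ?thesis
  proof (rule module_homI)
    fix x y assume x: "x \<in> carrier X" and y: "y \<in> carrier X"
    show "sweedler K U t (B x) \<in> carrier U"
      using module_hom_in[OF hom[OF bil[OF x]] t] .
    have xy: "x \<oplus>\<^bsub>X\<^esub> y \<in> carrier X" using x y by simp
    show "sweedler K U t (B (x \<oplus>\<^bsub>X\<^esub> y)) = sweedler K U t (B x) \<oplus>\<^bsub>U\<^esub> sweedler K U t (B y)"
    proof (rule tensor_hom_eqI[OF V W U _ _ _ t])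
      fix v w assume "v \<in> carrier V" "w \<in> carrier W"
      then show "sweedler K U (tens K V W v w) (B (x \<oplus>\<^bsub>X\<^esub> y)) =
          sweedler K U (tens K V W v w) (B x) \<oplus>\<^bsub>U\<^esub> sweedler K U (tens K V W v w) (B y)"
        using module_hom_add[OF lin x y] x y xy by (simp add: val[OF bil])
    qed (intro hom bil xy module_hom_pointwise_add[OF U] x y)+
  next
    fix a x assume a: "a \<in> carrier K" and x: "x \<in> carrier X"
    have ax: "a \<odot>\<^bsub>X\<^esub> x \<in> carrier X" using a x by simp
    show "sweedler K U t (B (a \<odot>\<^bsub>X\<^esub> x)) = a \<odot>\<^bsub>U\<^esub> sweedler K U t (B x)"
    proof (rule tensor_hom_eqI[OF V W U _ _ _ t])
      fix v w assume "v \<in> carrier V" "w \<in> carrier W"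
      then show "sweedler K U (tens K V W v w) (B (a \<odot>\<^bsub>X\<^esub> x)) =
          a \<odot>\<^bsub>U\<^esub> sweedler K U (tens K V W v w) (B x)"
        using module_hom_smult[OF lin a x] x ax by (simp add: val[OF bil])
    qed (intro hom bil ax module_hom_pointwise_smult[OF U] a x)+
  qed
qed

lemma sweedler_in:
  assumes "t \<in> carrier (tensor K V W)" "bilinear_map K V W U B"
    and "vectorspace K V" "vectorspace K W" "vectorspace K U"
  shows "sweedler K U t B \<in> carrier U"
  using module_hom_in[OF sweedler_hom] assms by metis

lemma module_hom_sweedler:
  assumes V: "vectorspace K V" and W: "vectorspace K W" and U: "vectorspace K U"
    and X: "vectorspace K X"
    and F: "F \<in> module_hom K U X" and t: "t \<in> carrier (tensor K V W)"
    and B: "bilinear_map K V W U B"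
  shows "F (sweedler K U t B) = sweedler K X t (\<lambda>v w. F (B v w))"
proof -
  have FB: "bilinear_map K V W X (\<lambda>v w. F (B v w))"
    using B by (intro bilinear_mapI module_hom_compose[OF F]) (auto simp: bilinear_map_def)
  show ?thesis
    using module_hom_compose[OF F sweedler_hom[OF V W U B]] sweedler_hom[OF V W X FB] _ t
    by (rule tensor_hom_eqI[OF V W X]) (simp add: sweedler_tens[OF V W] U X B FB)
qed

lemma sweedler_expand:
  assumes V: "vectorspace K V" and W: "vectorspace K W" and U: "vectorspace K U"
    and F: "F \<in> module_hom K (tensor K V W) U" and t: "t \<in> carrier (tensor K V W)"
  shows "F t = sweedler K U t (\<lambda>v w. F (tens K V W v w))"
proof -
  have B: "bilinear_map K V W U (\<lambda>v w. F (tens K V W v w))"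
    by (intro bilinear_mapI module_hom_compose[OF F] bilinear_mapD[OF bilinear_map_tens[OF V W]])
  show ?thesis
    using F sweedler_hom[OF V W U B] _ t
    by (rule tensor_hom_eqI[OF V W U]) (simp add: sweedler_tens[OF V W U B])
qed

text \<open>Agreement on the carriers is enough because bilinearity only concerns values there. Thus
  \<open>B'\<close> is bilinear too, and both sums are linear maps of t that agree on pure
  tensors.\<close>

lemma sweedler_cong:
  assumes V: "vectorspace K V" and W: "vectorspace K W" and U: "vectorspace K U"
    and t: "t \<in> carrier (tensor K V W)" and B: "bilinear_map K V W U B"
    and eq: "\<And>v w. \<lbrakk>v \<in> carrier V; w \<in> carrier W\<rbrakk> \<Longrightarrow> B v w = B' v w"
  shows "sweedler K U t B = sweedler K U t B'"
proof -
  interpret V: vectorspace K V by fact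
  interpret W: vectorspace K W by fact
  have B': "bilinear_map K V W U B'"
    using bilinear_mapD[OF B] eq
    by (intro bilinear_mapI; subst module_hom_cong[OF _ eq[symmetric]]) (simp_all add: V W)
  have "sweedler K U (tens K V W v w) B = sweedler K U (tens K V W v w) B'"
    if "v \<in> carrier V" "w \<in> carrier W" for v w
    using that by (simp add: sweedler_tens[OF V W U B] sweedler_tens[OF V W U B'] eq)
  then show ?thesis
    by (rule tensor_hom_eqI[OF V W U sweedler_hom[OF V W U B] sweedler_hom[OF V W U B'] _ t])
qed

section \<open>The base field and scalar multiplication\<close>

lemma vectorspace_base_vs:
  assumes "field K"
  shows "vectorspace K (base_vs K)"
proof -
  interpret field K by fact
  have "module K (base_vs K)"
    by (intro moduleI abelian_groupI)
      (auto simp: base_vs_def a_ac l_distr r_distr m_assoc is_cring intro: bexI[of _ "\<ominus>\<^bsub>K\<^esub> x" for x])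
  then show ?thesis
    by (simp add: vectorspace_def field_axioms)
qed

lemma bilinear_map_smult:
  assumes "vectorspace K V"
  shows "bilinear_map K (base_vs K) V V (\<lambda>a v. a \<odot>\<^bsub>V\<^esub> v)"
proof -
  interpret vectorspace K V by fact
  show ?thesis
    by (auto simp: bilinear_map_def module_hom_def base_vs_def smult_r_distr smult_l_distr R.m_comm
        simp flip: smult_assoc1)
qed

lemma carrier_base_vs [simp]: "carrier (base_vs K) = carrier K"
  by (simp add: base_vs_def)

text \<open>
  Applied in a loop together with \<open>assumption\<close>, these rules show that an expression in Sweedler notation is
  linear in each of its variables: which argument contains the bound variable decides which rule
  unifies. The premises that determine the tensor factors precede the premises \<open>vectorspace K V\<close>, so the
  latter contain no schematic variables when they are reached.
\<close>

lemmas bilinear_intros = bilinear_mapI module_hom_ident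
  module_hom_sweedler_arg module_hom_sweedler_param sweedler_in vectorspace_tensor tens_in
  module_hom_bilinear[OF bilinear_map_tens]

section \<open>Tensor products of maps, associativity and unit constraints\<close>

lemma tensor_map_hom:
  assumes "vectorspace K V" "vectorspace K W" "vectorspace K X" "vectorspace K Y"
    and f: "f \<in> module_hom K V X" and g: "g \<in> module_hom K W Y"
  shows "tensor_map K X Y f g \<in> module_hom K (tensor K V W) (tensor K X Y)"
    and "\<lbrakk>v \<in> carrier V; w \<in> carrier W\<rbrakk> \<Longrightarrow>
      tensor_map K X Y f g (tens K V W v w) = tens K X Y (f v) (g w)"
proof -
  have "bilinear_map K V W (tensor K X Y) (\<lambda>v w. tens K X Y (f v) (g w))"
    by (assumption | rule bilinear_intros assms module_hom_in[OF f] module_hom_in[OF g])+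
  with assms(1-4) show "tensor_map K X Y f g \<in> module_hom K (tensor K V W) (tensor K X Y)"
    and "\<lbrakk>v \<in> carrier V; w \<in> carrier W\<rbrakk> \<Longrightarrow>
      tensor_map K X Y f g (tens K V W v w) = tens K X Y (f v) (g w)"
    unfolding tensor_map_def[abs_def]
    by (simp_all add: sweedler_hom sweedler_tens vectorspace_tensor)
qed

text \<open>The evaluation keeps an arbitrary s in U \<otimes> V because coassociativity rebrackets
  \<open>\<Delta> c1 \<otimes> c2\<close>, whose first factor is not pure. For pure s it specialises
  to \<open>tensor_assoc_tens\<close>.\<close>

lemma tensor_assoc_hom:
  assumes U: "vectorspace K U" and V: "vectorspace K V" and W: "vectorspace K W"
  shows "tensor_assoc K U V W \<in>
      module_hom K (tensor K (tensor K U V) W) (tensor K U (tensor K V W))"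
    and "\<lbrakk>s \<in> carrier (tensor K U V); w \<in> carrier W\<rbrakk> \<Longrightarrow>
      tensor_assoc K U V W (tens K (tensor K U V) W s w) =
        sweedler K (tensor K U (tensor K V W)) s (\<lambda>u v. tens K U (tensor K V W) u (tens K V W v w))"
proof -
  have "bilinear_map K (tensor K U V) W (tensor K U (tensor K V W)) (\<lambda>s w.
      sweedler K (tensor K U (tensor K V W)) s (\<lambda>u v. tens K U (tensor K V W) u (tens K V W v w)))"
    by (assumption | rule bilinear_intros assms)+
  with assms show "tensor_assoc K U V W \<in>
      module_hom K (tensor K (tensor K U V) W) (tensor K U (tensor K V W))"
    and "\<lbrakk>s \<in> carrier (tensor K U V); w \<in> carrier W\<rbrakk> \<Longrightarrow>
      tensor_assoc K U V W (tens K (tensor K U V) W s w) =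
        sweedler K (tensor K U (tensor K V W)) s (\<lambda>u v. tens K U (tensor K V W) u (tens K V W v w))"
    unfolding tensor_assoc_def[abs_def]
    by (simp_all add: sweedler_hom sweedler_tens vectorspace_tensor)
qed

lemma tensor_assoc_inv_hom:
  assumes U: "vectorspace K U" and V: "vectorspace K V" and W: "vectorspace K W"
  shows "tensor_assoc_inv K U V W \<in>
      module_hom K (tensor K U (tensor K V W)) (tensor K (tensor K U V) W)"
    and "\<lbrakk>u \<in> carrier U; s \<in> carrier (tensor K V W)\<rbrakk> \<Longrightarrow>
      tensor_assoc_inv K U V W (tens K U (tensor K V W) u s) =
        sweedler K (tensor K (tensor K U V) W) s (\<lambda>v w. tens K (tensor K U V) W (tens K U V u v) w)"
proof -
  have "bilinear_map K U (tensor K V W) (tensor K (tensor K U V) W) (\<lambda>u s.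
      sweedler K (tensor K (tensor K U V) W) s (\<lambda>v w. tens K (tensor K U V) W (tens K U V u v) w))"
    by (assumption | rule bilinear_intros assms)+
  with assms show "tensor_assoc_inv K U V W \<in>
      module_hom K (tensor K U (tensor K V W)) (tensor K (tensor K U V) W)"
    and "\<lbrakk>u \<in> carrier U; s \<in> carrier (tensor K V W)\<rbrakk> \<Longrightarrow>
      tensor_assoc_inv K U V W (tens K U (tensor K V W) u s) =
        sweedler K (tensor K (tensor K U V) W) s (\<lambda>v w. tens K (tensor K U V) W (tens K U V u v) w)"
    unfolding tensor_assoc_inv_def[abs_def]
    by (simp_all add: sweedler_hom sweedler_tens vectorspace_tensor)
qed

lemma tensor_assoc_tens:
  assumes "vectorspace K U" "vectorspace K V" "vectorspace K W"
    and "u \<in> carrier U" "v \<in> carrier V" "w \<in> carrier W"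
  shows "tensor_assoc K U V W (tens K (tensor K U V) W (tens K U V u v) w) =
      tens K U (tensor K V W) u (tens K V W v w)"
proof -
  have "bilinear_map K U V (tensor K U (tensor K V W))
      (\<lambda>u v. tens K U (tensor K V W) u (tens K V W v w))"
    by (assumption | rule bilinear_intros assms)+
  then show ?thesis
    using assms by (simp add: tensor_assoc_hom(2) tens_in sweedler_tens vectorspace_tensor)
qed

lemma tensor_assoc_inv_tens:
  assumes "vectorspace K U" "vectorspace K V" "vectorspace K W"
    and "u \<in> carrier U" "v \<in> carrier V" "w \<in> carrier W"
  shows "tensor_assoc_inv K U V W (tens K U (tensor K V W) u (tens K V W v w)) =
      tens K (tensor K U V) W (tens K U V u v) w"
proof -
  have "bilinear_map K V W (tensor K (tensor K U V) W)
      (\<lambda>v w. tens K (tensor K U V) W (tens K U V u v) w)"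
    by (assumption | rule bilinear_intros assms)+
  then show ?thesis
    using assms by (simp add: tensor_assoc_inv_hom(2) tens_in sweedler_tens vectorspace_tensor)
qed

lemma bilinear_map_flip:
  "bilinear_map K V W U B \<Longrightarrow> bilinear_map K W V U (\<lambda>w v. B v w)"
  by (simp add: bilinear_map_def)

lemma tensor_lunit_hom:
  assumes "field K" "vectorspace K V"
  shows "tensor_lunit K V \<in> module_hom K (tensor K (base_vs K) V) V"
    and "\<lbrakk>a \<in> carrier K; v \<in> carrier V\<rbrakk> \<Longrightarrow> tensor_lunit K V (tens K (base_vs K) V a v) = a \<odot>\<^bsub>V\<^esub> v"
  unfolding tensor_lunit_def[abs_def] using assms
  by (simp_all add: sweedler_hom sweedler_tens vectorspace_base_vs bilinear_map_smult)

lemma tensor_runit_hom: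
  assumes "field K" "vectorspace K V"
  shows "tensor_runit K V \<in> module_hom K (tensor K V (base_vs K)) V"
    and "\<lbrakk>a \<in> carrier K; v \<in> carrier V\<rbrakk> \<Longrightarrow> tensor_runit K V (tens K V (base_vs K) v a) = a \<odot>\<^bsub>V\<^esub> v"
  unfolding tensor_runit_def[abs_def] using assms
  by (simp_all add: sweedler_hom sweedler_tens vectorspace_base_vs bilinear_map_flip[OF bilinear_map_smult])

section \<open>Evaluating linear maps on nested sums\<close>

lemma sweedler_image:
  assumes "F \<in> module_hom K U X" "t \<in> carrier (tensor K V W)" "bilinear_map K V W U B"
    and "\<And>v w. \<lbrakk>v \<in> carrier V; w \<in> carrier W\<rbrakk> \<Longrightarrow> F (B v w) = B' v w"
    and "vectorspace K V" "vectorspace K W" "vectorspace K U" "vectorspace K X"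
  shows "F (sweedler K U t B) = sweedler K X t B'"
proof -
  have "bilinear_map K V W X (\<lambda>v w. F (B v w))"
    using assms(3) by (intro bilinear_mapI module_hom_compose[OF assms(1)]) (auto simp: bilinear_map_def)
  from sweedler_cong[OF assms(5,6,8,2) this assms(4)] show ?thesis
    using module_hom_sweedler[OF assms(5-8,1-3)] by simp
qed

text \<open>This opens a new layer: a linear map applied to t becomes a sum over t of its values on
  pure tensors. Its counterpart \<open>sweedler_image\<close> carries a linear map past a layer that
  is already open. Used once per layer, the two rules evaluate any nested expression.\<close>

lemma sweedler_apply:
  assumes "F \<in> module_hom K (tensor K V W) U" "t \<in> carrier (tensor K V W)"
    and "\<And>v w. \<lbrakk>v \<in> carrier V; w \<in> carrier W\<rbrakk> \<Longrightarrow> F (tens K V W v w) = B v w"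
    and "vectorspace K V" "vectorspace K W" "vectorspace K U"
  shows "F t = sweedler K U t B"
proof -
  have "bilinear_map K V W U (\<lambda>v w. F (tens K V W v w))"
    by (intro bilinear_mapI module_hom_compose[OF assms(1)]
        bilinear_mapD[OF bilinear_map_tens[OF assms(4,5)]])
  from sweedler_cong[OF assms(4,5,6,2) this assms(3)] show ?thesis
    using sweedler_expand[OF assms(4,5,6,1,2)] by simp
qed

lemma tensor_ball_iff:
  assumes "F \<in> module_hom K (tensor K V W) U" "G \<in> module_hom K (tensor K V W) U"
    and "\<And>v w. \<lbrakk>v \<in> carrier V; w \<in> carrier W\<rbrakk> \<Longrightarrow> F (tens K V W v w) = f v w"
    and "\<And>v w. \<lbrakk>v \<in> carrier V; w \<in> carrier W\<rbrakk> \<Longrightarrow> G (tens K V W v w) = g v w"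
    and "vectorspace K V" "vectorspace K W" "vectorspace K U"
  shows "(\<forall>t\<in>carrier (tensor K V W). F t = G t) \<longleftrightarrow> (\<forall>v\<in>carrier V. \<forall>w\<in>carrier W. f v w = g v w)"
  using assms tensor_hom_eqI[OF assms(5-7,1,2)] tens_in[OF assms(5,6)] by metis

text \<open>A morphism condition has \<mu> of the acted tensor on its left, whereas the module
  algebra law has the action on a product there. The flipped form yields the law exactly as it
  stands in the definition.\<close>

lemma tensor_ball_iff_sym:
  assumes "F \<in> module_hom K (tensor K V W) U" "G \<in> module_hom K (tensor K V W) U"
    and "\<And>v w. \<lbrakk>v \<in> carrier V; w \<in> carrier W\<rbrakk> \<Longrightarrow> F (tens K V W v w) = f v w"
    and "\<And>v w. \<lbrakk>v \<in> carrier V; w \<in> carrier W\<rbrakk> \<Longrightarrow> G (tens K V W v w) = g v w"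
    and "vectorspace K V" "vectorspace K W" "vectorspace K U"
  shows "(\<forall>t\<in>carrier (tensor K V W). F t = G t) \<longleftrightarrow> (\<forall>v\<in>carrier V. \<forall>w\<in>carrier W. g v w = f v w)"
proof -
  have "(\<forall>t\<in>carrier (tensor K V W). F t = G t) \<longleftrightarrow> (\<forall>v\<in>carrier V. \<forall>w\<in>carrier W. f v w = g v w)"
    using assms by (rule tensor_ball_iff)
  also have "\<dots> \<longleftrightarrow> (\<forall>v\<in>carrier V. \<forall>w\<in>carrier W. g v w = f v w)"
    by (intro ball_cong refl eq_commute)
  finally show ?thesis .
qed

lemma module_hom_id: "id \<in> module_hom K V V"
  by (simp add: module_hom_def)

text \<open>\<open>tensor\<close> reads nothing but carriers, additions and scalar multiplications.
  So the monoidal product and the unit object, which are larger records carrying actions and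
  coactions, may be replaced by their underlying vector spaces inside every tensor product.\<close>

lemma tensor_cong:
  assumes "carrier V = carrier V'" "add V = add V'" "smult V = smult V'"
    and "carrier W = carrier W'" "add W = add W'" "smult W = smult W'"
  shows "tensor K V W = tensor K V' W'" and "tens K V W = tens K V' W'"
proof -
  have "bilinear_rels K V W = bilinear_rels K V' W'"
    unfolding bilinear_rels_def assms ..
  then have "tensor_rels K V W = tensor_rels K V' W'"
    unfolding tensor_rels_def assms by simp
  then show "tensor K V W = tensor K V' W'" and "tens K V W = tens K V' W'"
    by (simp_all add: tensor_def tens_def[abs_def] assms)
qed

lemma lr_tensor_simps [simp]:
  "carrier (lr_tensor K H M N) = carrier (tensor K M N)"
  "add (lr_tensor K H M N) = add (tensor K M N)"
  "smult (lr_tensor K H M N) = smult (tensor K M N)"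
  by (simp_all add: lr_tensor_def)

lemma lr_unit_simps [simp]:
  "carrier (lr_unit K H) = carrier (base_vs K)"
  "add (lr_unit K H) = add (base_vs K)"
  "smult (lr_unit K H) = smult (base_vs K)"
  by (simp_all add: lr_unit_def base_vs_def)

lemma lr_unit_ops [simp]:
  "h \<rightharpoonup>\<^bsub>lr_unit K H\<^esub> a = counit H h \<otimes>\<^bsub>K\<^esub> a"
  "a \<leftharpoonup>\<^bsub>lr_unit K H\<^esub> h = a \<otimes>\<^bsub>K\<^esub> counit H h"
  "lcoact (lr_unit K H) a = tens K H (base_vs K) \<one>\<^bsub>H\<^esub> a"
  "rcoact (lr_unit K H) a = tens K (base_vs K) H a \<one>\<^bsub>H\<^esub>"
  by (simp_all add: lr_unit_def)

lemma tensor_lr_tensor [simp]: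
  "tensor K V (lr_tensor K H M N) = tensor K V (tensor K M N)"
  "tensor K (lr_tensor K H M N) V = tensor K (tensor K M N) V"
  "tens K V (lr_tensor K H M N) = tens K V (tensor K M N)"
  "tens K (lr_tensor K H M N) V = tens K (tensor K M N) V"
  by (intro tensor_cong; simp)+

lemma tensor_lr_unit [simp]:
  "tensor K V (lr_unit K H) = tensor K V (base_vs K)"
  "tensor K (lr_unit K H) V = tensor K (base_vs K) V"
  "tens K V (lr_unit K H) = tens K V (base_vs K)"
  "tens K (lr_unit K H) V = tens K (base_vs K) V"
  by (intro tensor_cong; simp)+

lemma tensor_map_lr [simp]:
  "tensor_map K V (lr_tensor K H M N) = tensor_map K V (tensor K M N)"
  "tensor_map K (lr_tensor K H M N) V = tensor_map K (tensor K M N) V"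
  "tensor_map K V (lr_unit K H) = tensor_map K V (base_vs K)"
  "tensor_map K (lr_unit K H) V = tensor_map K (base_vs K) V"
  by (simp_all add: tensor_map_def[abs_def])

lemma module_hom_lr [simp]:
  "module_hom K (lr_tensor K H M N) V = module_hom K (tensor K M N) V"
  "module_hom K V (lr_tensor K H M N) = module_hom K V (tensor K M N)"
  "module_hom K (lr_unit K H) V = module_hom K (base_vs K) V"
  "module_hom K V (lr_unit K H) = module_hom K V (base_vs K)"
  by (simp_all add: module_hom_def)


section \<open>Bialgebras in the category \<open>\<L>\<R>(H)\<close>\<close>

text \<open>The maps on D are only candidates: they are linear, and no action, coaction, algebra or
  coalgebra law is assumed. Every equivalence proved here can therefore be used in both directions
  of the theorem.\<close>

locale lr_data =
  fixes K :: "('k, 'r) ring_scheme"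
    and H :: "('k, 'h, 's) bialg_scheme"
    and D :: "('k, 'h, 'd, 'x) lr_space_scheme"
    and \<Delta> :: "'d \<Rightarrow> ('k, 'd, 'd) tens"
    and \<epsilon> :: "'d \<Rightarrow> 'k"
  assumes field: "field K"
    and bialgebra: "bialgebra K H"
    and vectorspace_D: "vectorspace K D"
    and lact_bilinear: "bilinear_map K H D D (lact D)"
    and ract_bilinear: "bilinear_map K D H D (ract D)"
    and lcoact_hom: "lcoact D \<in> module_hom K D (tensor K H D)"
    and rcoact_hom: "rcoact D \<in> module_hom K D (tensor K D H)"
    and mult_bilinear: "bilinear_map K D D D (mult D)"
    and one_in: "\<one>\<^bsub>D\<^esub> \<in> carrier D"
    and comult_hom: "\<Delta> \<in> module_hom K D (tensor K D D)"
    and counit_hom: "\<epsilon> \<in> module_hom K D (base_vs K)"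
begin

section \<open>Linearity and closure of the structure maps\<close>

lemma vectorspace_H: "vectorspace K H"
  using bialgebra by (simp add: bialgebra_def k_algebra_def)

lemma vectorspace_K: "vectorspace K (base_vs K)"
  by (rule vectorspace_base_vs[OF field])

lemma H_comult_hom: "comult H \<in> module_hom K H (tensor K H H)"
  using bialgebra by (simp add: bialgebra_def k_coalgebra_def)

lemma H_counit_hom: "counit H \<in> module_hom K H (base_vs K)"
  using bialgebra by (simp add: bialgebra_def k_coalgebra_def)

lemma H_mult_bilinear: "bilinear_map K H H H (mult H)"
proof -
  have H: "k_algebra K H" using bialgebra by (simp add: bialgebra_def)
  interpret H: ring H using H by (simp add: k_algebra_def)
  show ?thesis
    using H unfolding k_algebra_def
    by (intro bilinear_mapI module_homI) (simp_all add: H.l_distr H.r_distr)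
qed

lemma H_one_in: "\<one>\<^bsub>H\<^esub> \<in> carrier H"
proof -
  interpret H: ring H using bialgebra by (simp add: bialgebra_def k_algebra_def)
  show ?thesis by simp
qed

lemmas in_intros = bilinear_mapD(3)[OF lact_bilinear] bilinear_mapD(3)[OF ract_bilinear]
  bilinear_mapD(3)[OF mult_bilinear] bilinear_mapD(3)[OF H_mult_bilinear]
  module_hom_in[OF lcoact_hom] module_hom_in[OF rcoact_hom] module_hom_in[OF comult_hom]
  module_hom_in[OF H_comult_hom] H_one_in one_in

text \<open>The composed form lets a rule match a structure map applied to any expression in the
  bound variable; the innermost occurrence is closed by \<open>module_hom_ident\<close>.\<close>

lemmas hom_intros = module_hom_bilinear[OF lact_bilinear] module_hom_bilinear[OF ract_bilinear]
  module_hom_bilinear[OF mult_bilinear] module_hom_bilinear[OF H_mult_bilinear]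
  module_hom_compose[OF lcoact_hom] module_hom_compose[OF rcoact_hom]
  module_hom_compose[OF comult_hom] module_hom_compose[OF H_comult_hom]
  module_hom_compose[OF counit_hom] module_hom_compose[OF H_counit_hom]

lemmas lr_intros = bilinear_intros vectorspace_H vectorspace_D vectorspace_K in_intros hom_intros

abbreviation "T \<equiv> tensor K D D"
abbreviation "\<mu> \<equiv> mult_map K D"
abbreviation "\<eta> \<equiv> unit_map K D"

section \<open>Multiplication and unit as morphisms\<close>

lemma mult_map_hom: "\<mu> \<in> module_hom K T D"
  unfolding mult_map_def[abs_def] by (assumption | rule lr_intros mult_bilinear)+

lemma mult_map_tens: "\<lbrakk>c \<in> carrier D; d \<in> carrier D\<rbrakk> \<Longrightarrow> \<mu> (tens K D D c d) = c \<otimes>\<^bsub>D\<^esub> d"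
  unfolding mult_map_def by (rule sweedler_tens[OF vectorspace_D vectorspace_D vectorspace_D mult_bilinear])

lemmas mult_map_intros = lr_intros module_hom_compose[OF mult_map_hom] module_hom_in[OF mult_map_hom]


text \<open>For fixed h both sides are linear in t. At a pure tensor the inner sum in the action on
  D \<otimes> D collapses to one term, and \<mu> then passes through the remaining sum over the
  comultiplication of h.\<close>

lemma mult_map_lact_iff:
  assumes h: "h \<in> carrier H"
  shows "(\<forall>t\<in>carrier T. \<mu> (h \<rightharpoonup>\<^bsub>lr_tensor K H D D\<^esub> t) = h \<rightharpoonup>\<^bsub>D\<^esub> \<mu> t) \<longleftrightarrow>
    (\<forall>c\<in>carrier D. \<forall>d\<in>carrier D. h \<rightharpoonup>\<^bsub>D\<^esub> (c \<otimes>\<^bsub>D\<^esub> d) =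
      sweedler K D (comult H h) (\<lambda>h1 h2. (h1 \<rightharpoonup>\<^bsub>D\<^esub> c) \<otimes>\<^bsub>D\<^esub> (h2 \<rightharpoonup>\<^bsub>D\<^esub> d)))"
proof (rule tensor_ball_iff_sym)
  show "(\<lambda>t. \<mu> (h \<rightharpoonup>\<^bsub>lr_tensor K H D D\<^esub> t)) \<in> module_hom K T D"
    unfolding lr_tensor_def lr_space.simps
    by (assumption | rule mult_map_intros h)+
  show "(\<lambda>t. h \<rightharpoonup>\<^bsub>D\<^esub> \<mu> t) \<in> module_hom K T D"
    by (assumption | rule mult_map_intros h)+
  fix c d assume c: "c \<in> carrier D" and d: "d \<in> carrier D"
  show "h \<rightharpoonup>\<^bsub>D\<^esub> \<mu> (tens K D D c d) = h \<rightharpoonup>\<^bsub>D\<^esub> (c \<otimes>\<^bsub>D\<^esub> d)"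
    by (simp add: mult_map_tens c d)
  show "\<mu> (h \<rightharpoonup>\<^bsub>lr_tensor K H D D\<^esub> tens K D D c d) =
      sweedler K D (comult H h) (\<lambda>h1 h2. (h1 \<rightharpoonup>\<^bsub>D\<^esub> c) \<otimes>\<^bsub>D\<^esub> (h2 \<rightharpoonup>\<^bsub>D\<^esub> d))"
    unfolding lr_tensor_def lr_space.simps
  proof (rule sweedler_image[OF mult_map_hom])
    fix h1 h2 assume "h1 \<in> carrier H" "h2 \<in> carrier H"
    then show "\<mu> (sweedler K T (tens K D D c d) (\<lambda>m n. tens K D D (h1 \<rightharpoonup>\<^bsub>D\<^esub> m) (h2 \<rightharpoonup>\<^bsub>D\<^esub> n))) =
        (h1 \<rightharpoonup>\<^bsub>D\<^esub> c) \<otimes>\<^bsub>D\<^esub> (h2 \<rightharpoonup>\<^bsub>D\<^esub> d)"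
      using c d
      by (subst sweedler_tens[OF vectorspace_D vectorspace_D])
        (assumption | rule mult_map_intros mult_map_tens)+
  qed (assumption | rule mult_map_intros h c d)+
qed (rule vectorspace_D)+

lemma mult_map_ract_iff:
  assumes h: "h \<in> carrier H"
  shows "(\<forall>t\<in>carrier T. \<mu> (t \<leftharpoonup>\<^bsub>lr_tensor K H D D\<^esub> h) = \<mu> t \<leftharpoonup>\<^bsub>D\<^esub> h) \<longleftrightarrow>
    (\<forall>c\<in>carrier D. \<forall>d\<in>carrier D. (c \<otimes>\<^bsub>D\<^esub> d) \<leftharpoonup>\<^bsub>D\<^esub> h =
      sweedler K D (comult H h) (\<lambda>h1 h2. (c \<leftharpoonup>\<^bsub>D\<^esub> h1) \<otimes>\<^bsub>D\<^esub> (d \<leftharpoonup>\<^bsub>D\<^esub> h2)))"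
proof (rule tensor_ball_iff_sym)
  show "(\<lambda>t. \<mu> (t \<leftharpoonup>\<^bsub>lr_tensor K H D D\<^esub> h)) \<in> module_hom K T D"
    unfolding lr_tensor_def lr_space.simps
    by (assumption | rule mult_map_intros h)+
  show "(\<lambda>t. \<mu> t \<leftharpoonup>\<^bsub>D\<^esub> h) \<in> module_hom K T D"
    by (assumption | rule mult_map_intros h)+
  fix c d assume c: "c \<in> carrier D" and d: "d \<in> carrier D"
  show "\<mu> (tens K D D c d) \<leftharpoonup>\<^bsub>D\<^esub> h = (c \<otimes>\<^bsub>D\<^esub> d) \<leftharpoonup>\<^bsub>D\<^esub> h"
    by (simp add: mult_map_tens c d)
  show "\<mu> (tens K D D c d \<leftharpoonup>\<^bsub>lr_tensor K H D D\<^esub> h) =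
      sweedler K D (comult H h) (\<lambda>h1 h2. (c \<leftharpoonup>\<^bsub>D\<^esub> h1) \<otimes>\<^bsub>D\<^esub> (d \<leftharpoonup>\<^bsub>D\<^esub> h2))"
    unfolding lr_tensor_def lr_space.simps
  proof (rule sweedler_image[OF mult_map_hom])
    fix h1 h2 assume "h1 \<in> carrier H" "h2 \<in> carrier H"
    then show "\<mu> (sweedler K T (tens K D D c d) (\<lambda>m n. tens K D D (m \<leftharpoonup>\<^bsub>D\<^esub> h1) (n \<leftharpoonup>\<^bsub>D\<^esub> h2))) =
        (c \<leftharpoonup>\<^bsub>D\<^esub> h1) \<otimes>\<^bsub>D\<^esub> (d \<leftharpoonup>\<^bsub>D\<^esub> h2)"
      using c d
      by (subst sweedler_tens[OF vectorspace_D vectorspace_D])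
        (assumption | rule mult_map_intros mult_map_tens)+
  qed (assumption | rule mult_map_intros h c d)+
qed (rule vectorspace_D)+

lemma mult_map_lcoact_iff:
  "(\<forall>t\<in>carrier T. lcoact D (\<mu> t) = tensor_map K H D id \<mu> (lcoact (lr_tensor K H D D) t)) \<longleftrightarrow>
    (\<forall>c\<in>carrier D. \<forall>d\<in>carrier D. lcoact D (c \<otimes>\<^bsub>D\<^esub> d) =
      sweedler K (tensor K H D) (lcoact D c) (\<lambda>g x.
      sweedler K (tensor K H D) (lcoact D d) (\<lambda>h y. tens K H D (g \<otimes>\<^bsub>H\<^esub> h) (x \<otimes>\<^bsub>D\<^esub> y))))"
proof (rule tensor_ball_iff)
  have f: "tensor_map K H D id \<mu> \<in> module_hom K (tensor K H T) (tensor K H D)"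
    by (assumption | rule tensor_map_hom(1) module_hom_id mult_map_hom lr_intros)+
  \<comment> \<open>The \<open>id\<close> on the right is what instantiating
    \<open>tensor_map_hom\<close> produces; the simplifier removes it where this fact is
    used.\<close>
  have f_tens: "tensor_map K H D id \<mu> (tens K H T h t) = tens K H D (id h) (\<mu> t)"
    if "h \<in> carrier H" "t \<in> carrier T" for h t
    by (assumption | rule tensor_map_hom(2) module_hom_id mult_map_hom lr_intros that)+
  show "(\<lambda>t. lcoact D (\<mu> t)) \<in> module_hom K T (tensor K H D)"
    by (assumption | rule mult_map_intros)+
  show "(\<lambda>t. tensor_map K H D id \<mu> (lcoact (lr_tensor K H D D) t)) \<in> module_hom K T (tensor K H D)"
    unfolding lr_tensor_def lr_space.simps
    by (assumption | rule mult_map_intros module_hom_compose[OF f])+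
  fix c d assume c: "c \<in> carrier D" and d: "d \<in> carrier D"
  show "lcoact D (\<mu> (tens K D D c d)) = lcoact D (c \<otimes>\<^bsub>D\<^esub> d)"
    by (simp add: mult_map_tens c d)
  have 1: "lcoact (lr_tensor K H D D) (tens K D D c d) =
      sweedler K (tensor K H T) (lcoact D c) (\<lambda>g x.
      sweedler K (tensor K H T) (lcoact D d) (\<lambda>h y. tens K H T (g \<otimes>\<^bsub>H\<^esub> h) (tens K D D x y)))"
    unfolding lr_tensor_def lr_space.simps
    by (subst sweedler_tens[OF vectorspace_D vectorspace_D _ _ c d]) (assumption | rule refl lr_intros)+
  \<comment> \<open>Two sums remain, one for each coaction, and id \<otimes> \<mu> is carried
    through them one after the other.\<close>
  have 2: "tensor_map K H D id \<mu> (sweedler K (tensor K H T) (lcoact D c) (\<lambda>g x.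
      sweedler K (tensor K H T) (lcoact D d) (\<lambda>h y. tens K H T (g \<otimes>\<^bsub>H\<^esub> h) (tens K D D x y)))) =
      sweedler K (tensor K H D) (lcoact D c) (\<lambda>g x.
      sweedler K (tensor K H D) (lcoact D d) (\<lambda>h y. tens K H D (g \<otimes>\<^bsub>H\<^esub> h) (x \<otimes>\<^bsub>D\<^esub> y)))"
  proof (rule sweedler_image[OF f])
    fix g x assume g: "g \<in> carrier H" and x: "x \<in> carrier D"
    show "tensor_map K H D id \<mu> (sweedler K (tensor K H T) (lcoact D d)
          (\<lambda>h y. tens K H T (g \<otimes>\<^bsub>H\<^esub> h) (tens K D D x y))) =
        sweedler K (tensor K H D) (lcoact D d) (\<lambda>h y. tens K H D (g \<otimes>\<^bsub>H\<^esub> h) (x \<otimes>\<^bsub>D\<^esub> y))"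
    proof (rule sweedler_image[OF f])
      fix h y assume h: "h \<in> carrier H" and y: "y \<in> carrier D"
      show "tensor_map K H D id \<mu> (tens K H T (g \<otimes>\<^bsub>H\<^esub> h) (tens K D D x y)) =
          tens K H D (g \<otimes>\<^bsub>H\<^esub> h) (x \<otimes>\<^bsub>D\<^esub> y)"
        using g h x y by (simp add: f_tens mult_map_tens lr_intros)
    qed (assumption | rule lr_intros c d g x)+
  qed (assumption | rule lr_intros c d)+
  show "tensor_map K H D id \<mu> (lcoact (lr_tensor K H D D) (tens K D D c d)) =
      sweedler K (tensor K H D) (lcoact D c) (\<lambda>g x.
      sweedler K (tensor K H D) (lcoact D d) (\<lambda>h y. tens K H D (g \<otimes>\<^bsub>H\<^esub> h) (x \<otimes>\<^bsub>D\<^esub> y)))"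
    by (simp only: 1 2)
qed (rule lr_intros)+

lemma mult_map_rcoact_iff:
  "(\<forall>t\<in>carrier T. rcoact D (\<mu> t) = tensor_map K D H \<mu> id (rcoact (lr_tensor K H D D) t)) \<longleftrightarrow>
    (\<forall>c\<in>carrier D. \<forall>d\<in>carrier D. rcoact D (c \<otimes>\<^bsub>D\<^esub> d) =
      sweedler K (tensor K D H) (rcoact D c) (\<lambda>x g.
      sweedler K (tensor K D H) (rcoact D d) (\<lambda>y h. tens K D H (x \<otimes>\<^bsub>D\<^esub> y) (g \<otimes>\<^bsub>H\<^esub> h))))"
proof (rule tensor_ball_iff)
  have f: "tensor_map K D H \<mu> id \<in> module_hom K (tensor K T H) (tensor K D H)"
    by (assumption | rule tensor_map_hom(1) module_hom_id mult_map_hom lr_intros)+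
  have f_tens: "tensor_map K D H \<mu> id (tens K T H t h) = tens K D H (\<mu> t) (id h)"
    if "h \<in> carrier H" "t \<in> carrier T" for h t
    by (assumption | rule tensor_map_hom(2) module_hom_id mult_map_hom lr_intros that)+
  show "(\<lambda>t. rcoact D (\<mu> t)) \<in> module_hom K T (tensor K D H)"
    by (assumption | rule mult_map_intros)+
  show "(\<lambda>t. tensor_map K D H \<mu> id (rcoact (lr_tensor K H D D) t)) \<in> module_hom K T (tensor K D H)"
    unfolding lr_tensor_def lr_space.simps
    by (assumption | rule mult_map_intros module_hom_compose[OF f])+
  fix c d assume c: "c \<in> carrier D" and d: "d \<in> carrier D"
  show "rcoact D (\<mu> (tens K D D c d)) = rcoact D (c \<otimes>\<^bsub>D\<^esub> d)"
    by (simp add: mult_map_tens c d)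
  have 1: "rcoact (lr_tensor K H D D) (tens K D D c d) =
      sweedler K (tensor K T H) (rcoact D c) (\<lambda>x g.
      sweedler K (tensor K T H) (rcoact D d) (\<lambda>y h. tens K T H (tens K D D x y) (g \<otimes>\<^bsub>H\<^esub> h)))"
    unfolding lr_tensor_def lr_space.simps
    by (subst sweedler_tens[OF vectorspace_D vectorspace_D _ _ c d]) (assumption | rule refl lr_intros)+
  have 2: "tensor_map K D H \<mu> id (sweedler K (tensor K T H) (rcoact D c) (\<lambda>x g.
      sweedler K (tensor K T H) (rcoact D d) (\<lambda>y h. tens K T H (tens K D D x y) (g \<otimes>\<^bsub>H\<^esub> h)))) =
      sweedler K (tensor K D H) (rcoact D c) (\<lambda>x g.
      sweedler K (tensor K D H) (rcoact D d) (\<lambda>y h. tens K D H (x \<otimes>\<^bsub>D\<^esub> y) (g \<otimes>\<^bsub>H\<^esub> h)))"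
  proof (rule sweedler_image[OF f])
    fix x g assume x: "x \<in> carrier D" and g: "g \<in> carrier H"
    show "tensor_map K D H \<mu> id (sweedler K (tensor K T H) (rcoact D d)
          (\<lambda>y h. tens K T H (tens K D D x y) (g \<otimes>\<^bsub>H\<^esub> h))) =
        sweedler K (tensor K D H) (rcoact D d) (\<lambda>y h. tens K D H (x \<otimes>\<^bsub>D\<^esub> y) (g \<otimes>\<^bsub>H\<^esub> h))"
    proof (rule sweedler_image[OF f])
      fix y h assume y: "y \<in> carrier D" and h: "h \<in> carrier H"
      show "tensor_map K D H \<mu> id (tens K T H (tens K D D x y) (g \<otimes>\<^bsub>H\<^esub> h)) =
          tens K D H (x \<otimes>\<^bsub>D\<^esub> y) (g \<otimes>\<^bsub>H\<^esub> h)"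
        using g h x y by (simp add: f_tens mult_map_tens lr_intros)
    qed (assumption | rule lr_intros c d g x)+
  qed (assumption | rule lr_intros c d)+
  show "tensor_map K D H \<mu> id (rcoact (lr_tensor K H D D) (tens K D D c d)) =
      sweedler K (tensor K D H) (rcoact D c) (\<lambda>x g.
      sweedler K (tensor K D H) (rcoact D d) (\<lambda>y h. tens K D H (x \<otimes>\<^bsub>D\<^esub> y) (g \<otimes>\<^bsub>H\<^esub> h)))"
    by (simp only: 1 2)
qed (rule lr_intros)+

lemma unit_map_hom: "\<eta> \<in> module_hom K (base_vs K) D"
  unfolding unit_map_def[abs_def] by (rule bilinear_mapD(2)[OF bilinear_map_smult[OF vectorspace_D] one_in])

lemma unit_map_one [simp]: "\<eta> \<one>\<^bsub>K\<^esub> = \<one>\<^bsub>D\<^esub>"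
proof -
  interpret vectorspace K D by (rule vectorspace_D)
  show ?thesis using one_in by (simp add: unit_map_def)
qed

lemma base_vs_ball_iff:
  assumes "vectorspace K U" "F \<in> module_hom K (base_vs K) U" "G \<in> module_hom K (base_vs K) U"
  shows "(\<forall>a\<in>carrier K. F a = G a) \<longleftrightarrow> F \<one>\<^bsub>K\<^esub> = G \<one>\<^bsub>K\<^esub>"
proof -
  interpret vectorspace K U by fact
  have "F a = a \<odot>\<^bsub>U\<^esub> F \<one>\<^bsub>K\<^esub>" "G a = a \<odot>\<^bsub>U\<^esub> G \<one>\<^bsub>K\<^esub>" if "a \<in> carrier K" for a
    using that module_hom_smult[OF assms(2), of a "\<one>\<^bsub>K\<^esub>"]
      module_hom_smult[OF assms(3), of a "\<one>\<^bsub>K\<^esub>"] by (simp_all add: base_vs_def)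
  then show ?thesis by (metis R.one_closed)
qed

lemma unit_map_lr_hom_iff:
  "\<eta> \<in> lr_hom K H (lr_unit K H) D \<longleftrightarrow>
    (\<forall>h\<in>carrier H. h \<rightharpoonup>\<^bsub>D\<^esub> \<one>\<^bsub>D\<^esub> = counit H h \<odot>\<^bsub>D\<^esub> \<one>\<^bsub>D\<^esub> \<and> \<one>\<^bsub>D\<^esub> \<leftharpoonup>\<^bsub>D\<^esub> h = counit H h \<odot>\<^bsub>D\<^esub> \<one>\<^bsub>D\<^esub>) \<and>
    rcoact D \<one>\<^bsub>D\<^esub> = tens K D H \<one>\<^bsub>D\<^esub> \<one>\<^bsub>H\<^esub> \<and> lcoact D \<one>\<^bsub>D\<^esub> = tens K H D \<one>\<^bsub>H\<^esub> \<one>\<^bsub>D\<^esub>"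
proof -
  interpret field K by (rule field)
  note \<eta>_intros = lr_intros module_hom_compose[OF unit_map_hom] module_hom_in[OF unit_map_hom]
  have counit_in: "counit H h \<in> carrier K" if "h \<in> carrier H" for h
    using module_hom_in[OF H_counit_hom that] by simp
  \<comment> \<open>The scalar multiplication of k as a vector space over itself is its
    multiplication, so this is an instance of \<open>bilinear_map_smult\<close>.\<close>
  have mult: "bilinear_map K (base_vs K) (base_vs K) (base_vs K) (mult K)"
    using bilinear_map_smult[OF vectorspace_K] by (simp add: base_vs_def)
  have 1: "(\<forall>a\<in>carrier K. \<eta> (counit H h \<otimes>\<^bsub>K\<^esub> a) = h \<rightharpoonup>\<^bsub>D\<^esub> \<eta> a) \<longleftrightarrow>
      h \<rightharpoonup>\<^bsub>D\<^esub> \<one>\<^bsub>D\<^esub> = counit H h \<odot>\<^bsub>D\<^esub> \<one>\<^bsub>D\<^esub>" if h: "h \<in> carrier H" for h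
  proof -
    have "(\<lambda>a. \<eta> (counit H h \<otimes>\<^bsub>K\<^esub> a)) \<in> module_hom K (base_vs K) D"
      by (rule \<eta>_intros module_hom_bilinear[OF mult] | simp add: counit_in h)+
    moreover have "(\<lambda>a. h \<rightharpoonup>\<^bsub>D\<^esub> \<eta> a) \<in> module_hom K (base_vs K) D"
      by (rule \<eta>_intros h)+
    ultimately show ?thesis
      using h by (subst base_vs_ball_iff[OF vectorspace_D]) (auto simp: counit_in unit_map_def[of _ _ "counit H h"])
  qed
  have 2: "(\<forall>a\<in>carrier K. \<eta> (a \<otimes>\<^bsub>K\<^esub> counit H h) = \<eta> a \<leftharpoonup>\<^bsub>D\<^esub> h) \<longleftrightarrow>
      \<one>\<^bsub>D\<^esub> \<leftharpoonup>\<^bsub>D\<^esub> h = counit H h \<odot>\<^bsub>D\<^esub> \<one>\<^bsub>D\<^esub>" if h: "h \<in> carrier H" for h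
  proof -
    have "(\<lambda>a. \<eta> (a \<otimes>\<^bsub>K\<^esub> counit H h)) \<in> module_hom K (base_vs K) D"
      by (rule \<eta>_intros module_hom_bilinear[OF mult] | simp add: counit_in h)+
    moreover have "(\<lambda>a. \<eta> a \<leftharpoonup>\<^bsub>D\<^esub> h) \<in> module_hom K (base_vs K) D"
      by (rule \<eta>_intros h)+
    ultimately show ?thesis
      using h by (subst base_vs_ball_iff[OF vectorspace_D]) (auto simp: counit_in unit_map_def[of _ _ "counit H h"])
  qed
  \<comment> \<open>The unit object has the coaction sending a to 1 \<otimes> a, a pure tensor. So
    id \<otimes> \<eta> can be evaluated, and the condition compares two linear maps from k to H
    \<otimes> D, which is decided at 1.\<close>
  have "tensor_map K H D id \<eta> (tens K H (base_vs K) \<one>\<^bsub>H\<^esub> a) = tens K H D \<one>\<^bsub>H\<^esub> (\<eta> a)"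
    if "a \<in> carrier K" for a
    using that tensor_map_hom(2)[OF vectorspace_H vectorspace_K vectorspace_H vectorspace_D
        module_hom_id unit_map_hom H_one_in] by simp
  then have "(\<forall>a\<in>carrier K. lcoact D (\<eta> a) =
        tensor_map K H D id \<eta> (tens K H (base_vs K) \<one>\<^bsub>H\<^esub> a)) \<longleftrightarrow>
      (\<forall>a\<in>carrier K. lcoact D (\<eta> a) = tens K H D \<one>\<^bsub>H\<^esub> (\<eta> a))"
    by simp
  also have "\<dots> \<longleftrightarrow> lcoact D \<one>\<^bsub>D\<^esub> = tens K H D \<one>\<^bsub>H\<^esub> \<one>\<^bsub>D\<^esub>"
    by (subst base_vs_ball_iff) (rule \<eta>_intros | simp)+
  finally have 3: "(\<forall>a\<in>carrier K. lcoact D (\<eta> a) =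
        tensor_map K H D id \<eta> (tens K H (base_vs K) \<one>\<^bsub>H\<^esub> a)) \<longleftrightarrow>
      lcoact D \<one>\<^bsub>D\<^esub> = tens K H D \<one>\<^bsub>H\<^esub> \<one>\<^bsub>D\<^esub>" .
  have "tensor_map K D H \<eta> id (tens K (base_vs K) H a \<one>\<^bsub>H\<^esub>) = tens K D H (\<eta> a) \<one>\<^bsub>H\<^esub>"
    if "a \<in> carrier K" for a
    using that tensor_map_hom(2)[OF vectorspace_K vectorspace_H vectorspace_D vectorspace_H
        unit_map_hom module_hom_id _ H_one_in] by simp
  then have "(\<forall>a\<in>carrier K. rcoact D (\<eta> a) =
        tensor_map K D H \<eta> id (tens K (base_vs K) H a \<one>\<^bsub>H\<^esub>)) \<longleftrightarrow>
      (\<forall>a\<in>carrier K. rcoact D (\<eta> a) = tens K D H (\<eta> a) \<one>\<^bsub>H\<^esub>)"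
    by simp
  also have "\<dots> \<longleftrightarrow> rcoact D \<one>\<^bsub>D\<^esub> = tens K D H \<one>\<^bsub>D\<^esub> \<one>\<^bsub>H\<^esub>"
    by (subst base_vs_ball_iff) (rule \<eta>_intros | simp)+
  finally have 4: "(\<forall>a\<in>carrier K. rcoact D (\<eta> a) =
        tensor_map K D H \<eta> id (tens K (base_vs K) H a \<one>\<^bsub>H\<^esub>)) \<longleftrightarrow>
      rcoact D \<one>\<^bsub>D\<^esub> = tens K D H \<one>\<^bsub>D\<^esub> \<one>\<^bsub>H\<^esub>" .
  have 5: "(\<forall>h\<in>carrier H. \<forall>a\<in>carrier K. \<eta> (counit H h \<otimes>\<^bsub>K\<^esub> a) = h \<rightharpoonup>\<^bsub>D\<^esub> \<eta> a) \<longleftrightarrow>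
      (\<forall>h\<in>carrier H. h \<rightharpoonup>\<^bsub>D\<^esub> \<one>\<^bsub>D\<^esub> = counit H h \<odot>\<^bsub>D\<^esub> \<one>\<^bsub>D\<^esub>)"
    by (intro ball_cong refl 1)
  have 6: "(\<forall>h\<in>carrier H. \<forall>a\<in>carrier K. \<eta> (a \<otimes>\<^bsub>K\<^esub> counit H h) = \<eta> a \<leftharpoonup>\<^bsub>D\<^esub> h) \<longleftrightarrow>
      (\<forall>h\<in>carrier H. \<one>\<^bsub>D\<^esub> \<leftharpoonup>\<^bsub>D\<^esub> h = counit H h \<odot>\<^bsub>D\<^esub> \<one>\<^bsub>D\<^esub>)"
    by (intro ball_cong refl 2)
  have "\<eta> \<in> lr_hom K H (lr_unit K H) D \<longleftrightarrow>
      (\<forall>h\<in>carrier H. h \<rightharpoonup>\<^bsub>D\<^esub> \<one>\<^bsub>D\<^esub> = counit H h \<odot>\<^bsub>D\<^esub> \<one>\<^bsub>D\<^esub>) \<and>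
      (\<forall>h\<in>carrier H. \<one>\<^bsub>D\<^esub> \<leftharpoonup>\<^bsub>D\<^esub> h = counit H h \<odot>\<^bsub>D\<^esub> \<one>\<^bsub>D\<^esub>) \<and>
      lcoact D \<one>\<^bsub>D\<^esub> = tens K H D \<one>\<^bsub>H\<^esub> \<one>\<^bsub>D\<^esub> \<and> rcoact D \<one>\<^bsub>D\<^esub> = tens K D H \<one>\<^bsub>D\<^esub> \<one>\<^bsub>H\<^esub>"
    by (simp only: lr_hom_def mem_Collect_eq lr_unit_simps lr_unit_ops module_hom_lr tensor_map_lr
        carrier_base_vs unit_map_hom 3 4 5 6 simp_thms)
  then show ?thesis by blast
qed

lemma mult_map_lr_hom_iff:
  "\<mu> \<in> lr_hom K H (lr_tensor K H D D) D \<longleftrightarrow>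
    (\<forall>h\<in>carrier H. \<forall>c\<in>carrier D. \<forall>d\<in>carrier D.
      h \<rightharpoonup>\<^bsub>D\<^esub> (c \<otimes>\<^bsub>D\<^esub> d) =
        sweedler K D (comult H h) (\<lambda>h1 h2. (h1 \<rightharpoonup>\<^bsub>D\<^esub> c) \<otimes>\<^bsub>D\<^esub> (h2 \<rightharpoonup>\<^bsub>D\<^esub> d)) \<and>
      (c \<otimes>\<^bsub>D\<^esub> d) \<leftharpoonup>\<^bsub>D\<^esub> h =
        sweedler K D (comult H h) (\<lambda>h1 h2. (c \<leftharpoonup>\<^bsub>D\<^esub> h1) \<otimes>\<^bsub>D\<^esub> (d \<leftharpoonup>\<^bsub>D\<^esub> h2))) \<and>
    (\<forall>c\<in>carrier D. \<forall>d\<in>carrier D. rcoact D (c \<otimes>\<^bsub>D\<^esub> d) =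
      sweedler K (tensor K D H) (rcoact D c) (\<lambda>x g.
      sweedler K (tensor K D H) (rcoact D d) (\<lambda>y h. tens K D H (x \<otimes>\<^bsub>D\<^esub> y) (g \<otimes>\<^bsub>H\<^esub> h)))) \<and>
    (\<forall>c\<in>carrier D. \<forall>d\<in>carrier D. lcoact D (c \<otimes>\<^bsub>D\<^esub> d) =
      sweedler K (tensor K H D) (lcoact D c) (\<lambda>g x.
      sweedler K (tensor K H D) (lcoact D d) (\<lambda>h y. tens K H D (g \<otimes>\<^bsub>H\<^esub> h) (x \<otimes>\<^bsub>D\<^esub> y))))"
proof -
  have 1: "(\<forall>h\<in>carrier H. \<forall>t\<in>carrier T. \<mu> (h \<rightharpoonup>\<^bsub>lr_tensor K H D D\<^esub> t) = h \<rightharpoonup>\<^bsub>D\<^esub> \<mu> t) \<longleftrightarrow>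
      (\<forall>h\<in>carrier H. \<forall>c\<in>carrier D. \<forall>d\<in>carrier D. h \<rightharpoonup>\<^bsub>D\<^esub> (c \<otimes>\<^bsub>D\<^esub> d) =
        sweedler K D (comult H h) (\<lambda>h1 h2. (h1 \<rightharpoonup>\<^bsub>D\<^esub> c) \<otimes>\<^bsub>D\<^esub> (h2 \<rightharpoonup>\<^bsub>D\<^esub> d)))"
    by (rule ball_cong[OF refl mult_map_lact_iff])
  have 2: "(\<forall>h\<in>carrier H. \<forall>t\<in>carrier T. \<mu> (t \<leftharpoonup>\<^bsub>lr_tensor K H D D\<^esub> h) = \<mu> t \<leftharpoonup>\<^bsub>D\<^esub> h) \<longleftrightarrow>
      (\<forall>h\<in>carrier H. \<forall>c\<in>carrier D. \<forall>d\<in>carrier D. (c \<otimes>\<^bsub>D\<^esub> d) \<leftharpoonup>\<^bsub>D\<^esub> h =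
        sweedler K D (comult H h) (\<lambda>h1 h2. (c \<leftharpoonup>\<^bsub>D\<^esub> h1) \<otimes>\<^bsub>D\<^esub> (d \<leftharpoonup>\<^bsub>D\<^esub> h2)))"
    by (rule ball_cong[OF refl mult_map_ract_iff])
  show ?thesis
    unfolding lr_hom_def mem_Collect_eq lr_tensor_simps module_hom_lr tensor_map_lr
      mult_map_lcoact_iff mult_map_rcoact_iff 1 2
    using mult_map_hom by blast
qed

section \<open>The algebra axioms\<close>

lemma mult_map_assoc_iff:
  "(\<forall>t\<in>carrier (tensor K T D).
      \<mu> (tensor_map K D D \<mu> id t) = \<mu> (tensor_map K D D id \<mu> (tensor_assoc K D D D t))) \<longleftrightarrow>
    (\<forall>a\<in>carrier D. \<forall>b\<in>carrier D. \<forall>c\<in>carrier D. (a \<otimes>\<^bsub>D\<^esub> b) \<otimes>\<^bsub>D\<^esub> c = a \<otimes>\<^bsub>D\<^esub> (b \<otimes>\<^bsub>D\<^esub> c))"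
proof -
  note VD = vectorspace_D
  have VT: "vectorspace K T" by (rule lr_intros)+
  note l = tensor_map_hom[OF VT VD VD VD mult_map_hom module_hom_id]
  note r = tensor_map_hom[OF VD VT VD VD module_hom_id mult_map_hom]
  note as = tensor_assoc_hom[OF VD VD VD]
  have F: "(\<lambda>t. \<mu> (tensor_map K D D \<mu> id t)) \<in> module_hom K (tensor K T D) D"
    by (rule module_hom_compose[OF mult_map_hom l(1)])
  have G: "(\<lambda>t. \<mu> (tensor_map K D D id \<mu> (tensor_assoc K D D D t))) \<in> module_hom K (tensor K T D) D"
    by (rule module_hom_compose[OF mult_map_hom module_hom_compose[OF r(1) as(1)]])
  \<comment> \<open>The reduction to pure tensors is needed twice: once for (D \<otimes> D)
    \<otimes> D, leaving s \<otimes> c with s arbitrary, and once for s with c held fixed. This is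
    the second reduction.\<close>
  have pure: "(\<forall>s\<in>carrier T. \<mu> (tensor_map K D D \<mu> id (tens K T D s c)) =
        \<mu> (tensor_map K D D id \<mu> (tensor_assoc K D D D (tens K T D s c)))) \<longleftrightarrow>
      (\<forall>a\<in>carrier D. \<forall>b\<in>carrier D. (a \<otimes>\<^bsub>D\<^esub> b) \<otimes>\<^bsub>D\<^esub> c = a \<otimes>\<^bsub>D\<^esub> (b \<otimes>\<^bsub>D\<^esub> c))"
    if c: "c \<in> carrier D" for c
  proof (rule tensor_ball_iff)
    show "(\<lambda>s. \<mu> (tensor_map K D D \<mu> id (tens K T D s c))) \<in> module_hom K T D"
      by (assumption | rule lr_intros c module_hom_compose[OF F])+
    show "(\<lambda>s. \<mu> (tensor_map K D D id \<mu> (tensor_assoc K D D D (tens K T D s c)))) \<in> module_hom K T D"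
      by (assumption | rule lr_intros c module_hom_compose[OF G])+
    fix a b assume a: "a \<in> carrier D" and b: "b \<in> carrier D"
    show "\<mu> (tensor_map K D D \<mu> id (tens K T D (tens K D D a b) c)) = (a \<otimes>\<^bsub>D\<^esub> b) \<otimes>\<^bsub>D\<^esub> c"
      using a b c VD by (simp add: l(2) mult_map_tens lr_intros)
    show "\<mu> (tensor_map K D D id \<mu> (tensor_assoc K D D D (tens K T D (tens K D D a b) c))) =
        a \<otimes>\<^bsub>D\<^esub> (b \<otimes>\<^bsub>D\<^esub> c)"
      using a b c VD by (simp add: r(2) tensor_assoc_tens mult_map_tens lr_intros)
  qed (rule VD)+
  have "(\<forall>t\<in>carrier (tensor K T D).
      \<mu> (tensor_map K D D \<mu> id t) = \<mu> (tensor_map K D D id \<mu> (tensor_assoc K D D D t))) \<longleftrightarrow>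
    (\<forall>s\<in>carrier T. \<forall>c\<in>carrier D. \<mu> (tensor_map K D D \<mu> id (tens K T D s c)) =
      \<mu> (tensor_map K D D id \<mu> (tensor_assoc K D D D (tens K T D s c))))"
    by (rule tensor_ball_iff[OF F G refl refl VT VD VD])
  then show ?thesis
    using pure by blast
qed

text \<open>At a \<otimes> d the left unit law reads a (1 d) = a d, by linearity of the
  multiplication. The case a = 1 gives the law for d, and scaling gives it back for every a. The
  right law is symmetric.\<close>

lemma mult_map_unit_iff:
  "(\<forall>t\<in>carrier (tensor K (base_vs K) D). \<mu> (tensor_map K D D \<eta> id t) = tensor_lunit K D t) \<longleftrightarrow>
    (\<forall>d\<in>carrier D. \<one>\<^bsub>D\<^esub> \<otimes>\<^bsub>D\<^esub> d = d)"
  "(\<forall>t\<in>carrier (tensor K D (base_vs K)). \<mu> (tensor_map K D D id \<eta> t) = tensor_runit K D t) \<longleftrightarrow>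
    (\<forall>d\<in>carrier D. d \<otimes>\<^bsub>D\<^esub> \<one>\<^bsub>D\<^esub> = d)"
proof -
  interpret vectorspace K D by (rule vectorspace_D)
  note VD = vectorspace_D and VK = vectorspace_K
  note l = tensor_map_hom[OF VK VD VD VD unit_map_hom module_hom_id]
  note r = tensor_map_hom[OF VD VK VD VD module_hom_id unit_map_hom]
  note lu = tensor_lunit_hom[OF field VD] and ru = tensor_runit_hom[OF field VD]
  have smult: "\<eta> a \<otimes>\<^bsub>D\<^esub> d = a \<odot>\<^bsub>D\<^esub> (\<one>\<^bsub>D\<^esub> \<otimes>\<^bsub>D\<^esub> d)" "d \<otimes>\<^bsub>D\<^esub> \<eta> a = a \<odot>\<^bsub>D\<^esub> (d \<otimes>\<^bsub>D\<^esub> \<one>\<^bsub>D\<^esub>)"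
    if "a \<in> carrier K" "d \<in> carrier D" for a d
    using that module_hom_smult[OF bilinear_mapD(2)[OF mult_bilinear]]
      module_hom_smult[OF bilinear_mapD(1)[OF mult_bilinear]] one_in
    by (simp_all add: unit_map_def)
  have "(\<forall>t\<in>carrier (tensor K (base_vs K) D). \<mu> (tensor_map K D D \<eta> id t) = tensor_lunit K D t) \<longleftrightarrow>
    (\<forall>a\<in>carrier (base_vs K). \<forall>d\<in>carrier D. \<eta> a \<otimes>\<^bsub>D\<^esub> d = a \<odot>\<^bsub>D\<^esub> d)"
    using module_hom_in[OF unit_map_hom]
    by (intro tensor_ball_iff[OF module_hom_compose[OF mult_map_hom l(1)] lu(1) _ _ VK VD VD])
      (simp_all add: l(2) lu(2) mult_map_tens)
  also have "\<dots> \<longleftrightarrow> (\<forall>d\<in>carrier D. \<one>\<^bsub>D\<^esub> \<otimes>\<^bsub>D\<^esub> d = d)"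
    using smult(1) smult_one R.one_closed unit_map_one unfolding carrier_base_vs by (metis (no_types, lifting))
  finally show "(\<forall>t\<in>carrier (tensor K (base_vs K) D). \<mu> (tensor_map K D D \<eta> id t) = tensor_lunit K D t) \<longleftrightarrow>
    (\<forall>d\<in>carrier D. \<one>\<^bsub>D\<^esub> \<otimes>\<^bsub>D\<^esub> d = d)" .
  have "(\<forall>t\<in>carrier (tensor K D (base_vs K)). \<mu> (tensor_map K D D id \<eta> t) = tensor_runit K D t) \<longleftrightarrow>
    (\<forall>d\<in>carrier D. \<forall>a\<in>carrier (base_vs K). d \<otimes>\<^bsub>D\<^esub> \<eta> a = a \<odot>\<^bsub>D\<^esub> d)"
    using module_hom_in[OF unit_map_hom]
    by (intro tensor_ball_iff[OF module_hom_compose[OF mult_map_hom r(1)] ru(1) _ _ VD VK VD])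
      (simp_all add: r(2) ru(2) mult_map_tens)
  also have "\<dots> \<longleftrightarrow> (\<forall>d\<in>carrier D. d \<otimes>\<^bsub>D\<^esub> \<one>\<^bsub>D\<^esub> = d)"
    using smult(2) smult_one R.one_closed unit_map_one unfolding carrier_base_vs by (metis (no_types, lifting))
  finally show "(\<forall>t\<in>carrier (tensor K D (base_vs K)). \<mu> (tensor_map K D D id \<eta> t) = tensor_runit K D t) \<longleftrightarrow>
    (\<forall>d\<in>carrier D. d \<otimes>\<^bsub>D\<^esub> \<one>\<^bsub>D\<^esub> = d)" .
qed

text \<open>Distributivity and compatibility with scalars are already contained in the bilinearity
  of the multiplication, so only the monoid laws remain.\<close>

lemma k_algebra_iff:
  "k_algebra K D \<longleftrightarrow>
    (\<forall>a\<in>carrier D. \<forall>b\<in>carrier D. \<forall>c\<in>carrier D. (a \<otimes>\<^bsub>D\<^esub> b) \<otimes>\<^bsub>D\<^esub> c = a \<otimes>\<^bsub>D\<^esub> (b \<otimes>\<^bsub>D\<^esub> c)) \<and>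
    (\<forall>d\<in>carrier D. \<one>\<^bsub>D\<^esub> \<otimes>\<^bsub>D\<^esub> d = d) \<and> (\<forall>d\<in>carrier D. d \<otimes>\<^bsub>D\<^esub> \<one>\<^bsub>D\<^esub> = d)"
    (is "_ \<longleftrightarrow> ?assoc \<and> ?l \<and> ?r")
proof
  assume "k_algebra K D"
  then interpret ring D by (simp add: k_algebra_def)
  show "?assoc \<and> ?l \<and> ?r" by (simp add: m_assoc)
next
  assume A: "?assoc \<and> ?l \<and> ?r"
  interpret vectorspace K D by (rule vectorspace_D)
  note L = bilinear_mapD(2)[OF mult_bilinear] and R = bilinear_mapD(1)[OF mult_bilinear]
  have "ring D"
    using A module_hom_add[OF L] module_hom_add[OF R] in_intros(3) one_in
    by (intro ringI M.abelian_group_axioms monoidI) auto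
  then show "k_algebra K D"
    using vectorspace_D module_hom_smult[OF L] module_hom_smult[OF R] by (simp add: k_algebra_def)
qed

section \<open>Comultiplication and counit as morphisms\<close>

lemma comult_lr_hom_iff:
  "\<Delta> \<in> lr_hom K H D (lr_tensor K H D D) \<longleftrightarrow>
    (\<forall>h\<in>carrier H. \<forall>d\<in>carrier D. \<Delta> (h \<rightharpoonup>\<^bsub>D\<^esub> d) =
      sweedler K T (comult H h) (\<lambda>h1 h2. sweedler K T (\<Delta> d) (\<lambda>d1 d2.
        tens K D D (h1 \<rightharpoonup>\<^bsub>D\<^esub> d1) (h2 \<rightharpoonup>\<^bsub>D\<^esub> d2)))) \<and>
    (\<forall>h\<in>carrier H. \<forall>d\<in>carrier D. \<Delta> (d \<leftharpoonup>\<^bsub>D\<^esub> h) =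
      sweedler K T (comult H h) (\<lambda>h1 h2. sweedler K T (\<Delta> d) (\<lambda>d1 d2.
        tens K D D (d1 \<leftharpoonup>\<^bsub>D\<^esub> h1) (d2 \<leftharpoonup>\<^bsub>D\<^esub> h2)))) \<and>
    (\<forall>d\<in>carrier D.
      sweedler K (tensor K H T) (\<Delta> d) (\<lambda>d1 d2.
      sweedler K (tensor K H T) (lcoact D d1) (\<lambda>g x.
      sweedler K (tensor K H T) (lcoact D d2) (\<lambda>h y.
        tens K H T (g \<otimes>\<^bsub>H\<^esub> h) (tens K D D x y))))
      = sweedler K (tensor K H T) (lcoact D d) (\<lambda>h x. tens K H T h (\<Delta> x))) \<and>
    (\<forall>d\<in>carrier D.
      sweedler K (tensor K T H) (\<Delta> d) (\<lambda>d1 d2.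
      sweedler K (tensor K T H) (rcoact D d1) (\<lambda>x g.
      sweedler K (tensor K T H) (rcoact D d2) (\<lambda>y h.
        tens K T H (tens K D D x y) (g \<otimes>\<^bsub>H\<^esub> h))))
      = sweedler K (tensor K T H) (rcoact D d) (\<lambda>x h. tens K T H (\<Delta> x) h))"
  \<comment> \<open>The conditions already range over elements d of D, so no reduction to pure
    tensors takes place. With the structure of D \<otimes> D and \<open>tensor_map\<close> unfolded,
    they are literally the bicomodule coalgebra conditions.\<close>
  unfolding lr_hom_def mem_Collect_eq module_hom_lr tensor_map_lr
  unfolding lr_tensor_def lr_space.simps tensor_map_def id_apply
  using comult_hom by blast

text \<open>The unit constraint is injective because v \<mapsto> v \<otimes> 1 is a left inverse:
  moving the scalar across the tensor sign gives a v \<otimes> 1 = v \<otimes> a, and pure tensors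
  suffice.\<close>

lemma runit_eq_iff:
  assumes V: "vectorspace K V"
    and s: "s \<in> carrier (tensor K V (base_vs K))" and t: "t \<in> carrier (tensor K V (base_vs K))"
  shows "s = t \<longleftrightarrow> tensor_runit K V s = tensor_runit K V t"
proof -
  interpret V: vectorspace K V by fact
  note ru = tensor_runit_hom[OF field V]
  have one: "\<one>\<^bsub>K\<^esub> \<in> carrier (base_vs K)" by simp
  have smult: "tens K V (base_vs K) (a \<odot>\<^bsub>V\<^esub> v) \<one>\<^bsub>K\<^esub> = tens K V (base_vs K) v a"
    if "v \<in> carrier V" "a \<in> carrier K" for v a
  proof -
    note b = bilinear_map_tens[OF V vectorspace_K]
    have "tens K V (base_vs K) (a \<odot>\<^bsub>V\<^esub> v) \<one>\<^bsub>K\<^esub> =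
        a \<odot>\<^bsub>tensor K V (base_vs K)\<^esub> tens K V (base_vs K) v \<one>\<^bsub>K\<^esub>"
      using module_hom_smult[OF bilinear_mapD(2)[OF b one]] that by simp
    also have "\<dots> = tens K V (base_vs K) v (a \<odot>\<^bsub>base_vs K\<^esub> \<one>\<^bsub>K\<^esub>)"
      using module_hom_smult[OF bilinear_mapD(1)[OF b that(1)]] that one by metis
    also have "a \<odot>\<^bsub>base_vs K\<^esub> \<one>\<^bsub>K\<^esub> = a"
      using that by (simp add: base_vs_def)
    finally show ?thesis .
  qed
  have inv: "tens K V (base_vs K) (tensor_runit K V t) \<one>\<^bsub>K\<^esub> = t"
    if t: "t \<in> carrier (tensor K V (base_vs K))" for t
  proof (rule tensor_hom_eqI[OF V vectorspace_K _ _ _ _ t])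
    show "(\<lambda>t. tens K V (base_vs K) (tensor_runit K V t) \<one>\<^bsub>K\<^esub>)
        \<in> module_hom K (tensor K V (base_vs K)) (tensor K V (base_vs K))"
      by (rule bilinear_intros one ru(1) V vectorspace_K)+
  qed (use ru(2) smult in \<open>auto intro!: module_hom_ident vectorspace_tensor V vectorspace_K\<close>)
  show ?thesis
    using inv[OF s] inv[OF t] by metis
qed

lemma lunit_eq_iff:
  assumes V: "vectorspace K V"
    and s: "s \<in> carrier (tensor K (base_vs K) V)" and t: "t \<in> carrier (tensor K (base_vs K) V)"
  shows "s = t \<longleftrightarrow> tensor_lunit K V s = tensor_lunit K V t"
proof -
  interpret V: vectorspace K V by fact
  note lu = tensor_lunit_hom[OF field V]
  have one: "\<one>\<^bsub>K\<^esub> \<in> carrier (base_vs K)" by simp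
  have smult: "tens K (base_vs K) V \<one>\<^bsub>K\<^esub> (a \<odot>\<^bsub>V\<^esub> v) = tens K (base_vs K) V a v"
    if "v \<in> carrier V" "a \<in> carrier K" for v a
  proof -
    note b = bilinear_map_tens[OF vectorspace_K V]
    have "tens K (base_vs K) V \<one>\<^bsub>K\<^esub> (a \<odot>\<^bsub>V\<^esub> v) =
        a \<odot>\<^bsub>tensor K (base_vs K) V\<^esub> tens K (base_vs K) V \<one>\<^bsub>K\<^esub> v"
      using module_hom_smult[OF bilinear_mapD(1)[OF b one]] that by simp
    also have "\<dots> = tens K (base_vs K) V (a \<odot>\<^bsub>base_vs K\<^esub> \<one>\<^bsub>K\<^esub>) v"
      using module_hom_smult[OF bilinear_mapD(2)[OF b that(1)]] that one by metis
    also have "a \<odot>\<^bsub>base_vs K\<^esub> \<one>\<^bsub>K\<^esub> = a"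
      using that by (simp add: base_vs_def)
    finally show ?thesis .
  qed
  have inv: "tens K (base_vs K) V \<one>\<^bsub>K\<^esub> (tensor_lunit K V t) = t"
    if t: "t \<in> carrier (tensor K (base_vs K) V)" for t
  proof (rule tensor_hom_eqI[OF vectorspace_K V _ _ _ _ t])
    show "(\<lambda>t. tens K (base_vs K) V \<one>\<^bsub>K\<^esub> (tensor_lunit K V t))
        \<in> module_hom K (tensor K (base_vs K) V) (tensor K (base_vs K) V)"
      by (rule bilinear_intros one lu(1) V vectorspace_K)+
  qed (use lu(2) smult in \<open>auto intro!: module_hom_ident vectorspace_tensor V vectorspace_K\<close>)
  show ?thesis
    using inv[OF s] inv[OF t] by metis
qed

text \<open>Colinearity of \<epsilon> is an equation in H \<otimes> k, admissibility asks for one in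
  H. The injective unit constraint sends the two sides of the first to those of the second.\<close>

lemma counit_lcoact_iff:
  assumes d: "d \<in> carrier D"
  shows "tens K H (base_vs K) \<one>\<^bsub>H\<^esub> (\<epsilon> d) = tensor_map K H (base_vs K) id \<epsilon> (lcoact D d) \<longleftrightarrow>
    sweedler K H (lcoact D d) (\<lambda>h x. \<epsilon> x \<odot>\<^bsub>H\<^esub> h) = \<epsilon> d \<odot>\<^bsub>H\<^esub> \<one>\<^bsub>H\<^esub>"
proof -
  note VH = vectorspace_H and VD = vectorspace_D and VK = vectorspace_K
  have \<epsilon>: "\<epsilon> x \<in> carrier K" if "x \<in> carrier D" for x
    using module_hom_in[OF counit_hom that] by simp
  note ru = tensor_runit_hom[OF field VH]
  note m = tensor_map_hom[OF VH VD VH VK module_hom_id counit_hom]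
  have 1: "tensor_runit K H (tens K H (base_vs K) \<one>\<^bsub>H\<^esub> (\<epsilon> d)) = \<epsilon> d \<odot>\<^bsub>H\<^esub> \<one>\<^bsub>H\<^esub>"
    by (rule ru(2)[OF \<epsilon>[OF d] H_one_in])
  have 2: "tensor_runit K H (tensor_map K H (base_vs K) id \<epsilon> (lcoact D d)) =
      sweedler K H (lcoact D d) (\<lambda>h x. \<epsilon> x \<odot>\<^bsub>H\<^esub> h)"
    by (rule sweedler_apply[OF module_hom_compose[OF ru(1) m(1)] _ _ VH VD VH])
      (simp_all add: m(2) ru(2) \<epsilon> d in_intros)
  show ?thesis
    using runit_eq_iff[OF VH tens_in[OF VH VK H_one_in] module_hom_in[OF m(1)]] d \<epsilon> 1 2
    by (metis carrier_base_vs in_intros(5))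
qed

lemma counit_rcoact_iff:
  assumes d: "d \<in> carrier D"
  shows "tens K (base_vs K) H (\<epsilon> d) \<one>\<^bsub>H\<^esub> = tensor_map K (base_vs K) H \<epsilon> id (rcoact D d) \<longleftrightarrow>
    sweedler K H (rcoact D d) (\<lambda>x h. \<epsilon> x \<odot>\<^bsub>H\<^esub> h) = \<epsilon> d \<odot>\<^bsub>H\<^esub> \<one>\<^bsub>H\<^esub>"
proof -
  note VH = vectorspace_H and VD = vectorspace_D and VK = vectorspace_K
  have \<epsilon>: "\<epsilon> x \<in> carrier K" if "x \<in> carrier D" for x
    using module_hom_in[OF counit_hom that] by simp
  note lu = tensor_lunit_hom[OF field VH]
  note m = tensor_map_hom[OF VD VH VK VH counit_hom module_hom_id]
  have 1: "tensor_lunit K H (tens K (base_vs K) H (\<epsilon> d) \<one>\<^bsub>H\<^esub>) = \<epsilon> d \<odot>\<^bsub>H\<^esub> \<one>\<^bsub>H\<^esub>"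
    by (rule lu(2)[OF \<epsilon>[OF d] H_one_in])
  have 2: "tensor_lunit K H (tensor_map K (base_vs K) H \<epsilon> id (rcoact D d)) =
      sweedler K H (rcoact D d) (\<lambda>x h. \<epsilon> x \<odot>\<^bsub>H\<^esub> h)"
    by (rule sweedler_apply[OF module_hom_compose[OF lu(1) m(1)] _ _ VD VH VH])
      (simp_all add: m(2) lu(2) \<epsilon> d in_intros)
  show ?thesis
    using lunit_eq_iff[OF VH tens_in[OF VK VH _ H_one_in] module_hom_in[OF m(1)]] d \<epsilon> 1 2
    by (metis carrier_base_vs in_intros(6))
qed

lemma counit_lr_hom_iff:
  "\<epsilon> \<in> lr_hom K H D (lr_unit K H) \<longleftrightarrow>
    (\<forall>h\<in>carrier H. \<forall>d\<in>carrier D.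
      \<epsilon> (h \<rightharpoonup>\<^bsub>D\<^esub> d) = \<epsilon> d \<otimes>\<^bsub>K\<^esub> counit H h \<and> \<epsilon> (d \<leftharpoonup>\<^bsub>D\<^esub> h) = \<epsilon> d \<otimes>\<^bsub>K\<^esub> counit H h) \<and>
    (\<forall>d\<in>carrier D. sweedler K H (lcoact D d) (\<lambda>h x. \<epsilon> x \<odot>\<^bsub>H\<^esub> h) = \<epsilon> d \<odot>\<^bsub>H\<^esub> \<one>\<^bsub>H\<^esub>) \<and>
    (\<forall>d\<in>carrier D. sweedler K H (rcoact D d) (\<lambda>x h. \<epsilon> x \<odot>\<^bsub>H\<^esub> h) = \<epsilon> d \<odot>\<^bsub>H\<^esub> \<one>\<^bsub>H\<^esub>)"
proof -
  interpret field K by (rule field)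
  \<comment> \<open>The left action on the unit object multiplies by the counit of h from the left,
    while admissibility writes that factor on the right.\<close>
  have comm: "counit H h \<otimes>\<^bsub>K\<^esub> \<epsilon> d = \<epsilon> d \<otimes>\<^bsub>K\<^esub> counit H h" if "h \<in> carrier H" "d \<in> carrier D" for h d
    using that module_hom_in[OF counit_hom] module_hom_in[OF H_counit_hom] by (simp add: m_comm)
  have 1: "(\<forall>h\<in>carrier H. \<forall>d\<in>carrier D. \<epsilon> (h \<rightharpoonup>\<^bsub>D\<^esub> d) = counit H h \<otimes>\<^bsub>K\<^esub> \<epsilon> d) \<longleftrightarrow>
      (\<forall>h\<in>carrier H. \<forall>d\<in>carrier D. \<epsilon> (h \<rightharpoonup>\<^bsub>D\<^esub> d) = \<epsilon> d \<otimes>\<^bsub>K\<^esub> counit H h)"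
    using comm by auto
  have 2: "(\<forall>d\<in>carrier D.
        tens K H (base_vs K) \<one>\<^bsub>H\<^esub> (\<epsilon> d) = tensor_map K H (base_vs K) id \<epsilon> (lcoact D d)) \<longleftrightarrow>
      (\<forall>d\<in>carrier D. sweedler K H (lcoact D d) (\<lambda>h x. \<epsilon> x \<odot>\<^bsub>H\<^esub> h) = \<epsilon> d \<odot>\<^bsub>H\<^esub> \<one>\<^bsub>H\<^esub>)"
    by (rule ball_cong[OF refl counit_lcoact_iff])
  have 3: "(\<forall>d\<in>carrier D.
        tens K (base_vs K) H (\<epsilon> d) \<one>\<^bsub>H\<^esub> = tensor_map K (base_vs K) H \<epsilon> id (rcoact D d)) \<longleftrightarrow>
      (\<forall>d\<in>carrier D. sweedler K H (rcoact D d) (\<lambda>x h. \<epsilon> x \<odot>\<^bsub>H\<^esub> h) = \<epsilon> d \<odot>\<^bsub>H\<^esub> \<one>\<^bsub>H\<^esub>)"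
    by (rule ball_cong[OF refl counit_rcoact_iff])
  show ?thesis
    unfolding lr_hom_def mem_Collect_eq module_hom_lr tensor_map_lr lr_unit_ops 1 2 3
    using counit_hom by blast
qed

section \<open>The coalgebra axioms\<close>

lemma k_coalgebra_iff:
  "k_coalgebra K D \<Delta> \<epsilon> \<longleftrightarrow>
    (\<forall>d\<in>carrier D. tensor_assoc K D D D (tensor_map K T D \<Delta> id (\<Delta> d)) = tensor_map K D T id \<Delta> (\<Delta> d)) \<and>
    (\<forall>d\<in>carrier D. tensor_lunit K D (tensor_map K (base_vs K) D \<epsilon> id (\<Delta> d)) = d) \<and>
    (\<forall>d\<in>carrier D. tensor_runit K D (tensor_map K D (base_vs K) id \<epsilon> (\<Delta> d)) = d)"
proof -
  note VD = vectorspace_D and VK = vectorspace_K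
  have VT: "vectorspace K T" by (rule lr_intros)+
  note lu = tensor_lunit_hom[OF field VD] and ru = tensor_runit_hom[OF field VD]
  note l = tensor_map_hom[OF VD VD VK VD counit_hom module_hom_id]
  note r = tensor_map_hom[OF VD VD VD VK module_hom_id counit_hom]
  note a = tensor_map_hom[OF VD VD VT VD comult_hom module_hom_id]
  note as = tensor_assoc_hom[OF VD VD VD]
  have \<epsilon>: "\<epsilon> x \<in> carrier K" if "x \<in> carrier D" for x
    using module_hom_in[OF counit_hom that] by simp
  have 1: "tensor_lunit K D (tensor_map K (base_vs K) D \<epsilon> id (\<Delta> d)) =
      sweedler K D (\<Delta> d) (\<lambda>c1 c2. \<epsilon> c1 \<odot>\<^bsub>D\<^esub> c2)" if d: "d \<in> carrier D" for d
    by (rule sweedler_apply[OF module_hom_compose[OF lu(1) l(1)] _ _ VD VD VD])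
      (simp_all add: l(2) lu(2) \<epsilon> d in_intros)
  have 2: "tensor_runit K D (tensor_map K D (base_vs K) id \<epsilon> (\<Delta> d)) =
      sweedler K D (\<Delta> d) (\<lambda>c1 c2. \<epsilon> c2 \<odot>\<^bsub>D\<^esub> c1)" if d: "d \<in> carrier D" for d
    by (rule sweedler_apply[OF module_hom_compose[OF ru(1) r(1)] _ _ VD VD VD])
      (simp_all add: r(2) ru(2) \<epsilon> d in_intros)
  \<comment> \<open>The outer sum opens \<Delta>(d). The inner one, over \<Delta>(c1), is supplied
    by evaluating the associator at a tensor whose first factor is not pure.\<close>
  have 3: "tensor_assoc K D D D (tensor_map K T D \<Delta> id (\<Delta> d)) =
      sweedler K (tensor K D T) (\<Delta> d) (\<lambda>c1 c2. sweedler K (tensor K D T) (\<Delta> c1) (\<lambda>c11 c12.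
        tens K D T c11 (tens K D D c12 c2)))" if d: "d \<in> carrier D" for d
    by (rule sweedler_apply[OF module_hom_compose[OF as(1) a(1)] _ _ VD VD])
      (simp_all add: a(2) as(2) d in_intros vectorspace_tensor VD)
  have 4: "tensor_map K D T id \<Delta> (\<Delta> d) =
      sweedler K (tensor K D T) (\<Delta> d) (\<lambda>c1 c2. tens K D T c1 (\<Delta> c2))" for d
    by (simp add: tensor_map_def)
  show ?thesis
    unfolding k_coalgebra_def using VD comult_hom counit_hom
    by (simp add: 1 2 3 4)
qed

section \<open>The braiding and the twisted product on D \<otimes> D\<close>

lemma braiding_hom: "lr_braiding K H D D \<in> module_hom K T T"
  and braiding_tens: "\<lbrakk>c \<in> carrier D; d \<in> carrier D\<rbrakk> \<Longrightarrow>
    lr_braiding K H D D (tens K D D c d) =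
      sweedler K T (lcoact D c) (\<lambda>g x. sweedler K T (rcoact D d) (\<lambda>y h.
        tens K D D (g \<rightharpoonup>\<^bsub>D\<^esub> y) (x \<leftharpoonup>\<^bsub>D\<^esub> h)))"
proof -
  have VT: "vectorspace K T" by (rule lr_intros)+
  have "bilinear_map K D D T (\<lambda>c d. sweedler K T (lcoact D c) (\<lambda>g x.
      sweedler K T (rcoact D d) (\<lambda>y h. tens K D D (g \<rightharpoonup>\<^bsub>D\<^esub> y) (x \<leftharpoonup>\<^bsub>D\<^esub> h))))"
    by (assumption | rule lr_intros)+
  note sweedler_hom[OF vectorspace_D vectorspace_D VT this]
    sweedler_tens[OF vectorspace_D vectorspace_D VT this]
  then show "lr_braiding K H D D \<in> module_hom K T T"
    and "\<lbrakk>c \<in> carrier D; d \<in> carrier D\<rbrakk> \<Longrightarrow>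
      lr_braiding K H D D (tens K D D c d) =
        sweedler K T (lcoact D c) (\<lambda>g x. sweedler K T (rcoact D d) (\<lambda>y h.
          tens K D D (g \<rightharpoonup>\<^bsub>D\<^esub> y) (x \<leftharpoonup>\<^bsub>D\<^esub> h)))"
    unfolding lr_braiding_def[abs_def] by simp_all
qed

text \<open>The evaluation is given for two pure tensors, where all four factors are visible.
  Linearity in each argument later extends it to the product of \<Delta>(c) and \<Delta>(d).\<close>

lemma mult_tensor_hom: "lr_mult_tensor K H D \<mu> \<in> module_hom K (tensor K T T) T" (is ?hom)
  and mult_tensor_tens: "\<lbrakk>a \<in> carrier D; b \<in> carrier D; c \<in> carrier D; d \<in> carrier D\<rbrakk> \<Longrightarrow>
    lr_mult_tensor K H D \<mu> (tens K T T (tens K D D a b) (tens K D D c d)) =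
      sweedler K T (lcoact D b) (\<lambda>g x. sweedler K T (rcoact D c) (\<lambda>y h.
        tens K D D (a \<otimes>\<^bsub>D\<^esub> (g \<rightharpoonup>\<^bsub>D\<^esub> y)) ((x \<leftharpoonup>\<^bsub>D\<^esub> h) \<otimes>\<^bsub>D\<^esub> d)))"
proof -
  note VD = vectorspace_D and VH = vectorspace_H
  have VT: "vectorspace K T" by (rule lr_intros)+
  have VDT: "vectorspace K (tensor K D T)" and VTD: "vectorspace K (tensor K T D)"
    by (rule lr_intros)+
  \<comment> \<open>\<open>W\<close> is the inner block of the middle braiding: on D \<otimes> (D
    \<otimes> D) it braids the first two factors and restores the bracketing.\<close>
  define W where "W = (\<lambda>s. tensor_assoc K D D D
    (tensor_map K T D (lr_braiding K H D D) id (tensor_assoc_inv K D D D s)))"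
  note as = tensor_assoc_hom[OF VD VD VD] and asi = tensor_assoc_inv_hom[OF VD VD VD]
    and as' = tensor_assoc_hom[OF VD VD VT] and asi' = tensor_assoc_inv_hom[OF VD VD VT]
    and br = tensor_map_hom[OF VT VD VT VD braiding_hom module_hom_id]
    and mm = tensor_map_hom[OF VT VT VD VD mult_map_hom mult_map_hom]
  have W: "W \<in> module_hom K (tensor K D T) (tensor K D T)"
    unfolding W_def
    by (rule module_hom_compose[OF as(1) module_hom_compose[OF br(1) asi(1)]])
  note idW = tensor_map_hom[OF VD VDT VD VDT module_hom_id W]
  have M: "lr_mult_tensor K H D \<mu> t = tensor_map K D D \<mu> \<mu> (tensor_assoc_inv K D D T
      (tensor_map K D (tensor K D T) id W (tensor_assoc K D D T t)))" for t
    by (simp add: lr_mult_tensor_def lr_middle_braiding_def W_def comp_def)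
  have "lr_mult_tensor K H D \<mu> = (\<lambda>t. tensor_map K D D \<mu> \<mu> (tensor_assoc_inv K D D T
      (tensor_map K D (tensor K D T) id W (tensor_assoc K D D T t))))"
    by (rule ext) (rule M)
  then show ?hom
    using module_hom_compose[OF mm(1) module_hom_compose[OF asi'(1) module_hom_compose[OF idW(1) as'(1)]]]
    by simp
  assume a: "a \<in> carrier D" and b: "b \<in> carrier D" and c: "c \<in> carrier D" and d: "d \<in> carrier D"
  \<comment> \<open>Up to the braiding all tensors are pure and the constraints only move brackets;
    the braiding returns a sum. \<open>\<Phi>\<close> collects everything done afterwards, with the
    outer factors a and d fixed. As one linear map it can be carried through both sums of the
    braiding.\<close>
  define \<Phi> where "\<Phi> = (\<lambda>s. tensor_map K D D \<mu> \<mu> (tensor_assoc_inv K D D T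
    (tens K D (tensor K D T) a (tensor_assoc K D D D (tens K T D s d)))))"
  have \<Phi>: "\<Phi> \<in> module_hom K T T"
    unfolding \<Phi>_def
    by (rule module_hom_compose[OF mm(1)] module_hom_compose[OF asi'(1)] module_hom_compose[OF as(1)]
        lr_intros a d)+
  have \<Phi>_tens: "\<Phi> (tens K D D y x) = tens K D D (a \<otimes>\<^bsub>D\<^esub> y) (x \<otimes>\<^bsub>D\<^esub> d)"
    if "y \<in> carrier D" "x \<in> carrier D" for x y
    unfolding \<Phi>_def using that a d VD VT
    by (simp add: tensor_assoc_tens tensor_assoc_inv_tens tens_in mm(2) mult_map_tens)
  have "W (tens K D T b (tens K D D c d)) =
      tensor_assoc K D D D (tens K T D (lr_braiding K H D D (tens K D D b c)) d)"
    unfolding W_def using b c d VD by (simp add: tensor_assoc_inv_tens br(2) tens_in)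
  then have "lr_mult_tensor K H D \<mu> (tens K T T (tens K D D a b) (tens K D D c d)) =
      \<Phi> (lr_braiding K H D D (tens K D D b c))"
    unfolding M \<Phi>_def using a b c d VD VT
    by (simp add: tensor_assoc_tens idW(2) tens_in)
  also have "\<dots> = sweedler K T (lcoact D b) (\<lambda>g x. sweedler K T (rcoact D c) (\<lambda>y h.
        tens K D D (a \<otimes>\<^bsub>D\<^esub> (g \<rightharpoonup>\<^bsub>D\<^esub> y)) ((x \<leftharpoonup>\<^bsub>D\<^esub> h) \<otimes>\<^bsub>D\<^esub> d)))"
    unfolding braiding_tens[OF b c]
  proof (rule sweedler_image[OF \<Phi>])
    fix g x assume g: "g \<in> carrier H" and x: "x \<in> carrier D"
    show "\<Phi> (sweedler K T (rcoact D c) (\<lambda>y h. tens K D D (g \<rightharpoonup>\<^bsub>D\<^esub> y) (x \<leftharpoonup>\<^bsub>D\<^esub> h))) =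
        sweedler K T (rcoact D c) (\<lambda>y h.
          tens K D D (a \<otimes>\<^bsub>D\<^esub> (g \<rightharpoonup>\<^bsub>D\<^esub> y)) ((x \<leftharpoonup>\<^bsub>D\<^esub> h) \<otimes>\<^bsub>D\<^esub> d))"
      by (rule sweedler_image[OF \<Phi>]) (assumption | rule \<Phi>_tens lr_intros b c g x)+
  qed (assumption | rule lr_intros b c)+
  finally show "lr_mult_tensor K H D \<mu> (tens K T T (tens K D D a b) (tens K D D c d)) =
      sweedler K T (lcoact D b) (\<lambda>g x. sweedler K T (rcoact D c) (\<lambda>y h.
        tens K D D (a \<otimes>\<^bsub>D\<^esub> (g \<rightharpoonup>\<^bsub>D\<^esub> y)) ((x \<leftharpoonup>\<^bsub>D\<^esub> h) \<otimes>\<^bsub>D\<^esub> d)))" .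
qed

section \<open>Comultiplication and counit as algebra maps\<close>

lemma comult_algebra_map_iff:
  "algebra_map K D \<mu> \<eta> T (lr_mult_tensor K H D \<mu>) (lr_unit_tensor K D \<eta>) \<Delta> \<longleftrightarrow>
    (\<forall>c\<in>carrier D. \<forall>d\<in>carrier D. \<Delta> (c \<otimes>\<^bsub>D\<^esub> d) =
      sweedler K T (\<Delta> c) (\<lambda>c1 c2. sweedler K T (\<Delta> d) (\<lambda>d1 d2.
      sweedler K T (lcoact D c2) (\<lambda>g x. sweedler K T (rcoact D d1) (\<lambda>y h.
        tens K D D (c1 \<otimes>\<^bsub>D\<^esub> (g \<rightharpoonup>\<^bsub>D\<^esub> y)) ((x \<leftharpoonup>\<^bsub>D\<^esub> h) \<otimes>\<^bsub>D\<^esub> d2)))))) \<and>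
    \<Delta> \<one>\<^bsub>D\<^esub> = tens K D D \<one>\<^bsub>D\<^esub> \<one>\<^bsub>D\<^esub>"
proof -
  note VD = vectorspace_D and VK = vectorspace_K
  have VT: "vectorspace K T" by (rule lr_intros)+
  let ?M = "lr_mult_tensor K H D \<mu>"
  note dd = tensor_map_hom[OF VD VD VT VT comult_hom comult_hom]
  have "(\<forall>t\<in>carrier T. \<Delta> (\<mu> t) = ?M (tensor_map K T T \<Delta> \<Delta> t)) \<longleftrightarrow>
      (\<forall>c\<in>carrier D. \<forall>d\<in>carrier D. \<Delta> (c \<otimes>\<^bsub>D\<^esub> d) =
      sweedler K T (\<Delta> c) (\<lambda>c1 c2. sweedler K T (\<Delta> d) (\<lambda>d1 d2.
      sweedler K T (lcoact D c2) (\<lambda>g x. sweedler K T (rcoact D d1) (\<lambda>y h.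
        tens K D D (c1 \<otimes>\<^bsub>D\<^esub> (g \<rightharpoonup>\<^bsub>D\<^esub> y)) ((x \<leftharpoonup>\<^bsub>D\<^esub> h) \<otimes>\<^bsub>D\<^esub> d2))))))"
  proof (rule tensor_ball_iff)
    show "(\<lambda>t. \<Delta> (\<mu> t)) \<in> module_hom K T T"
      by (rule module_hom_compose[OF comult_hom mult_map_hom])
    show "(\<lambda>t. ?M (tensor_map K T T \<Delta> \<Delta> t)) \<in> module_hom K T T"
      by (rule module_hom_compose[OF mult_tensor_hom dd(1)])
    fix c d assume c: "c \<in> carrier D" and d: "d \<in> carrier D"
    show "\<Delta> (\<mu> (tens K D D c d)) = \<Delta> (c \<otimes>\<^bsub>D\<^esub> d)"
      using c d by (simp add: mult_map_tens)
    have "?M (tens K T T (\<Delta> c) (\<Delta> d)) =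
        sweedler K T (\<Delta> c) (\<lambda>c1 c2. sweedler K T (\<Delta> d) (\<lambda>d1 d2.
        sweedler K T (lcoact D c2) (\<lambda>g x. sweedler K T (rcoact D d1) (\<lambda>y h.
          tens K D D (c1 \<otimes>\<^bsub>D\<^esub> (g \<rightharpoonup>\<^bsub>D\<^esub> y)) ((x \<leftharpoonup>\<^bsub>D\<^esub> h) \<otimes>\<^bsub>D\<^esub> d2)))))"
    \<comment> \<open>The product is linear in each argument. First \<Delta>(c) is opened with
      \<Delta>(d) fixed, then \<Delta>(d) with c1 \<otimes> c2 fixed, after which
      \<open>mult_tensor_tens\<close> applies. Stating F says which argument is being
      opened.\<close>
    proof (rule sweedler_apply[where F = "\<lambda>s. ?M (tens K T T s (\<Delta> d))"])
      fix c1 c2 assume c1: "c1 \<in> carrier D" and c2: "c2 \<in> carrier D"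
      show "?M (tens K T T (tens K D D c1 c2) (\<Delta> d)) = sweedler K T (\<Delta> d) (\<lambda>d1 d2.
          sweedler K T (lcoact D c2) (\<lambda>g x. sweedler K T (rcoact D d1) (\<lambda>y h.
            tens K D D (c1 \<otimes>\<^bsub>D\<^esub> (g \<rightharpoonup>\<^bsub>D\<^esub> y)) ((x \<leftharpoonup>\<^bsub>D\<^esub> h) \<otimes>\<^bsub>D\<^esub> d2))))"
        by (rule sweedler_apply[where F = "\<lambda>t. ?M (tens K T T (tens K D D c1 c2) t)"])
          (assumption | rule mult_tensor_tens module_hom_compose[OF mult_tensor_hom] lr_intros d c1 c2)+
    qed (assumption | rule module_hom_compose[OF mult_tensor_hom] lr_intros c d)+
    then show "?M (tensor_map K T T \<Delta> \<Delta> (tens K D D c d)) =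
        sweedler K T (\<Delta> c) (\<lambda>c1 c2. sweedler K T (\<Delta> d) (\<lambda>d1 d2.
        sweedler K T (lcoact D c2) (\<lambda>g x. sweedler K T (rcoact D d1) (\<lambda>y h.
          tens K D D (c1 \<otimes>\<^bsub>D\<^esub> (g \<rightharpoonup>\<^bsub>D\<^esub> y)) ((x \<leftharpoonup>\<^bsub>D\<^esub> h) \<otimes>\<^bsub>D\<^esub> d2)))))"
      using c d by (simp add: dd(2))
  qed (rule VD VT)+
  moreover have "(\<forall>a\<in>carrier K. \<Delta> (\<eta> a) = lr_unit_tensor K D \<eta> a) \<longleftrightarrow>
      \<Delta> \<one>\<^bsub>D\<^esub> = tens K D D \<one>\<^bsub>D\<^esub> \<one>\<^bsub>D\<^esub>"
  proof -
    interpret field K by (rule field)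
    \<comment> \<open>The unit of D \<otimes> D is \<eta> \<otimes> \<eta> at 1 \<otimes> a, so its
      first factor is constant and the expression is linear in a; comparison at a = 1 then
      suffices.\<close>
    have "lr_unit_tensor K D \<eta> a = tens K D D \<one>\<^bsub>D\<^esub> (\<eta> a)" if "a \<in> carrier K" for a
      using that tensor_map_hom(2)[OF VK VK VD VD unit_map_hom unit_map_hom, of "\<one>\<^bsub>K\<^esub>" a]
      by (simp add: lr_unit_tensor_def)
    then have "(\<forall>a\<in>carrier K. \<Delta> (\<eta> a) = lr_unit_tensor K D \<eta> a) \<longleftrightarrow>
        (\<forall>a\<in>carrier K. \<Delta> (\<eta> a) = tens K D D \<one>\<^bsub>D\<^esub> (\<eta> a))"
      by simp
    also have "\<dots> \<longleftrightarrow> \<Delta> \<one>\<^bsub>D\<^esub> = tens K D D \<one>\<^bsub>D\<^esub> \<one>\<^bsub>D\<^esub>"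
      by (subst base_vs_ball_iff[OF VT]) (rule lr_intros module_hom_compose[OF unit_map_hom] | simp)+
    finally show ?thesis .
  qed
  ultimately show ?thesis
    by (simp add: algebra_map_def)
qed

text \<open>The left unit constraint of k itself, k \<otimes> k \<rightarrow> k, is the
  multiplication of the unit object, and the identity is its unit map.\<close>

lemma counit_algebra_map_iff:
  "algebra_map K D \<mu> \<eta> (base_vs K) (tensor_lunit K (base_vs K)) id \<epsilon> \<longleftrightarrow>
    (\<forall>c\<in>carrier D. \<forall>d\<in>carrier D. \<epsilon> (c \<otimes>\<^bsub>D\<^esub> d) = \<epsilon> c \<otimes>\<^bsub>K\<^esub> \<epsilon> d) \<and> \<epsilon> \<one>\<^bsub>D\<^esub> = \<one>\<^bsub>K\<^esub>"
proof -
  note VD = vectorspace_D and VK = vectorspace_K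
  note ee = tensor_map_hom[OF VD VD VK VK counit_hom counit_hom]
  note lu = tensor_lunit_hom[OF field VK]
  have \<epsilon>: "\<epsilon> x \<in> carrier K" if "x \<in> carrier D" for x
    using module_hom_in[OF counit_hom that] by simp
  have smult: "a \<odot>\<^bsub>base_vs K\<^esub> b = a \<otimes>\<^bsub>K\<^esub> b" for a b
    by (simp add: base_vs_def)
  have "(\<forall>t\<in>carrier T. \<epsilon> (\<mu> t) =
        tensor_lunit K (base_vs K) (tensor_map K (base_vs K) (base_vs K) \<epsilon> \<epsilon> t)) \<longleftrightarrow>
      (\<forall>c\<in>carrier D. \<forall>d\<in>carrier D. \<epsilon> (c \<otimes>\<^bsub>D\<^esub> d) = \<epsilon> c \<otimes>\<^bsub>K\<^esub> \<epsilon> d)"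
    by (intro tensor_ball_iff[OF module_hom_compose[OF counit_hom mult_map_hom]
          module_hom_compose[OF lu(1) ee(1)] _ _ VD VD VK])
      (simp_all add: mult_map_tens ee(2) lu(2) smult \<epsilon>)
  moreover have "(\<forall>a\<in>carrier K. \<epsilon> (\<eta> a) = id a) \<longleftrightarrow> \<epsilon> \<one>\<^bsub>D\<^esub> = \<one>\<^bsub>K\<^esub>"
    by (subst base_vs_ball_iff[OF VK module_hom_compose[OF counit_hom unit_map_hom] module_hom_id]) simp
  ultimately show ?thesis
    by (simp add: algebra_map_def)
qed

text \<open>After rewriting with the equivalences, each conjunct on one side has a literal
  counterpart on the other. The bimodule, bicomodule and compatibility conditions are those of
  \<open>lr_object\<close>, and the twist condition is common to both sides. Only regrouping of
  conjunctions is left.\<close>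

lemma lr_admissible_iff:
  "lr_admissible K H D \<Delta> \<epsilon> \<longleftrightarrow> lr_bialgebra K H D \<mu> \<eta> \<Delta> \<epsilon> \<and> lr_twist_trivial K H D"
  unfolding lr_admissible_def lr_bialgebra_def lr_algebra_def lr_coalgebra_def lr_object_def
    bimodule_algebra_def bicomodule_coalgebra_def
    mult_map_lr_hom_iff unit_map_lr_hom_iff comult_lr_hom_iff counit_lr_hom_iff
    mult_map_assoc_iff mult_map_unit_iff k_algebra_iff k_coalgebra_iff
    comult_algebra_map_iff counit_algebra_map_iff
  by (intro iffI; elim conjE; intro conjI; assumption)

end

theorem proposition2p3:
  fixes K :: "('k, 'r) ring_scheme"
    and H :: "('k, 'h, 's) bialg_scheme"
    and D :: "('k, 'h, 'd, 'x) lr_space_scheme"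
    and \<Delta> :: "'d \<Rightarrow> ('k, 'd, 'd) tens"
    and \<epsilon> :: "'d \<Rightarrow> 'k"
  assumes "field K"
    and "bialgebra K H"
    and "vectorspace K D"
    and "bilinear_map K H D D (lact D)"
    and "bilinear_map K D H D (ract D)"
    and "lcoact D \<in> module_hom K D (tensor K H D)"
    and "rcoact D \<in> module_hom K D (tensor K D H)"
    and "bilinear_map K D D D (mult D)"
    and "\<one>\<^bsub>D\<^esub> \<in> carrier D"
    and "\<Delta> \<in> module_hom K D (tensor K D D)"
    and "\<epsilon> \<in> module_hom K D (base_vs K)"
  shows "lr_admissible K H D \<Delta> \<epsilon> \<longleftrightarrow>
    lr_bialgebra K H D (mult_map K D) (unit_map K D) \<Delta> \<epsilon> \<and>
    lr_twist_trivial K H D"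
  using assms by (intro lr_data.lr_admissible_iff lr_data.intro)

end
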